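(* Let $M,N,P$ be indecomposable $\mathbf{W}$-modules of the class $\mathcal{S}$ with $\deg M=\deg N=\deg P=\{0,1\}$. In the following, triples are considered up to isomorphism of each module and up to exchanging $M$ and $N$, and $u,v\in\mathbb{C}/\mathbb{Z}$, $\xi\in\mathbb{P}^1$. (i) If $(M,N,P)$ is of the form $(\Omega^0_u,\Omega^0_v,\Omega^1_{u+v})$, then $\dim\overline{\mathbf{B}}_{\mathbf{W}}(M\times N,P)=2$. (ii) If $(M,N,P)$ is of one of the forms $(\Omega^0_u,\Omega^0_{-u},\Omega^0_0)$, $(\Omega^0_u,\Omega^1_0,\Omega^1_u)$, $(\Omega^0_u,\Omega^0_{-u},A_\xi)$ with $\xi\neq\infty$, or $(B_\xi,\Omega^0_u,\Omega^1_u)$ with $\xi\ne\infty$, then $\dim\overline{\mathbf{B}}_{\mathbf{W}}(M\times N,P)=1$. (iii) Otherwise, $\overline{\mathbf{B}}_{\mathbf{W}}(M\times N,P)=0$.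
   Context: $\mathbf{W}$ is the Witt algebra with basis $L_n=z^{n+1}\frac{d}{dz}$ ($n\in\mathbb{Z}$), $[L_m,L_n]=(n-m)L_{m+n}$. For a $\mathbf{W}$-module $M$ put $M_s=\{m:L_0.m=sm\}$ and $\mathrm{Supp}\,M=\{s:M_s\neq0\}$. The class $\mathcal{S}$ consists of the $\mathbf{W}$-modules $M=\bigoplus_sM_s$ such that $\mathrm{Supp}\,M$ is exactly one $\mathbb{Z}$-coset of $\mathbb{C}$ and $\dim M_s=1$ for $s\in\mathrm{Supp}\,M$. Modules: - $\Omega^\delta_u$ ($\delta\in\mathbb{C}$, $u\in\mathbb{C}/\mathbb{Z}$): basis $(e^\delta_x)_{x\in u}$, $L_m.e^\delta_x=(m\delta+x)e^\delta_{x+m}$. - $A_{a,b}$: basis $(e^A_n)_{n\in\mathbb{Z}}$, $L_m.e^A_n=(m+n)e^A_{m+n}$ if $n\ne0$, $L_m.e^A_0=(am^2+bm)e^A_m$. - $B_{a,b}$: basis $(e^B_n)_{n\in\mathbb{Z}}$, $L_m.e^B_n=n\,e^B_{m+n}$ if $m+n\ne0$, $L_m.e^B_{-m}=(am^2+bm)e^B_0$. For $(a,b)\ne(0,0)$, $A_{a,b}$ and $B_{a,b}$ depend up to isomorphism only on the point $\xi\in\mathbb{P}^1$ with projective coordinates $(a,b)$ and are written $A_\xi$, $B_\xi$. Put $\infty=(0,1)$; then $A_\infty\cong\Omega^1_0$, $B_\infty\cong\Omega^0_0$, and $\Omega^0_u\cong\Omega^1_u$ for $u\ne0$. By the Kaplansky–Santharoubane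 theorem the indecomposable modules of the class $\mathcal{S}$ are, up to isomorphism, the $\Omega^\delta_u$, $A_\xi$, $B_\xi$. Degree: $\deg M=\{\delta\}$ if $M\cong\Omega^\delta_s$ for some $s$ with $\delta\in\mathbb{C}\setminus\{0,1\}$, and $\deg M=\{0,1\}$ otherwise. $\mathbf{B}_{\mathbf{W}}(M\times N,P)$ is the space of bilinear maps $\pi:M\times N\to P$ with $L.\pi(m,n)=\pi(L.m,n)+\pi(m,L.n)$ for all $L\in\mathbf{W}$. $\mathbf{B}^0_{\mathbf{W}}(M\times N,P)$ is the subspace of those $\pi$ vanishing on $M_{\ge x}\times N_{\ge x}$ for all sufficiently large $x\in\mathbb{R}$, where $M_{\ge x}=\bigoplus_{\Re s\ge x}M_s$. Finally $\overline{\mathbf{B}}_{\mathbf{W}}(M\times N,P)=\mathbf{B}_{\mathbf{W}}(M\times N,P)/\mathbf{B}^0_{\mathbf{W}}(M\times N,P)$. *)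

theory Defs
  imports Complex_Main "HOL-Library.Poly_Mapping" "HOL-Library.Function_Algebras"
begin

section \<open>The Witt algebra\<close>

text \<open>
  Finitely supported families \<open>int \<Rightarrow>\<^sub>0 complex\<close> serve as the complex vector space with a basis
  indexed by the integers; the basis vector of index \<open>n\<close> is \<open>Poly_Mapping.single n 1\<close>.
  (The convolution product that the library puts on this type is not used.)
\<close>

type_synonym witt = "int \<Rightarrow>\<^sub>0 complex"

definition pm_scale :: "complex \<Rightarrow> (int \<Rightarrow>\<^sub>0 complex) \<Rightarrow> (int \<Rightarrow>\<^sub>0 complex)" where
  "pm_scale c v = Poly_Mapping.map (\<lambda>a. c * a) v"

definition L :: "int \<Rightarrow> witt" where
  "L n = Poly_Mapping.single n 1"

text \<open>
  The bilinear map sending the pair of basis vectors of indices \<open>m\<close>, \<open>n\<close> to \<open>c m n\<close> times the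
  basis vector of index \<open>m + n\<close>.
\<close>

definition graded_bilin ::
  "(int \<Rightarrow> int \<Rightarrow> complex) \<Rightarrow> (int \<Rightarrow>\<^sub>0 complex) \<Rightarrow> (int \<Rightarrow>\<^sub>0 complex) \<Rightarrow> (int \<Rightarrow>\<^sub>0 complex)" where
  "graded_bilin c x v =
     (\<Sum>m\<in>Poly_Mapping.keys x. \<Sum>n\<in>Poly_Mapping.keys v.
        Poly_Mapping.single (m + n) (Poly_Mapping.lookup x m * Poly_Mapping.lookup v n * c m n))"

definition witt_bracket :: "witt \<Rightarrow> witt \<Rightarrow> witt" where
  "witt_bracket = graded_bilin (\<lambda>m n. of_int (n - m))"

section \<open>Modules over the Witt algebra\<close>

text \<open>The underlying space of a module is a whole type, an abelian group.\<close>

record 'm wmod =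
  scale :: "complex \<Rightarrow> 'm \<Rightarrow> 'm"
  act :: "witt \<Rightarrow> 'm \<Rightarrow> 'm"

definition witt_module :: "'m::ab_group_add wmod \<Rightarrow> bool" where
  "witt_module M \<longleftrightarrow>
     vector_space (scale M) \<and>
     (\<forall>x. Vector_Spaces.linear (scale M) (scale M) (act M x)) \<and>
     (\<forall>v. Vector_Spaces.linear pm_scale (scale M) (\<lambda>x. act M x v)) \<and>
     (\<forall>x y v. act M (witt_bracket x y) v = act M x (act M y v) - act M y (act M x v))"

definition witt_iso :: "'m::ab_group_add wmod \<Rightarrow> 'n::ab_group_add wmod \<Rightarrow> bool" (infix \<open>\<cong>\<^sub>W\<close> 50) where
  "M \<cong>\<^sub>W N \<longleftrightarrow>
     (\<exists>f. Vector_Spaces.linear (scale M) (scale N) f \<and> bij f \<and>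
          (\<forall>x v. f (act M x v) = act N x (f v)))"

definition submodule :: "'m::ab_group_add wmod \<Rightarrow> 'm set \<Rightarrow> bool" where
  "submodule M U \<longleftrightarrow> module.subspace (scale M) U \<and> (\<forall>x. \<forall>v\<in>U. act M x v \<in> U)"

definition indecomposable :: "'m::ab_group_add wmod \<Rightarrow> bool" where
  "indecomposable M \<longleftrightarrow>
     (UNIV :: 'm set) \<noteq> {0} \<and>
     (\<forall>U V. submodule M U \<and> submodule M V \<and> U \<inter> V = {0} \<and> {u + v |u v. u \<in> U \<and> v \<in> V} = UNIV
        \<longrightarrow> U = {0} \<or> V = {0})"

definition weight_space :: "'m::ab_group_add wmod \<Rightarrow> complex \<Rightarrow> 'm set" where
  "weight_space M s = {v. act M (L 0) v = scale M s v}"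

definition Supp :: "'m::ab_group_add wmod \<Rightarrow> complex set" where
  "Supp M = {s. weight_space M s \<noteq> {0}}"

text \<open>The second conjunct says that the module is the direct sum of its weight spaces.\<close>

definition class_S :: "'m::ab_group_add wmod \<Rightarrow> bool" where
  "class_S M \<longleftrightarrow>
     witt_module M \<and>
     (\<forall>v. \<exists>!c. finite {s. c s \<noteq> 0} \<and> (\<forall>s. c s \<in> weight_space M s) \<and> v = (\<Sum>s | c s \<noteq> 0. c s)) \<and>
     (\<exists>s. Supp M = {s + of_int n |n. True}) \<and>
     (\<forall>s\<in>Supp M. vector_space.dim (scale M) (weight_space M s) = 1)"

section \<open>The modules of the Kaplansky--Santharoubane list\<close>

text \<open>
  \<open>Omega \<delta> s\<close> is the module attached to \<open>\<delta>\<close> and to the coset \<open>u = s + \<int>\<close>: the basis vector of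
  index \<open>n\<close> is the one usually indexed by \<open>s + n \<in> u\<close>.  Another representative of the same coset
  gives an isomorphic module.
\<close>

definition Omega :: "complex \<Rightarrow> complex \<Rightarrow> (int \<Rightarrow>\<^sub>0 complex) wmod" where
  "Omega \<delta> s =
     \<lparr>scale = pm_scale, act = graded_bilin (\<lambda>m n. of_int m * \<delta> + (s + of_int n))\<rparr>"

definition A_mod :: "complex \<times> complex \<Rightarrow> (int \<Rightarrow>\<^sub>0 complex) wmod" where
  "A_mod = (\<lambda>(a, b).
     \<lparr>scale = pm_scale,
      act = graded_bilin (\<lambda>m n. if n \<noteq> 0 then of_int (m + n) else a * of_int m ^ 2 + b * of_int m)\<rparr>)"

definition B_mod :: "complex \<times> complex \<Rightarrow> (int \<Rightarrow>\<^sub>0 complex) wmod" where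
  "B_mod = (\<lambda>(a, b).
     \<lparr>scale = pm_scale,
      act = graded_bilin (\<lambda>m n. if m + n \<noteq> 0 then of_int n else a * of_int m ^ 2 + b * of_int m)\<rparr>)"

text \<open>
  A point of the projective line is given by projective coordinates, that is by a pair different
  from \<open>(0, 0)\<close>, considered up to a nonzero factor.
\<close>

definition same_point :: "complex \<times> complex \<Rightarrow> complex \<times> complex \<Rightarrow> bool" where
  "same_point \<xi> \<eta> \<longleftrightarrow> (\<exists>c. c \<noteq> 0 \<and> \<eta> = (c * fst \<xi>, c * snd \<xi>))"

definition infinity_point :: "complex \<times> complex" where
  "infinity_point = (0, 1)"

text \<open>
  The value \<open>\<delta>\<close> in the first case is determined by the isomorphism class of \<open>M\<close>, so the set there
  is the singleton \<open>{\<delta>}\<close>.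
\<close>

definition deg :: "'m::ab_group_add wmod \<Rightarrow> complex set" where
  "deg M =
     (if \<exists>\<delta> s. \<delta> \<notin> {0, 1} \<and> M \<cong>\<^sub>W Omega \<delta> s
      then {\<delta>. \<delta> \<notin> {0, 1} \<and> (\<exists>s. M \<cong>\<^sub>W Omega \<delta> s)}
      else {0, 1})"

section \<open>Equivariant bilinear maps and their germs\<close>

definition bilin_W ::
  "'m::ab_group_add wmod \<Rightarrow> 'n::ab_group_add wmod \<Rightarrow> 'p::ab_group_add wmod \<Rightarrow> ('m \<Rightarrow> 'n \<Rightarrow> 'p) set" where
  "bilin_W M N P =
     {\<pi>. (\<forall>m. Vector_Spaces.linear (scale N) (scale P) (\<pi> m)) \<and>
         (\<forall>n. Vector_Spaces.linear (scale M) (scale P) (\<lambda>m. \<pi> m n)) \<and>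
         (\<forall>x m n. act P x (\<pi> m n) = \<pi> (act M x m) n + \<pi> m (act N x n))}"

definition weight_ge :: "'m::ab_group_add wmod \<Rightarrow> real \<Rightarrow> 'm set" where
  "weight_ge M x = module.span (scale M) (\<Union>s\<in>{s. Re s \<ge> x}. weight_space M s)"

definition bilin_W0 ::
  "'m::ab_group_add wmod \<Rightarrow> 'n::ab_group_add wmod \<Rightarrow> 'p::ab_group_add wmod \<Rightarrow> ('m \<Rightarrow> 'n \<Rightarrow> 'p) set" where
  "bilin_W0 M N P =
     {\<pi> \<in> bilin_W M N P. \<forall>\<^sub>F x in at_top. \<forall>m\<in>weight_ge M x. \<forall>n\<in>weight_ge N x. \<pi> m n = 0}"

text \<open>
  The quotient \<open>V / W\<close> of a subspace \<open>V\<close> by a subspace \<open>W \<subseteq> V\<close> is the set of the cosets of \<open>W\<close> by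
  elements of \<open>V\<close>; its zero is \<open>W\<close>, and the linear combination with coefficients \<open>c i\<close> of the
  cosets of \<open>b i\<close> is the coset of the linear combination of the \<open>b i\<close>.  The dimension is \<open>n\<close>
  when the quotient has a basis of length \<open>n\<close>, here given by representatives
  \<open>b 0, \<dots>, b (n - 1)\<close>.  Coefficient families are taken to vanish from \<open>n\<close> on for the sake of
  uniqueness.
\<close>

definition coset :: "'v::ab_group_add set \<Rightarrow> 'v \<Rightarrow> 'v set" where
  "coset W v = {v + w |w. w \<in> W}"

definition quotient_space :: "'v::ab_group_add set \<Rightarrow> 'v set \<Rightarrow> 'v set set" where
  "quotient_space V W = coset W ` V"

definition quotient_has_dim ::
  "(complex \<Rightarrow> 'v \<Rightarrow> 'v) \<Rightarrow> 'v::ab_group_add set \<Rightarrow> 'v set \<Rightarrow> nat \<Rightarrow> bool" where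
  "quotient_has_dim sc V W n \<longleftrightarrow>
     (\<exists>b :: nat \<Rightarrow> 'v. (\<forall>i<n. b i \<in> V) \<and>
        (\<forall>q\<in>quotient_space V W.
           \<exists>!c :: nat \<Rightarrow> complex. (\<forall>i\<ge>n. c i = 0) \<and> q = coset W (\<Sum>i<n. sc (c i) (b i))))"

definition Bbar ::
  "'m::ab_group_add wmod \<Rightarrow> 'n::ab_group_add wmod \<Rightarrow> 'p::ab_group_add wmod \<Rightarrow> ('m \<Rightarrow> 'n \<Rightarrow> 'p) set set" where
  "Bbar M N P = quotient_space (bilin_W M N P) (bilin_W0 M N P)"

definition Bbar_has_dim ::
  "'m::ab_group_add wmod \<Rightarrow> 'n::ab_group_add wmod \<Rightarrow> 'p::ab_group_add wmod \<Rightarrow> nat \<Rightarrow> bool" where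
  "Bbar_has_dim M N P d \<longleftrightarrow>
     quotient_has_dim (\<lambda>c \<pi> m n. scale P c (\<pi> m n)) (bilin_W M N P) (bilin_W0 M N P) d"

section \<open>The exceptional triples\<close>

text \<open>
  Here \<open>s\<close>, \<open>t\<close> represent the cosets \<open>u\<close>, \<open>v\<close>.  The exchange of the first two modules is not
  included in these definitions.
\<close>

definition triple_i ::
  "'m::ab_group_add wmod \<Rightarrow> 'n::ab_group_add wmod \<Rightarrow> 'p::ab_group_add wmod \<Rightarrow> bool" where
  "triple_i M N P \<longleftrightarrow>
     (\<exists>s t. M \<cong>\<^sub>W Omega 0 s \<and> N \<cong>\<^sub>W Omega 0 t \<and> P \<cong>\<^sub>W Omega 1 (s + t))"

definition triple_ii ::
  "'m::ab_group_add wmod \<Rightarrow> 'n::ab_group_add wmod \<Rightarrow> 'p::ab_group_add wmod \<Rightarrow> bool" where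
  "triple_ii M N P \<longleftrightarrow>
     (\<exists>s. M \<cong>\<^sub>W Omega 0 s \<and> N \<cong>\<^sub>W Omega 0 (- s) \<and> P \<cong>\<^sub>W Omega 0 0) \<or>
     (\<exists>s. M \<cong>\<^sub>W Omega 0 s \<and> N \<cong>\<^sub>W Omega 1 0 \<and> P \<cong>\<^sub>W Omega 1 s) \<or>
     (\<exists>s \<xi>. \<xi> \<noteq> (0, 0) \<and> \<not> same_point \<xi> infinity_point \<and>
        M \<cong>\<^sub>W Omega 0 s \<and> N \<cong>\<^sub>W Omega 0 (- s) \<and> P \<cong>\<^sub>W A_mod \<xi>) \<or>
     (\<exists>s \<xi>. \<xi> \<noteq> (0, 0) \<and> \<not> same_point \<xi> infinity_point \<and>
        M \<cong>\<^sub>W B_mod \<xi> \<and> N \<cong>\<^sub>W Omega 0 s \<and> P \<cong>\<^sub>W Omega 1 s)"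

section \<open>Consistency of the definitions\<close>

lemma lookup_pm_scale [simp]: "Poly_Mapping.lookup (pm_scale c v) n = c * Poly_Mapping.lookup v n"
  by (simp add: pm_scale_def Poly_Mapping.map.rep_eq when_def)

lemma vector_space_pm_scale: "vector_space pm_scale"
  by unfold_locales (auto intro!: poly_mapping_eqI simp: algebra_simps lookup_add)

lemma graded_bilin_superset:
  assumes "finite X" "finite V" "Poly_Mapping.keys x \<subseteq> X" "Poly_Mapping.keys v \<subseteq> V"
  shows "graded_bilin c x v = (\<Sum>m\<in>X. \<Sum>n\<in>V.
    Poly_Mapping.single (m + n) (Poly_Mapping.lookup x m * Poly_Mapping.lookup v n * c m n))"
proof -
  let ?f = "\<lambda>m n. Poly_Mapping.single (m + n)
    (Poly_Mapping.lookup x m * Poly_Mapping.lookup v n * c m n)"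
  have "(\<Sum>m\<in>X. \<Sum>n\<in>V. ?f m n) = (\<Sum>m\<in>X. \<Sum>n\<in>Poly_Mapping.keys v. ?f m n)"
    using assms by (intro sum.cong refl sum.mono_neutral_right) (auto simp: in_keys_iff)
  also have "\<dots> = graded_bilin c x v"
    unfolding graded_bilin_def
    using assms by (intro sum.mono_neutral_right) (auto simp: in_keys_iff)
  finally show ?thesis by simp
qed

lemma pm_scale_single: "pm_scale c (Poly_Mapping.single n a) = Poly_Mapping.single n (c * a)"
  by (rule poly_mapping_eqI) (simp add: lookup_single when_def)

lemma pm_scale_add: "pm_scale c (x + y) = pm_scale c x + pm_scale c y"
  by (rule poly_mapping_eqI) (simp add: lookup_add algebra_simps)

lemma pm_scale_sum: "pm_scale c (\<Sum>i\<in>I. f i) = (\<Sum>i\<in>I. pm_scale c (f i))"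
proof (induction I rule: infinite_finite_induct)
  case (insert i I)
  then show ?case by (simp add: pm_scale_add)
qed (auto intro!: poly_mapping_eqI)

lemma keys_pm_scale: "Poly_Mapping.keys (pm_scale c v) \<subseteq> Poly_Mapping.keys v"
  by (auto simp: in_keys_iff)

lemma graded_bilin_add_left: "graded_bilin c (x + y) v = graded_bilin c x v + graded_bilin c y v"
proof -
  let ?X = "Poly_Mapping.keys x \<union> Poly_Mapping.keys y"
  have "Poly_Mapping.keys (x + y) \<subseteq> ?X" by (rule Poly_Mapping.keys_add)
  then show ?thesis
    by (simp add: graded_bilin_superset[where X = ?X and V = "Poly_Mapping.keys v"] lookup_add
        sum.distrib[symmetric] single_add[symmetric] algebra_simps)
qed

lemma graded_bilin_add_right: "graded_bilin c x (v + w) = graded_bilin c x v + graded_bilin c x w"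
proof -
  let ?V = "Poly_Mapping.keys v \<union> Poly_Mapping.keys w"
  have "Poly_Mapping.keys (v + w) \<subseteq> ?V" by (rule Poly_Mapping.keys_add)
  then show ?thesis
    by (simp add: graded_bilin_superset[where V = ?V and X = "Poly_Mapping.keys x"] lookup_add
        sum.distrib[symmetric] single_add[symmetric] algebra_simps)
qed

lemma graded_bilin_scale_left: "graded_bilin c (pm_scale a x) v = pm_scale a (graded_bilin c x v)"
  using keys_pm_scale[of a x]
  by (simp add: graded_bilin_superset[where X = "Poly_Mapping.keys x" and V = "Poly_Mapping.keys v"]
      pm_scale_sum pm_scale_single mult.assoc)

lemma graded_bilin_scale_right: "graded_bilin c x (pm_scale a v) = pm_scale a (graded_bilin c x v)"
  using keys_pm_scale[of a v]
  by (simp add: graded_bilin_superset[where X = "Poly_Mapping.keys x" and V = "Poly_Mapping.keys v"]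
      pm_scale_sum pm_scale_single mult_ac)

lemma graded_bilin_single:
  "graded_bilin c (Poly_Mapping.single m a) (Poly_Mapping.single n b) =
     Poly_Mapping.single (m + n) (a * b * c m n)"
  by (subst graded_bilin_superset[where X = "{m}" and V = "{n}"]) auto

lemma poly_mapping_additive_induct:
  fixes x :: "int \<Rightarrow>\<^sub>0 complex"
  assumes "P 0" "\<And>n a. P (Poly_Mapping.single n a)" "\<And>x y. P x \<Longrightarrow> P y \<Longrightarrow> P (x + y)"
  shows "P x"
proof -
  have "P (\<Sum>n\<in>I. Poly_Mapping.single n (Poly_Mapping.lookup x n))" if "finite I" for I
    using that by (induction I) (auto intro: assms)
  moreover have "x = (\<Sum>n\<in>Poly_Mapping.keys x. Poly_Mapping.single n (Poly_Mapping.lookup x n))"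
    by (rule poly_mapping_eqI) (auto simp: lookup_sum lookup_single when_def in_keys_iff)
  ultimately show ?thesis by (metis finite_keys)
qed

lemma graded_bilin_0 [simp]: "graded_bilin c 0 v = 0" "graded_bilin c x 0 = 0"
  by (simp_all add: graded_bilin_def)

lemma linear_graded_bilin:
  "Vector_Spaces.linear pm_scale pm_scale (graded_bilin c x)"
  "Vector_Spaces.linear pm_scale pm_scale (\<lambda>x. graded_bilin c x v)"
  by (auto intro!: vector_space_pm_scale simp: Vector_Spaces.linear_def module_hom_def module_hom_axioms_def
      module_iff_vector_space graded_bilin_add_left graded_bilin_add_right
      graded_bilin_scale_left graded_bilin_scale_right)

lemma witt_module_graded:
  assumes c: "\<And>m n j. of_int (n - m) * c (m + n) j = c n j * c m (n + j) - c m j * c n (m + j)"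
  shows "witt_module \<lparr>scale = pm_scale, act = graded_bilin c\<rparr>"
proof -
  have "graded_bilin c (witt_bracket x y) v =
      graded_bilin c x (graded_bilin c y v) - graded_bilin c y (graded_bilin c x v)" for x y v
  proof (induction v rule: poly_mapping_additive_induct)
    case (2 j d)
    show ?case
    proof (induction x rule: poly_mapping_additive_induct)
      case (2 m a)
      show ?case
      proof (induction y rule: poly_mapping_additive_induct)
        case (2 n b)
        have "a * b * d * (of_int (n - m) * c (m + n) j) =
            a * b * d * (c n j * c m (n + j) - c m j * c n (m + j))"
          by (simp only: c)
        then have "a * b * of_int (n - m) * d * c (m + n) j =
            a * (b * d * c n j) * c m (n + j) - b * (a * d * c m j) * c n (m + j)"
          by (simp add: algebra_simps)
        then show ?case
          by (simp add: witt_bracket_def graded_bilin_single single_diff[symmetric] ac_simps)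
      qed (simp_all add: witt_bracket_def graded_bilin_add_left graded_bilin_add_right)
    qed (simp_all add: witt_bracket_def graded_bilin_add_left graded_bilin_add_right)
  qed (simp_all add: graded_bilin_add_right)
  then show ?thesis
    by (simp add: witt_module_def vector_space_pm_scale linear_graded_bilin)
qed

lemma witt_module_Omega: "witt_module (Omega \<delta> s)"
  unfolding Omega_def by (rule witt_module_graded) (simp add: algebra_simps)

lemma witt_module_A_mod: "witt_module (A_mod \<xi>)"
proof (cases \<xi>)
  case (Pair a b)
  show ?thesis
    unfolding A_mod_def Pair prod.case
  proof (rule witt_module_graded, goal_cases)
    case (1 m n j)
    consider "j = 0" | "j \<noteq> 0" "n + j = 0" "m + j = 0" | "j \<noteq> 0" "n + j = 0" "m + j \<noteq> 0"
      | "j \<noteq> 0" "n + j \<noteq> 0" "m + j = 0" | "j \<noteq> 0" "n + j \<noteq> 0" "m + j \<noteq> 0"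
      by blast
    then show ?case
    proof cases
      case 1
      then show ?thesis
        by (cases "n = 0"; cases "m = 0") (simp_all add: algebra_simps power2_eq_square)
    next
      case 2
      then have "n = - j" "m = - j" by simp_all
      then show ?thesis by simp
    next
      case 3
      then have "n = - j" by simp
      with 3 show ?thesis by (simp add: algebra_simps)
    next
      case 4
      then have "m = - j" by simp
      with 4 show ?thesis by (simp add: algebra_simps)
    next
      case 5
      then show ?thesis by (simp add: algebra_simps)
    qed
  qed
qed

lemma witt_module_B_mod: "witt_module (B_mod \<xi>)"
proof (cases \<xi>)
  case (Pair a b)
  show ?thesis
    unfolding B_mod_def Pair prod.case
  proof (rule witt_module_graded, goal_cases)
    case (1 m n j)
    show ?case
    proof (cases "m + n + j = 0")
      case True
      then have j: "j = - m - n" by simp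
      show ?thesis
        unfolding j by (cases "m = 0"; cases "n = 0") (simp_all add: algebra_simps power2_eq_square)
    next
      case False
      then have ne: "m + (n + j) \<noteq> 0" "n + (m + j) \<noteq> 0" by simp_all
      consider "n + j = 0" "m + j = 0" | "n + j = 0" "m + j \<noteq> 0" | "n + j \<noteq> 0" "m + j = 0"
        | "n + j \<noteq> 0" "m + j \<noteq> 0"
        by blast
      then show ?thesis
      proof cases
        case 1
        then have "n = - j" "m = - j" by simp_all
        with False show ?thesis by simp
      next
        case 2
        then have "n = - j" by simp
        with 2 False show ?thesis by (simp add: algebra_simps)
      next
        case 3
        then have "m = - j" by simp
        with 3 False show ?thesis by (simp add: algebra_simps)
      next
        case 4
        with False ne show ?thesis by (simp add: algebra_simps)
      qed
    qed
  qed
qed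

lemma Omega_representative: "Omega \<delta> (s + of_int k) \<cong>\<^sub>W Omega \<delta> s"
proof -
  define T where "T k = graded_bilin (\<lambda>_ _. 1) (Poly_Mapping.single k 1)" for k
  have T_single: "T k (Poly_Mapping.single n a) = Poly_Mapping.single (k + n) a" for k n a
    by (simp add: T_def graded_bilin_single)
  have T_add: "T k (v + w) = T k v + T k w" for k v w
    by (simp add: T_def graded_bilin_add_right)
  have T_0: "T k 0 = 0" for k
    by (simp add: T_def)
  have inv: "T k (T l v) = v" if "k + l = 0" for k l v
  proof (induction v rule: poly_mapping_additive_induct)
    case (2 n a)
    show ?case using that by (simp add: T_single add.assoc[symmetric])
  qed (simp_all add: T_add T_0)
  have "bij (T k)"
    by (rule o_bij[where g = "T (- k)"]) (auto simp: inv fun_eq_iff)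
  moreover have "Vector_Spaces.linear pm_scale pm_scale (T k)"
    unfolding T_def by (rule linear_graded_bilin)
  moreover have "T k (act (Omega \<delta> (s + of_int k)) x v) = act (Omega \<delta> s) x (T k v)" for x v
  proof (induction v rule: poly_mapping_additive_induct)
    case (2 n b)
    show ?case
    proof (induction x rule: poly_mapping_additive_induct)
      case (2 m a)
      show ?case
        by (simp add: Omega_def graded_bilin_single T_single ac_simps)
    qed (simp_all add: Omega_def T_add T_0 graded_bilin_add_left)
  qed (simp_all add: Omega_def T_add T_0 graded_bilin_add_right)
  ultimately show ?thesis
    unfolding witt_iso_def by (intro exI[of _ "T k"]) (simp add: Omega_def)
qed

end

theory Submission
  imports Defs "HOL-Computational_Algebra.Polynomial"
begin

text \<open>
  A module of the class $\mathcal{S}$ is given by coefficients with $L_m e_n = c(m,n)\, e_{m+n}$, and a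
  nonzero equivariant map by coefficients with $\pi(e_i, e_j) = k(i,j)\, e_{i+j}$.

  For large weights the scalars by which $L_{\pm 1}$, $L_{\pm 2}$ act force the module to coincide with
  some $\Omega^\delta_s$, and the action of the weight-zero part of the enveloping algebra on all weight
  spaces is determined by this germ. This recovers the module wherever $\Omega^\delta_s$ is
  irreducible; for $\delta \in \{0, 1\}$ and integral weights only the coefficients at weight $0$
  are left, and they satisfy a functional equation with quadratic solutions.

  In degree $\{0, 1\}$ all modules agree, up to rescaling of the basis, with $\Omega^0$ away from
  weight $0$, so for weights $x$, $y$ large the equations for $L_1$ and $L_2$ leave only
  $k = \alpha x + \beta y$, and this formula propagates to all nonzero weights. The equations involving
  weight $0$ then give $\beta = 0$, $\alpha = 0$ or $\alpha = \beta$ when the first factor, the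
  second factor or the target is not generic, and $\alpha = \beta = 0$ for $A_\xi$ as a factor
  or $B_\xi$ as a target with $\xi \neq \infty$.
\<close>

section \<open>Modules with one-dimensional weight spaces\<close>

text \<open>A basis of weight vectors is determined only up to a nonzero factor in each weight, so a
  single coefficient has no intrinsic meaning; the scalars of products of the \<open>L m\<close>
  that return to their starting weight do. The obstacle is that \<open>L 1\<close> may vanish at a
  few weights, so the basis cannot be normalized by \<open>L 1\<close> everywhere. This is the
  reason for working at large weights first and carrying the information back along closed paths.

  For bilinear maps the factors are written in Omega^0 form and the target in Omega^1 form; off
  weight 0 the differential identifies the two. If x and y are the weights of the factors,
  \<open>\<alpha> * x + \<beta> * y\<close> is the coefficient of \<alpha> g df + \<beta> f dg. A
  factor B_\<xi> is compatible with g df because df kills its weight-0 line, where the parameter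
  sits. A target A_\<xi> is compatible with d(fg) because that map has no component in weight 0. The
  two remaining families of dimension one are the product fg of functions and the product of a
  function with a one-form.\<close>

lemma linear_mapD:
  assumes "Vector_Spaces.linear s1 s2 f"
  shows "f (x + y) = f x + f y" "f (s1 a x) = s2 a (f x)" "f (x - y) = f x - f y" "f 0 = 0"
proof -
  show add: "f (x + y) = f x + f y" for x y
    using assms by (simp add: Vector_Spaces.linear_iff)
  show "f (s1 a x) = s2 a (f x)"
    using assms by (simp add: Vector_Spaces.linear_iff)
  show "f (x - y) = f x - f y"
    using add[of "x - y" y] by simp
  show "f 0 = 0"
    using add[of 0 0] by simp
qed

lemma witt_iso_sym:
  assumes "M \<cong>\<^sub>W N" shows "N \<cong>\<^sub>W M"
proof -
  from assms obtain f where f: "Vector_Spaces.linear (scale M) (scale N) f" "bij f"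
    "\<And>x v. f (act M x v) = act N x (f v)"
    unfolding witt_iso_def by blast
  define g where "g = inv f"
  have fg: "f (g y) = y" and gf: "g (f y') = y'" for y y'
    using f(2) by (simp_all add: g_def bij_is_surj surj_f_inv_f bij_is_inj inv_f_f)
  have "g (x + y) = g x + g y" "g (scale N c x) = scale M c (g x)" "g (act N a x) = act M a (g x)"
    for x y c a
    using gf[of "g x + g y"] gf[of "scale M c (g x)"] gf[of "act M a (g x)"]
    by (simp_all add: linear_mapD[OF f(1)] f(3) fg)
  moreover have "bij g"
    using f(2) by (simp add: g_def bij_imp_bij_inv)
  ultimately show ?thesis
    using f(1) unfolding witt_iso_def Vector_Spaces.linear_iff by blast
qed

lemma witt_iso_trans [trans]:
  assumes "M \<cong>\<^sub>W N" "N \<cong>\<^sub>W P" shows "M \<cong>\<^sub>W P"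
proof -
  from assms obtain f g where f: "Vector_Spaces.linear (scale M) (scale N) f" "bij f"
      "\<And>x v. f (act M x v) = act N x (f v)"
    and g: "Vector_Spaces.linear (scale N) (scale P) g" "bij g"
      "\<And>x v. g (act N x v) = act P x (g v)"
    unfolding witt_iso_def by blast
  then have "Vector_Spaces.linear (scale M) (scale P) (g \<circ> f)" "bij (g \<circ> f)"
    "\<And>x v. (g \<circ> f) (act M x v) = act P x ((g \<circ> f) v)"
    by (auto simp: Vector_Spaces.linear_iff intro: bij_comp)
  then show ?thesis
    unfolding witt_iso_def by blast
qed

lemma ex1_witnesses_eq: "\<exists>!x. Q x \<Longrightarrow> Q a \<Longrightarrow> Q b \<Longrightarrow> a = b"
  by blast

section \<open>Modules given by structure coefficients\<close>

definition graded_module :: "(int \<Rightarrow> int \<Rightarrow> complex) \<Rightarrow> (int \<Rightarrow>\<^sub>0 complex) wmod" where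
  "graded_module c = \<lparr>scale = pm_scale, act = graded_bilin c\<rparr>"

abbreviation unit_vec :: "int \<Rightarrow> (int \<Rightarrow>\<^sub>0 complex)" where
  "unit_vec n \<equiv> Poly_Mapping.single n 1"

lemma scale_graded_module [simp]: "scale (graded_module c) = pm_scale"
  and act_graded_module [simp]: "act (graded_module c) = graded_bilin c"
  by (simp_all add: graded_module_def)

lemma linear_pm_eqI:
  assumes "Vector_Spaces.linear pm_scale s f" "Vector_Spaces.linear pm_scale s g"
    and "\<And>n. f (unit_vec n) = g (unit_vec n)"
  shows "f v = g v"
proof (induction v rule: poly_mapping_additive_induct)
  case 1
  then show ?case
    by (simp add: linear_mapD[OF assms(1)] linear_mapD[OF assms(2)])
next
  case (2 n a)
  have "Poly_Mapping.single n a = pm_scale a (unit_vec n)"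
    by (simp add: pm_scale_single)
  then show ?case
    by (simp only: linear_mapD[OF assms(1)] linear_mapD[OF assms(2)] assms(3))
next
  case (3 x y)
  then show ?case
    by (simp only: linear_mapD[OF assms(1)] linear_mapD[OF assms(2)])
qed

lemma lookup_graded_bilin_L:
  "Poly_Mapping.lookup (graded_bilin c (L m) v) i = Poly_Mapping.lookup v (i - m) * c m (i - m)"
proof (induction v rule: poly_mapping_additive_induct)
  case (2 n a)
  then show ?case
    by (auto simp: L_def graded_bilin_single lookup_single when_def)
qed (simp_all add: graded_bilin_add_right lookup_add algebra_simps)

text \<open>The isomorphism sends \<open>unit_vec n\<close> to \<open>g n\<close> times
  \<open>unit_vec (n + k)\<close>; the hypothesis \<open>eq\<close> is its equivariance on basis
  vectors.\<close>

lemma graded_module_iso_of_basis_change: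
  assumes g: "\<And>n. g n \<noteq> 0"
    and eq: "\<And>m n. g n * c m (n + k) = c' m n * g (n + m)"
  shows "graded_module c' \<cong>\<^sub>W graded_module c"
proof -
  define T where "T = graded_bilin (\<lambda>_ n. g n) (unit_vec k)"
  define T' where "T' = graded_bilin (\<lambda>_ n. 1 / g (n - k)) (unit_vec (- k))"
  have T_single: "T (Poly_Mapping.single n a) = Poly_Mapping.single (k + n) (a * g n)" for n a
    by (simp add: T_def graded_bilin_single)
  have T'_single: "T' (Poly_Mapping.single n a) = Poly_Mapping.single (n - k) (a / g (n - k))" for n a
    by (simp add: T'_def graded_bilin_single)
  have T_add: "T (v + w) = T v + T w" "T' (v + w) = T' v + T' w" "T 0 = 0" "T' 0 = 0" for v w
    by (simp_all add: T_def T'_def graded_bilin_add_right)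
  have "T (T' v) = v" for v
  proof (induction v rule: poly_mapping_additive_induct)
    case (2 n a)
    then show ?case using g by (simp add: T_single T'_single)
  qed (simp_all add: T_add)
  moreover have "T' (T v) = v" for v
  proof (induction v rule: poly_mapping_additive_induct)
    case (2 n a)
    then show ?case using g by (simp add: T_single T'_single)
  qed (simp_all add: T_add)
  ultimately have "bij T"
    by (intro o_bij[where g = T']) (auto simp: fun_eq_iff)
  moreover have "Vector_Spaces.linear pm_scale pm_scale T"
    unfolding T_def by (rule linear_graded_bilin)
  moreover have "T (graded_bilin c' x v) = graded_bilin c x (T v)" for x v
  proof (induction v rule: poly_mapping_additive_induct)
    case (2 n b)
    show ?case
    proof (induction x rule: poly_mapping_additive_induct)
      case (2 m a)
      have "g n * c m (k + n) = c' m n * g (m + n)"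
        using eq[of n m] by (simp add: add.commute)
      then show ?case
        by (simp add: graded_bilin_single T_single ac_simps)
    qed (simp_all add: T_add graded_bilin_add_left)
  qed (simp_all add: T_add graded_bilin_add_right)
  ultimately show ?thesis
    unfolding witt_iso_def by (intro exI[of _ T]) simp
qed

lemma graded_module_iso_gauge:
  assumes "\<And>n. g n \<noteq> 0" "\<And>m n. g n * c m n = c' m n * g (n + m)"
  shows "graded_module c \<cong>\<^sub>W graded_module c'"
  using graded_module_iso_of_basis_change[of g c 0 c'] assms by (simp add: witt_iso_sym)

lemma Omega_eq_graded: "Omega d s = graded_module (\<lambda>m n. of_int m * d + (s + of_int n))"
  by (simp add: Omega_def graded_module_def)

lemma A_mod_eq_graded: "A_mod (a, b) =
    graded_module (\<lambda>m n. if n \<noteq> 0 then of_int (m + n) else a * of_int m ^ 2 + b * of_int m)"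
  by (simp add: A_mod_def graded_module_def)

lemma B_mod_eq_graded: "B_mod (a, b) =
    graded_module (\<lambda>m n. if m + n \<noteq> 0 then of_int n else a * of_int m ^ 2 + b * of_int m)"
  by (simp add: B_mod_def graded_module_def)

definition witt_coeffs :: "complex \<Rightarrow> (int \<Rightarrow> int \<Rightarrow> complex) \<Rightarrow> bool" where
  "witt_coeffs s c \<longleftrightarrow> (\<forall>n. c 0 n = s + of_int n) \<and>
     (\<forall>m n j. of_int (n - m) * c (m + n) j = c n j * c m (n + j) - c m j * c n (m + j))"

lemma witt_iso_of_frame:
  fixes M :: "'m::ab_group_add wmod"
  assumes M: "witt_module M"
    and F: "Vector_Spaces.linear pm_scale (scale M) F" "bij F"
    and FL: "\<And>m n. F (graded_bilin c (L m) (unit_vec n)) = act M (L m) (F (unit_vec n))"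
  shows "M \<cong>\<^sub>W graded_module c"
proof -
  have linM: "Vector_Spaces.linear (scale M) (scale M) (act M x)"
    "Vector_Spaces.linear pm_scale (scale M) (\<lambda>x. act M x v)" for x v
    using M by (auto simp: witt_module_def)
  have 1: "F (graded_bilin c x v) = act M x (F v)" for x v
  proof (rule linear_pm_eqI[where s = "scale M" and v = v])
    show "Vector_Spaces.linear pm_scale (scale M) (\<lambda>v. F (graded_bilin c x v))"
      using F(1) linear_graded_bilin(1)[of c x] by (auto simp: Vector_Spaces.linear_iff)
    show "Vector_Spaces.linear pm_scale (scale M) (\<lambda>v. act M x (F v))"
      using F(1) linM(1)[of x] by (auto simp: Vector_Spaces.linear_iff)
    show "F (graded_bilin c x (unit_vec n)) = act M x (F (unit_vec n))" for n
    proof (rule linear_pm_eqI[where s = "scale M" and v = x])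
      show "Vector_Spaces.linear pm_scale (scale M) (\<lambda>x. F (graded_bilin c x (unit_vec n)))"
        using F(1) linear_graded_bilin(2)[of c "unit_vec n"] by (auto simp: Vector_Spaces.linear_iff)
      show "Vector_Spaces.linear pm_scale (scale M) (\<lambda>x. act M x (F (unit_vec n)))"
        by (rule linM(2))
    qed (use FL in \<open>simp add: L_def\<close>)
  qed
  have "graded_module c \<cong>\<^sub>W M"
    unfolding witt_iso_def using F 1 by (intro exI[of _ F]) simp
  then show ?thesis
    by (rule witt_iso_sym)
qed

lemma witt_coeffs_of_iso:
  assumes M: "witt_module M" and iso: "M \<cong>\<^sub>W graded_module c"
    and c0: "\<And>n. c 0 n = s + of_int n"
  shows "witt_coeffs s c"
proof -
  from witt_iso_sym[OF iso] obtain f where f: "Vector_Spaces.linear pm_scale (scale M) f" "bij f"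
    "\<And>x v. f (graded_bilin c x v) = act M x (f v)"
    unfolding witt_iso_def by auto
  have "graded_bilin c (witt_bracket x y) v =
      graded_bilin c x (graded_bilin c y v) - graded_bilin c y (graded_bilin c x v)" for x y v
  proof -
    have "f (graded_bilin c (witt_bracket x y) v) =
        f (graded_bilin c x (graded_bilin c y v) - graded_bilin c y (graded_bilin c x v))"
      using M by (simp add: f(3) linear_mapD[OF f(1)] witt_module_def)
    then show ?thesis
      using f(2) by (simp add: bij_is_inj inj_eq)
  qed
  from this[of "L m" "L n" "unit_vec j" for m n j]
  have "Poly_Mapping.lookup (graded_bilin c (witt_bracket (L m) (L n)) (unit_vec j)) (m + n + j) =
      Poly_Mapping.lookup (graded_bilin c (L m) (graded_bilin c (L n) (unit_vec j)) -
       graded_bilin c (L n) (graded_bilin c (L m) (unit_vec j))) (m + n + j)" for m n j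
    by simp
  then have "of_int (n - m) * c (m + n) j = c n j * c m (n + j) - c m j * c n (m + j)" for m n j
    by (simp add: L_def witt_bracket_def graded_bilin_single lookup_minus lookup_single ac_simps)
  then show ?thesis
    using c0 by (simp add: witt_coeffs_def)
qed

section \<open>Coordinates for a module of the class S\<close>

lemma class_S_Supp_weight:
  assumes "class_S M"
  obtains s where "s = 0 \<or> s \<notin> \<int>" "Supp M = {s + of_int n |n. True}"
proof -
  from assms obtain s where s: "Supp M = {s + of_int n |n. True}"
    by (auto simp: class_S_def)
  \<comment> \<open>The integral coset gets the representative 0, so that index 0 is weight 0, the
    only weight where coefficients need special treatment later.\<close>
  show thesis
  proof (cases "s \<in> \<int>")
    case True
    then obtain k where k: "s = of_int k"
      by (auto elim: Ints_cases)
    have "x \<in> Supp M \<longleftrightarrow> x \<in> {0 + of_int n |n. True}" for x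
    proof
      assume "x \<in> Supp M"
      then obtain n where "x = of_int k + of_int n"
        using s k by auto
      then have "x = 0 + of_int (k + n)" by simp
      then show "x \<in> {0 + of_int n |n. True}" by blast
    next
      assume "x \<in> {0 + of_int n |n. True}"
      then obtain n where "x = of_int n" by auto
      then have "x = s + of_int (n - k)" by (simp add: k)
      then show "x \<in> Supp M" using s by blast
    qed
    then show ?thesis
      using that[of 0] by blast
  qed (use s that in blast)
qed

lemma (in vector_space) dim_1_span:
  assumes "subspace W" "dim W = 1"
  obtains v where "v \<in> W" "v \<noteq> 0" "\<And>w. w \<in> W \<Longrightarrow> \<exists>a. w = scale a v"
proof -
  obtain B where B: "B \<subseteq> W" "independent B" "W \<subseteq> span B" "card B = dim W"
    using basis_exists by blast
  then obtain v where v: "B = {v}"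
    using assms(2) by (auto simp: card_1_singleton_iff)
  then have "v \<noteq> 0"
    using B(2) dependent_zero by blast
  moreover have "\<exists>a. w = scale a v" if "w \<in> W" for w
    using B(3) that unfolding v span_singleton by auto
  ultimately show thesis
    using that B(1) v by blast
qed

text \<open>One nonzero vector is chosen in each weight space, and \<open>F\<close> is the linear
  map sending \<open>unit_vec n\<close> to it. Uniqueness of the weight decomposition makes
  \<open>F\<close> injective, existence makes it surjective.\<close>

lemma class_S_graded:
  fixes M :: "'m::ab_group_add wmod"
  assumes "class_S M"
  obtains s c where "s = 0 \<or> s \<notin> \<int>" "M \<cong>\<^sub>W graded_module c" "witt_coeffs s c"
proof -
  from class_S_Supp_weight[OF assms] obtain s where s: "s = 0 \<or> s \<notin> \<int>"
    and Supp: "Supp M = {s + of_int n |n. True}" by blast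
  have M: "witt_module M"
    using assms unfolding class_S_def by (elim conjE)
  have dec: "\<And>v. \<exists>!c. finite {s. c s \<noteq> 0} \<and> (\<forall>s. c s \<in> weight_space M s) \<and> v = (\<Sum>s | c s \<noteq> 0. c s)"
    using assms unfolding class_S_def by (elim conjE) (erule spec)
  have dim: "\<And>s. s \<in> Supp M \<Longrightarrow> vector_space.dim (scale M) (weight_space M s) = 1"
    using assms unfolding class_S_def by (elim conjE) (erule bspec)
  interpret vs: vector_space "scale M"
    using M by (simp add: witt_module_def)
  have linM: "Vector_Spaces.linear (scale M) (scale M) (act M x)"
    "Vector_Spaces.linear pm_scale (scale M) (\<lambda>x. act M x v)" for x v
    using M by (auto simp: witt_module_def)
  have act_add: "act M x (v + w) = act M x v + act M x w"
    and act_scale: "act M x (scale M a v) = scale M a (act M x v)"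
    and act_0: "act M x 0 = 0" for x v w a
    by (simp_all add: linear_mapD[OF linM(1)])
  have sub: "vs.subspace (weight_space M t)" for t
    by (auto simp: vs.subspace_def weight_space_def act_add act_scale act_0 vs.scale_right_distrib
        vs.scale_left_commute)
  define Q where "Q n v \<longleftrightarrow> v \<in> weight_space M (s + of_int n) \<and> v \<noteq> 0 \<and>
      (\<forall>w\<in>weight_space M (s + of_int n). \<exists>a. w = scale M a v)" for n v
  have "\<exists>v. Q n v" for n
  proof -
    have "s + of_int n \<in> Supp M"
      using Supp by blast
    from vs.dim_1_span[OF sub dim[OF this]] obtain v where "v \<in> weight_space M (s + of_int n)"
      "v \<noteq> 0" "\<And>w. w \<in> weight_space M (s + of_int n) \<Longrightarrow> \<exists>a. w = scale M a v"
      by auto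
    then show ?thesis
      unfolding Q_def by (intro exI[of _ v]) simp
  qed
  then obtain v where "\<And>n. Q n (v n)"
    by metis
  then have v: "\<And>n. v n \<in> weight_space M (s + of_int n)" "\<And>n. v n \<noteq> 0"
    "\<And>n w. w \<in> weight_space M (s + of_int n) \<Longrightarrow> \<exists>a. w = scale M a (v n)"
    by (simp_all add: Q_def)
  define F where "F p = (\<Sum>n\<in>Poly_Mapping.keys p. scale M (Poly_Mapping.lookup p n) (v n))" for p
  have F_sup: "F p = (\<Sum>n\<in>X. scale M (Poly_Mapping.lookup p n) (v n))"
    if "finite X" "Poly_Mapping.keys p \<subseteq> X" for p X
    unfolding F_def using that by (intro sum.mono_neutral_left) (auto simp: in_keys_iff)
  have linF: "Vector_Spaces.linear pm_scale (scale M) F"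
    unfolding Vector_Spaces.linear_iff
  proof (intro conjI allI)
    show "vector_space (scale M)" by (rule vs.vector_space_axioms)
    show "vector_space pm_scale" by (rule vector_space_pm_scale)
    show "F (x + y) = F x + F y" for x y
    proof -
      let ?X = "Poly_Mapping.keys x \<union> Poly_Mapping.keys y"
      have "Poly_Mapping.keys (x + y) \<subseteq> ?X" by (rule Poly_Mapping.keys_add)
      then show ?thesis
        by (simp add: F_sup[of ?X] lookup_add vs.scale_left_distrib sum.distrib)
    qed
    show "F (pm_scale a x) = scale M a (F x)" for a x
      using keys_pm_scale[of a x]
      by (simp add: F_sup[of "Poly_Mapping.keys x"] vs.scale_sum_right)
  qed
  have F_unit: "F (unit_vec n) = v n" for n
    by (simp add: F_def)
  have "inj F"
  proof -
    have "p = 0" if "F p = 0" for p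
    proof -
      \<comment> \<open>The weight components of \<open>F p\<close>, indexed by weights instead of
        integers. If \<open>F p = 0\<close>, this family and the zero family both decompose 0, hence
        coincide.\<close>
      define c where "c t = (if \<exists>n. t = s + of_int n
        then scale M (Poly_Mapping.lookup p (THE n. t = s + of_int n)) (v (THE n. t = s + of_int n)) else 0)" for t
      have c_at: "c (s + of_int n) = scale M (Poly_Mapping.lookup p n) (v n)" for n
        by (auto simp: c_def)
      have supp: "{t. c t \<noteq> 0} = (\<lambda>n. s + of_int n) ` Poly_Mapping.keys p"
      proof safe
        fix t assume "c t \<noteq> 0"
        then obtain n where n: "t = s + of_int n" by (auto simp: c_def split: if_splits)
        then have "n \<in> Poly_Mapping.keys p"
          using \<open>c t \<noteq> 0\<close> c_at[of n] by (auto simp: in_keys_iff)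
        then show "t \<in> (\<lambda>n. s + of_int n) ` Poly_Mapping.keys p" using n by blast
      next
        fix n assume "n \<in> Poly_Mapping.keys p" "c (s + of_int n) = 0"
        then show False using v(2)[of n] by (simp add: c_at in_keys_iff)
      qed
      have c_weight: "c t \<in> weight_space M t" for t
      proof (cases "\<exists>n. t = s + of_int n")
        case True
        then obtain n where "t = s + of_int n" by blast
        then show ?thesis
          using vs.subspace_scale[OF sub v(1)] by (simp add: c_at)
      next
        case False
        then show ?thesis by (simp add: c_def vs.subspace_0[OF sub])
      qed
      have "(\<Sum>t | c t \<noteq> 0. c t) = F p"
        unfolding supp F_def by (subst sum.reindex) (auto simp: inj_on_def c_at)
      then have "finite {t. c t \<noteq> 0} \<and> (\<forall>t. c t \<in> weight_space M t) \<and> 0 = (\<Sum>t | c t \<noteq> 0. c t)"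
        using supp c_weight that by simp
      moreover have "finite {t. (\<lambda>_. 0::'m) t \<noteq> 0} \<and> (\<forall>t. (\<lambda>_. 0::'m) t \<in> weight_space M t) \<and>
          0 = (\<Sum>t | (\<lambda>_. 0::'m) t \<noteq> 0. (\<lambda>_. 0::'m) t)"
        by (simp add: vs.subspace_0[OF sub])
      ultimately have "c = (\<lambda>_. 0)"
        by (rule ex1_witnesses_eq[OF dec])
      then have "scale M (Poly_Mapping.lookup p n) (v n) = 0" for n
        using c_at[of n] by simp
      then show "p = 0"
        using v(2) by (auto intro!: poly_mapping_eqI)
    qed
    from this[of "x - y" for x y] show ?thesis
      by (auto simp: inj_on_def linear_mapD[OF linF])
  qed
  moreover have "surj F"
  proof -
    have F_ex: "\<exists>p. w = F p" if "w \<in> weight_space M t" for w t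
    proof (cases "w = 0")
      case True
      then show ?thesis by (intro exI[of _ 0]) (simp add: F_def)
    next
      case False
      then have "t \<in> Supp M" using that vs.subspace_0[OF sub] by (auto simp: Supp_def)
      then obtain n where n: "t = s + of_int n" using Supp by auto
      then obtain a where "w = scale M a (v n)" using v(3) \<open>w \<in> _\<close> by blast
      then have "w = F (Poly_Mapping.single n a)"
        by (cases "a = 0") (simp_all add: F_def)
      then show ?thesis by blast
    qed
    have F_sum: "\<exists>p. (\<Sum>t\<in>I. c t) = F p" if "finite I" and wt: "\<And>t. c t \<in> weight_space M t" for I c
      using that(1)
    proof (induction I)
      case empty
      then show ?case by (intro exI[of _ 0]) (simp add: F_def)
    next
      case (insert t I)
      then obtain p where "(\<Sum>t\<in>I. c t) = F p" by blast
      moreover obtain q where "c t = F q" using F_ex wt by blast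
      ultimately have "(\<Sum>t\<in>insert t I. c t) = F (q + p)"
        using insert by (simp add: linear_mapD[OF linF])
      then show ?case by blast
    qed
    have "\<exists>p. w = F p" for w
    proof -
      obtain c where "finite {s. c s \<noteq> 0}" "\<forall>s. c s \<in> weight_space M s" "w = (\<Sum>s | c s \<noteq> 0. c s)"
        using dec[of w] by blast
      then show ?thesis using F_sum[of "{s. c s \<noteq> 0}" c] by simp
    qed
    then show ?thesis by (auto simp: surj_def)
  qed
  ultimately have bijF: "bij F" by (simp add: bij_def)
  \<comment> \<open>Since [L_0, L_m] = m L_m, the operator \<open>L m\<close> raises weights by
    \<open>m\<close>; one-dimensionality then yields the coefficient.\<close>
  have "act M (L m) (v n) \<in> weight_space M (s + of_int (m + n))" for m n
  proof -
    have br: "witt_bracket (L 0) (L m) = pm_scale (of_int m) (L m)"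
      by (simp add: witt_bracket_def L_def graded_bilin_single pm_scale_single del: single_one)
    have "act M (L 0) (act M (L m) (v n)) =
        act M (witt_bracket (L 0) (L m)) (v n) + act M (L m) (act M (L 0) (v n))"
      using M by (simp add: witt_module_def)
    also have "act M (witt_bracket (L 0) (L m)) (v n) = scale M (of_int m) (act M (L m) (v n))"
      by (simp only: br linear_mapD[OF linM(2)])
    also have "act M (L 0) (v n) = scale M (s + of_int n) (v n)"
      using v(1)[of n] by (simp add: weight_space_def)
    finally show ?thesis
      by (simp add: weight_space_def act_scale vs.scale_left_distrib[symmetric] add_ac)
  qed
  then have "\<exists>a. act M (L m) (v n) = scale M a (v (m + n))" for m n
    by (rule v(3))
  then obtain c where c: "\<And>m n. act M (L m) (v n) = scale M (c m n) (v (m + n))"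
    by metis
  have "M \<cong>\<^sub>W graded_module c"
  proof (rule witt_iso_of_frame[OF M linF bijF])
    show "F (graded_bilin c (L m) (unit_vec n)) = act M (L m) (F (unit_vec n))" for m n
    proof -
      have "graded_bilin c (L m) (unit_vec n) = pm_scale (c m n) (unit_vec (m + n))"
        by (simp add: L_def graded_bilin_single pm_scale_single)
      then show ?thesis
        by (simp only: linear_mapD[OF linF] F_unit c)
    qed
  qed
  moreover have "c 0 n = s + of_int n" for n
    using c[of 0 n] v(1)[of n] v(2)[of n] by (simp add: weight_space_def)
  ultimately show thesis
    using that[OF s] witt_coeffs_of_iso[OF M] by blast
qed

section \<open>The germ of a module at infinity\<close>

lemma witt_coeffs_0: "witt_coeffs s c \<Longrightarrow> c 0 n = s + of_int n"
  by (simp add: witt_coeffs_def)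

lemma witt_coeffs_rel:
  "witt_coeffs s c \<Longrightarrow>
    c n j * c m (n + j) - c m j * c n (m + j) = of_int (n - m) * c (m + n) j"
  by (simp add: witt_coeffs_def)

lemma witt_coeffs_gauge:
  assumes c: "witt_coeffs s c" and g: "\<And>n. g n \<noteq> 0"
    and eq: "\<And>m n. g n * c m n = c' m n * g (n + m)"
  shows "witt_coeffs s c'"
proof -
  have c': "c' m n = g n * c m n / g (n + m)" for m n
    using eq[of n m] g[of "n + m"] by (simp add: field_simps)
  have "of_int (n - m) * c' (m + n) j = c' n j * c' m (n + j) - c' m j * c' n (m + j)" for m n j
  proof -
    have comp: "c' a j * c' b (a + j) = g j * (c a j * c b (a + j)) / g (a + b + j)" for a b
      using g[of "a + j"] by (simp add: c' add_ac)
    have "of_int (n - m) * c' (m + n) j = g j * (of_int (n - m) * c (m + n) j) / g (m + n + j)"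
      by (simp add: c' add_ac)
    also have "of_int (n - m) * c (m + n) j = c n j * c m (n + j) - c m j * c n (m + j)"
      using witt_coeffs_rel[OF c, of n j m] by simp
    also have "g j * (c n j * c m (n + j) - c m j * c n (m + j)) / g (m + n + j) =
        c' n j * c' m (n + j) - c' m j * c' n (m + j)"
      by (simp only: comp add.commute[of n m] right_diff_distrib diff_divide_distrib)
    finally show ?thesis .
  qed
  moreover have "c' 0 n = s + of_int n" for n
    using g[of n] witt_coeffs_0[OF c] by (simp add: c')
  ultimately show ?thesis
    by (simp add: witt_coeffs_def)
qed

lemma int_step_const:
  fixes f :: "int \<Rightarrow> 'a"
  assumes "\<And>n. f (n + 1) = f n"
  shows "f n = f 0"
proof (induction n rule: int_induct[where k = 0])
  case (step2 i)
  then show ?case using assms[of "i - 1"] by simp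
qed (simp_all add: assms)

text \<open>The step is 2 because the bracket of L_2 and L_{-2} links only weights that differ by 2,
  so the identity to be exploited is known on one parity class only.\<close>

lemma poly_zero_if_zero_on_progression:
  fixes p :: "complex poly"
  assumes "\<And>j::int. poly p (s + 2 * of_int j) = 0"
  shows "poly p x = 0"
proof -
  have "infinite (range (\<lambda>j::int. s + 2 * (of_int j :: complex)))"
    by (subst finite_image_iff) (simp_all add: inj_def infinite_UNIV_int)
  moreover have "range (\<lambda>j::int. s + 2 * (of_int j :: complex)) \<subseteq> {x. poly p x = 0}"
    using assms by auto
  ultimately have "infinite {x. poly p x = 0}"
    using finite_subset by blast
  then have "p = 0"
    using poly_roots_finite by blast
  then show ?thesis by simp
qed

lemma complex_quadratic_root: "\<exists>d::complex. d - d\<^sup>2 = \<kappa>"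
proof -
  have "(csqrt (1 - 4 * \<kappa>))\<^sup>2 = 1 - 4 * \<kappa>" by simp
  then have "(1 + csqrt (1 - 4 * \<kappa>)) / 2 - ((1 + csqrt (1 - 4 * \<kappa>)) / 2)\<^sup>2 = \<kappa>"
    by (simp add: power2_eq_square field_simps) algebra
  then show ?thesis by blast
qed

text \<open>By [L_1, L_{-1}] = -2 L_0, subtracting x (x - 1), with x the weight, from the scalar of
  L_1 L_{-1} leaves the Casimir constant. Writing this constant as d - d^2 factors the quadratic;
  \<open>d\<close> and \<open>1 - d\<close> are equally possible here.\<close>

lemma witt_coeffs_casimir:
  assumes c: "witt_coeffs s c"
  obtains d where "\<And>n. c (- 1) n * c 1 (n - 1) = (s + of_int n - d) * (s + of_int n - 1 + d)"
proof -
  define h where "h n = c (- 1) n * c 1 (n - 1) - (s + of_int n) * (s + of_int n - 1)" for n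
  have "h (n + 1) = h n" for n
    using witt_coeffs_rel[OF c, of "- 1" n 1] witt_coeffs_0[OF c, of n]
    by (simp add: h_def algebra_simps)
  then have h: "h n = h 0" for n
    by (rule int_step_const)
  obtain d where "d - d\<^sup>2 = h 0"
    using complex_quadratic_root by blast
  then have "h n = d - d\<^sup>2" for n
    using h by simp
  then show thesis
    using that[of d] by (simp add: h_def algebra_simps power2_eq_square)
qed

text \<open>Finite differences: the fourth one isolates the quartic coefficient, with factor 24 =
  4!; once \<kappa> is gone, the third one isolates the cubic coefficient \<open>K + K'\<close>,
  with factor 6 = 3!. The value at 0 gives the last relation.\<close>

lemma quartic_identity_constants:
  fixes d K K' \<kappa> :: complex
  assumes f: "\<And>x. K' * (x - 2 + 2 * d) * ((x - d) * (x - 1 - d)) +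
    K * (x - 2 * d) * ((x - 2 + d) * (x - 1 + d)) + K * K' -
    \<kappa> * ((x - 2 + d) * (x - 1 + d) * ((x - d) * (x - 1 - d))) = 0"
  shows "\<kappa> = 0" "K' = - K" "K * (K - 2 * d * (1 - d) * (2 * d - 1)) = 0"
proof -
  have "24 * \<kappa> = 0"
    using f[of 0] f[of 1] f[of 2] f[of 3] f[of 4] by algebra
  then show \<kappa>: "\<kappa> = 0" by simp
  have "6 * (K + K') = 0"
    using f[of 0] f[of 1] f[of 2] f[of 3] unfolding \<kappa> by algebra
  then have "K + K' = 0"
    by (metis mult_eq_0_iff zero_neq_numeral)
  then show K': "K' = - K"
    by (simp add: eq_neg_iff_add_eq_0 add.commute)
  show "K * (K - 2 * d * (1 - d) * (2 * d - 1)) = 0"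
    using f[of 0] unfolding K' \<kappa> by algebra
qed

text \<open>
  The scalars by which $L_1 L_{-1}$, $L_{-1}^2 L_2$ and $L_1^2 L_{-2}$ act on the weight spaces
  are polynomial in the weight, and agree with those of some density module. The parameter is
  determined by the Casimir element only up to $\delta \mapsto 1 - \delta$; the relation
  $[L_2, L_{-2}] = -4 L_0$ leaves exactly two values for the integration constant of the cubic
  polynomials, and these two values correspond to $\delta$ and $1 - \delta$.
\<close>

lemma witt_coeffs_invariants:
  assumes c: "witt_coeffs s c"
  obtains d where
    "\<And>n. c (- 1) n * c 1 (n - 1) = (s + of_int n - d) * (s + of_int n - 1 + d)"
    "\<And>n. c 2 n * c (- 1) (n + 2) * c (- 1) (n + 1) =
      (s + of_int n + 2 * d) * (s + of_int n + 2 - d) * (s + of_int n + 1 - d)"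
    "\<And>n. c (- 2) n * c 1 (n - 2) * c 1 (n - 1) =
      (s + of_int n - 2 * d) * (s + of_int n - 2 + d) * (s + of_int n - 1 + d)"
proof -
  obtain d where p: "\<And>n. c (- 1) n * c 1 (n - 1) = (s + of_int n - d) * (s + of_int n - 1 + d)"
    using witt_coeffs_casimir[OF c] by blast
  define u where "u n = c 2 n * c (- 1) (n + 2) * c (- 1) (n + 1)" for n
  define w where "w n = c (- 2) n * c 1 (n - 2) * c 1 (n - 1)" for n
  define q where "q n = c (- 2) n * c 2 (n - 2)" for n
  define U where "U x = (x + 2 * d) * (x + 2 - d) * (x + 1 - d)" for x
  define W where "W x = (x - 2 * d) * (x - 2 + d) * (x - 1 + d)" for x
  have u_step: "u (n + 1) = u n + 3 * ((s + of_int n + 2 - d) * (s + of_int n + 1 + d))" for n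
  proof -
    have "c 2 (n + 1) * c (- 1) (n + 3) - c (- 1) (n + 1) * c 2 n = 3 * c 1 (n + 1)"
      using witt_coeffs_rel[OF c, of 2 "n + 1" "- 1"] by (simp add: add_ac)
    then have "(c 2 (n + 1) * c (- 1) (n + 3) - c (- 1) (n + 1) * c 2 n) * c (- 1) (n + 2) =
        3 * c 1 (n + 1) * c (- 1) (n + 2)" by simp
    then have "u (n + 1) = u n + 3 * (c (- 1) (n + 2) * c 1 (n + 2 - 1))"
      by (simp add: u_def algebra_simps)
    then show ?thesis
      by (simp only: p) (simp add: algebra_simps)
  qed
  have w_step: "w (n + 1) = w n + 3 * ((s + of_int n - d) * (s + of_int n - 1 + d))" for n
  proof -
    have "c (- 2) n * c 1 (n - 2) - c 1 n * c (- 2) (n + 1) = - 3 * c (- 1) n"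
      using witt_coeffs_rel[OF c, of "- 2" n 1] by (simp add: add_ac)
    then have "(c (- 2) n * c 1 (n - 2) - c 1 n * c (- 2) (n + 1)) * c 1 (n - 1) =
        - 3 * c (- 1) n * c 1 (n - 1)" by simp
    then have "w (n + 1) = w n + 3 * (c (- 1) n * c 1 (n - 1))"
      by (simp add: w_def algebra_simps)
    then show ?thesis
      by (simp only: p)
  qed
  have q_step: "q (n + 2) = q n + 4 * (s + of_int n)" for n
    using witt_coeffs_rel[OF c, of 2 n "- 2"] witt_coeffs_0[OF c, of n]
    by (simp add: q_def algebra_simps)
  have "u n - U (s + of_int n) = u 0 - U (s + of_int 0)" for n
    by (rule int_step_const) (simp add: u_step U_def algebra_simps)
  then obtain K where u: "\<And>n. u n = U (s + of_int n) + K"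
    by (metis add.commute diff_add_cancel)
  have "w n - W (s + of_int n) = w 0 - W (s + of_int 0)" for n
    by (rule int_step_const) (simp add: w_step W_def algebra_simps)
  then obtain K' where w: "\<And>n. w n = W (s + of_int n) + K'"
    by (metis add.commute diff_add_cancel)
  define Q where "Q x = (x - 2 * d) * (x - 2 + 2 * d)" for x
  have "q (2 * j) - Q (s + 2 * of_int j) = q (2 * 0) - Q (s + 2 * of_int 0)" for j :: int
  proof (rule int_step_const)
    show "q (2 * (j + 1)) - Q (s + 2 * of_int (j + 1)) = q (2 * j) - Q (s + 2 * of_int j)" for j
      using q_step[of "2 * j"] by (simp add: Q_def algebra_simps)
  qed
  then obtain \<kappa> where q: "\<And>j. q (2 * j) = Q (s + 2 * of_int j) + \<kappa>"
    by (metis add.commute diff_add_cancel)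
  \<comment> \<open>Regrouping the six coefficients in \<open>w n * u (n - 2)\<close> gives
    \<open>q n\<close> times two consecutive values of the Casimir quadratic. For K = K' = \<kappa>
    = 0 this is a polynomial identity, as in a density module; \<open>F\<close> is what the three
    integration constants add to it.\<close>
  define F where "F x = K' * (x - 2 + 2 * d) * ((x - d) * (x - 1 - d)) +
    K * (x - 2 * d) * ((x - 2 + d) * (x - 1 + d)) + K * K' -
    \<kappa> * ((x - 2 + d) * (x - 1 + d) * ((x - d) * (x - 1 - d)))" for x
  have "F (s + 2 * of_int j) = 0" for j :: int
  proof -
    define n where "n = 2 * j"
    define x where "x = s + of_int n"
    have w1: "w n = W x + K'" and u1: "u (n - 2) = U (x - 2) + K" and q1: "q n = Q x + \<kappa>"
      using w[of n] u[of "n - 2"] q[of j] by (simp_all add: x_def n_def add_diff_eq)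
    have p1: "c (- 1) n * c 1 (n - 1) = (x - d) * (x - 1 + d)"
      "c (- 1) (n - 1) * c 1 (n - 1 - 1) = (x - 1 - d) * (x - 2 + d)"
      unfolding p by (simp_all add: x_def algebra_simps)
    have "w n * u (n - 2) = q n * (c (- 1) n * c 1 (n - 1)) * (c (- 1) (n - 1) * c 1 (n - 1 - 1))"
      by (simp add: w_def u_def q_def)
    then have "(W x + K') * (U (x - 2) + K) =
        (Q x + \<kappa>) * ((x - d) * (x - 1 + d)) * ((x - 1 - d) * (x - 2 + d))"
      by (simp only: w1 u1 p1 q1)
    then have "F x = 0"
      unfolding F_def U_def W_def Q_def by algebra
    then show ?thesis
      by (simp add: x_def n_def)
  qed
  moreover define P where "P = smult K' ([:2 * d - 2, 1:] * ([:- d, 1:] * [:- 1 - d, 1:])) +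
    smult K ([:- 2 * d, 1:] * ([:d - 2, 1:] * [:d - 1, 1:])) + [:K * K':] -
    smult \<kappa> ([:d - 2, 1:] * [:d - 1, 1:] * ([:- d, 1:] * [:- 1 - d, 1:]))"
  moreover have "poly P x = F x" for x
    unfolding P_def F_def by (simp add: algebra_simps)
  ultimately have F: "F x = 0" for x
    using poly_zero_if_zero_on_progression[of P s x] by simp
  have K: "K' = - K" "K * (K - 2 * d * (1 - d) * (2 * d - 1)) = 0"
    using quartic_identity_constants[of K' d K \<kappa>] F unfolding F_def by blast+
  show thesis
  proof (cases "K = 0")
    case True
    then show ?thesis
      using that[of d] p u w K(1) by (simp add: u_def w_def U_def W_def)
  next
    case False
    then have T: "K = 2 * d * (1 - d) * (2 * d - 1)"
      using K(2) by simp
    show ?thesis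
    proof (rule that[of "1 - d"])
      show "c (- 1) n * c 1 (n - 1) = (s + of_int n - (1 - d)) * (s + of_int n - 1 + (1 - d))" for n
        unfolding p by (simp add: algebra_simps)
      show "c 2 n * c (- 1) (n + 2) * c (- 1) (n + 1) =
        (s + of_int n + 2 * (1 - d)) * (s + of_int n + 2 - (1 - d)) * (s + of_int n + 1 - (1 - d))" for n
        using u[of n] unfolding u_def U_def T by algebra
      show "c (- 2) n * c 1 (n - 2) * c 1 (n - 1) =
        (s + of_int n - 2 * (1 - d)) * (s + of_int n - 2 + (1 - d)) * (s + of_int n - 1 + (1 - d))" for n
        using w[of n] unfolding w_def W_def K(1) T by algebra
    qed
  qed
qed

text \<open>L_1 and L_2 generate the positive half of the algebra: the bracket of L_{k+2} with L_1
  is a nonzero multiple of L_{k+3}. The induction starts at index 2 because L_1 commutes with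
  itself.\<close>

lemma witt_coeffs_pos:
  assumes c: "witt_coeffs s c"
    and c1: "\<And>n. n \<ge> N \<Longrightarrow> c 1 n = s + of_int n + d"
    and c2: "\<And>n. n \<ge> N \<Longrightarrow> c 2 n = s + of_int n + 2 * d"
    and "n \<ge> N"
  shows "c (int k) n = s + of_int n + of_nat k * d"
proof -
  have "c (int k + 2) n = s + of_int n + of_nat (k + 2) * d" if "n \<ge> N" for k n
    using that
  proof (induction k arbitrary: n)
    case 0
    then show ?case using c2 by simp
  next
    case (Suc k)
    have "of_nat (Suc k) * c (int k + 3) n =
        c (int k + 2) n * c 1 (int k + 2 + n) - c 1 n * c (int k + 2) (1 + n)"
      using witt_coeffs_rel[OF c, of "int k + 2" n 1] by (simp add: add_ac)
    also have "\<dots> = (s + of_int n + of_nat (k + 2) * d) * (s + of_int (int k + 2 + n) + d) -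
        (s + of_int n + d) * (s + of_int (1 + n) + of_nat (k + 2) * d)"
      using Suc.IH[of n] Suc.IH[of "1 + n"] c1[of n] c1[of "int k + 2 + n"] Suc.prems by simp
    also have "\<dots> = of_nat (Suc k) * (s + of_int n + of_nat (k + 3) * d)"
      by (simp add: algebra_simps)
    finally show ?case
      using of_nat_neq_0[of k, where ?'a = complex] by (simp only: mult_cancel_left) (simp add: add_ac)
  qed
  from this[of n "k - 2"] show ?thesis
  proof (cases "k < 2")
    case True
    then have "k = 0 \<or> k = 1" by auto
    then show ?thesis using c1 witt_coeffs_0[OF c] \<open>n \<ge> N\<close> by auto
  next
    case False
    then have "int (k - 2) + 2 = int k" "k - 2 + 2 = k" by auto
    then show ?thesis
      using \<open>n \<ge> N \<Longrightarrow> c (int (k - 2) + 2) n = _\<close> \<open>n \<ge> N\<close> by metis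
  qed
qed

text \<open>The mirror image for L_{-1} and L_{-2}. The bound is imposed on
  \<open>n - int k\<close>, the lowest index met on the way down, so that every intermediate step
  stays in the known range.\<close>

lemma witt_coeffs_neg:
  assumes c: "witt_coeffs s c"
    and c1: "\<And>n. n - 1 \<ge> N \<Longrightarrow> c (- 1) n = s + of_int n - d"
    and c2: "\<And>n. n - 2 \<ge> N \<Longrightarrow> c (- 2) n = s + of_int n - 2 * d"
    and "n - int k \<ge> N"
  shows "c (- int k) n = s + of_int n - of_nat k * d"
proof -
  have ge2: "c (- int (k + 2)) n = s + of_int n - of_nat (k + 2) * d" if "n - int (k + 2) \<ge> N" for k n
    using that
  proof (induction k arbitrary: n)
    case 0
    then show ?case using c2 by simp
  next
    case (Suc k)
    have "- of_nat (Suc k) * c (- int (k + 3)) n =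
        c (- int (k + 2)) n * c (- 1) (n - int (k + 2)) - c (- 1) n * c (- int (k + 2)) (n - 1)"
      using witt_coeffs_rel[OF c, of "- int (k + 2)" n "- 1"] by (simp add: algebra_simps)
    also have "\<dots> = (s + of_int n - of_nat (k + 2) * d) * (s + of_int (n - int (k + 2)) - d) -
        (s + of_int n - d) * (s + of_int (n - 1) - of_nat (k + 2) * d)"
      using Suc.IH[of n] Suc.IH[of "n - 1"] c1[of n] c1[of "n - int (k + 2)"] Suc.prems by simp
    also have "\<dots> = - of_nat (Suc k) * (s + of_int n - of_nat (k + 3) * d)"
      by (simp add: algebra_simps)
    finally show ?case
      using of_nat_neq_0[of k, where ?'a = complex]
      by (simp only: mult_cancel_left neg_equal_0_iff_equal) (simp add: add_ac)
  qed
  show ?thesis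
  proof (cases "k < 2")
    case True
    then have "k = 0 \<or> k = 1" by auto
    then show ?thesis using c1 witt_coeffs_0[OF c] assms(4) by auto
  next
    case False
    then have "k = (k - 2) + 2" by simp
    then show ?thesis
      using ge2[where k = "k - 2"] assms(4) by metis
  qed
qed

text \<open>Far out the factors of the Casimir quadratic do not vanish, so L_1 is nonzero there and
  can be normalized by rescaling. The closed-path polynomials then give L_{-1}, L_2 and L_{-2}, and
  these generate the rest.\<close>

lemma witt_coeffs_germ:
  assumes c: "witt_coeffs s c"
  obtains d c' N where "graded_module c \<cong>\<^sub>W graded_module c'" "witt_coeffs s c'"
    "\<And>m n. n \<ge> N \<Longrightarrow> n + m \<ge> N \<Longrightarrow> c' m n = of_int m * d + (s + of_int n)"
proof -
  obtain d where
    p: "\<And>n. c (- 1) n * c 1 (n - 1) = (s + of_int n - d) * (s + of_int n - 1 + d)" and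
    u: "\<And>n. c 2 n * c (- 1) (n + 2) * c (- 1) (n + 1) =
      (s + of_int n + 2 * d) * (s + of_int n + 2 - d) * (s + of_int n + 1 - d)" and
    w: "\<And>n. c (- 2) n * c 1 (n - 2) * c 1 (n - 1) =
      (s + of_int n - 2 * d) * (s + of_int n - 2 + d) * (s + of_int n - 1 + d)"
    using witt_coeffs_invariants[OF c] by blast
  define N where "N = \<lceil>\<bar>Re s\<bar> + \<bar>Re d\<bar> + 1\<rceil>"
  have nz: "s + of_int n - d \<noteq> 0" "s + of_int n + d \<noteq> 0" if "n \<ge> N" for n
  proof -
    have "real_of_int n > \<bar>Re s\<bar> + \<bar>Re d\<bar>"
      using that unfolding N_def by linarith
    then have "Re (s + of_int n - d) > 0" "Re (s + of_int n + d) > 0"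
      by simp_all
    then show "s + of_int n - d \<noteq> 0" "s + of_int n + d \<noteq> 0"
      by (metis less_irrefl zero_complex.simps(1))+
  qed
  have c1_nz: "c 1 n \<noteq> 0" if "n \<ge> N" for n
    using p[of "n + 1"] nz(1)[of "n + 1"] nz(2)[of n] that by (auto simp: add_ac add_diff_eq)
  \<comment> \<open>The ratio of two consecutive values replaces \<open>c 1 n\<close> by
    \<open>s + of_int n + d\<close>. Up to \<open>N\<close> the product is empty, so possible zeros
    of \<open>c 1\<close> below are never touched.\<close>
  define g where "g n = (\<Prod>k\<in>{N..<n}. c 1 k / (s + of_int k + d))" for n
  have g_nz: "g n \<noteq> 0" for n
    using c1_nz nz by (auto simp: g_def)
  have g_step: "g (n + 1) = g n * (c 1 n / (s + of_int n + d))" if "n \<ge> N" for n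
  proof -
    have "{N..<n + 1} = insert n {N..<n}" using that by auto
    then show ?thesis by (simp add: g_def)
  qed
  define c' where "c' m n = g n * c m n / g (n + m)" for m n
  have eq: "g n * c m n = c' m n * g (n + m)" for m n
    using g_nz by (simp add: c'_def)
  have c': "witt_coeffs s c'"
    by (rule witt_coeffs_gauge[OF c g_nz eq])
  have c'1: "c' 1 n = s + of_int n + d" if "n \<ge> N" for n
    using that g_step[of n] c1_nz[of n] g_nz[of n] nz(2)[of n] by (simp add: c'_def)
  \<comment> \<open>Rescaling does not change products along closed paths, so dividing the known
    product by the normalized L_1 coefficient leaves the L_{-1} coefficient. The same device gives
    \<open>c'2\<close> and \<open>c'm2\<close>.\<close>
  have c'm1: "c' (- 1) n = s + of_int n - d" if "n - 1 \<ge> N" for n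
  proof -
    have "c' (- 1) n * c' 1 (n - 1) = c (- 1) n * c 1 (n - 1)"
      using g_nz by (simp add: c'_def)
    also have "\<dots> = (s + of_int n - d) * c' 1 (n - 1)"
      using that by (simp add: p c'1 algebra_simps)
    finally show ?thesis
      using that nz(2)[of "n - 1"] c'1[of "n - 1"] by simp
  qed
  have c'2: "c' 2 n = s + of_int n + 2 * d" if "n \<ge> N" for n
  proof -
    have m1: "c' (- 1) (n + 1) = s + of_int n + 1 - d" "c' (- 1) (n + 2) = s + of_int n + 2 - d"
      using that c'm1[of "n + 1"] c'm1[of "n + 2"] by simp_all
    have "c' 2 n * c' (- 1) (n + 2) * c' (- 1) (n + 1) = c 2 n * c (- 1) (n + 2) * c (- 1) (n + 1)"
      using g_nz by (simp add: c'_def add.commute[of 1])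
    also have "\<dots> = (s + of_int n + 2 * d) * c' (- 1) (n + 2) * c' (- 1) (n + 1)"
      by (simp add: u m1)
    finally show ?thesis
      using that nz(1)[of "n + 1"] nz(1)[of "n + 2"] c'm1[of "n + 1"] c'm1[of "n + 2"] by simp
  qed
  have c'm2: "c' (- 2) n = s + of_int n - 2 * d" if "n - 2 \<ge> N" for n
  proof -
    have m1: "c' 1 (n - 1) = s + of_int n - 1 + d" "c' 1 (n - 2) = s + of_int n - 2 + d"
      using that c'1[of "n - 1"] c'1[of "n - 2"] by simp_all
    have "c' (- 2) n * c' 1 (n - 2) * c' 1 (n - 1) = c (- 2) n * c 1 (n - 2) * c 1 (n - 1)"
      using g_nz by (simp add: c'_def)
    also have "\<dots> = (s + of_int n - 2 * d) * c' 1 (n - 2) * c' 1 (n - 1)"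
      by (simp add: w m1)
    finally show ?thesis
      using that nz(2)[of "n - 1"] nz(2)[of "n - 2"] c'1[of "n - 1"] c'1[of "n - 2"] by simp
  qed
  have "c' m n = of_int m * d + (s + of_int n)" if "n \<ge> N" "n + m \<ge> N" for m n
  proof (cases "m \<ge> 0")
    case True
    then have "int (nat m) = m" by simp
    then show ?thesis
      using witt_coeffs_pos[OF c' c'1 c'2 that(1), where k = "nat m"]
      by (metis add.commute of_int_of_nat_eq)
  next
    case False
    then obtain k where m: "m = - int k"
      by (metis add.inverse_inverse int_nat_eq linear neg_0_le_iff_le)
    show ?thesis
      using witt_coeffs_neg[OF c' c'm1 c'm2, where k = k and n = n] that(2) by (simp add: m)
  qed
  then show thesis
    using that[OF graded_module_iso_gauge[OF g_nz eq] c'] by blast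
qed

section \<open>The Kaplansky--Santharoubane classification\<close>

text \<open>The scalar of a monomial in the \<open>L m\<close> applied to \<open>unit_vec n\<close>,
  the head of the list acting first. Lists with sum 0 are the weight-zero monomials; their scalars
  are invariant under rescaling of the basis.\<close>

fun path_scalar :: "(int \<Rightarrow> int \<Rightarrow> complex) \<Rightarrow> int list \<Rightarrow> int \<Rightarrow> complex" where
  "path_scalar c [] n = 1"
| "path_scalar c (a # w) n = c a n * path_scalar c w (n + a)"

lemma path_scalar_append:
  "path_scalar c (u @ v) n = path_scalar c u n * path_scalar c v (n + sum_list u)"
  by (induction u arbitrary: n) (simp_all add: add.assoc)

text \<open>The commutation relation inside a word. The correction term is shorter by one letter,
  which is what makes an induction on length possible.\<close>

lemma path_scalar_swap:
  assumes "witt_coeffs s c"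
  shows "path_scalar c (u @ a # b # v) n - path_scalar c (u @ b # a # v) n =
    of_int (a - b) * path_scalar c (u @ (a + b) # v) n"
proof -
  define j where "j = n + sum_list u"
  have "c a j * c b (j + a) - c b j * c a (j + b) = of_int (a - b) * c (a + b) j"
    using witt_coeffs_rel[OF assms, of a j b] by (simp add: add.commute)
  then have "path_scalar c u n * (c a j * c b (j + a) - c b j * c a (j + b)) *
      path_scalar c v (j + (a + b)) =
    path_scalar c u n * (of_int (a - b) * c (a + b) j) * path_scalar c v (j + (a + b))"
    by simp
  then show ?thesis
    by (simp add: path_scalar_append j_def algebra_simps)
qed

lemma path_scalar_agree_far:
  assumes "\<And>m n. n \<ge> N \<Longrightarrow> n + m \<ge> N \<Longrightarrow> c m n = d m n"
    and "n \<ge> N + sum_list (map abs w)"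
  shows "path_scalar c w n = path_scalar d w n"
  using assms(2)
proof (induction w arbitrary: n)
  case (Cons a w)
  have nn: "sum_list (map abs w) \<ge> 0"
    by (rule sum_list_nonneg) auto
  then have "c a n = d a n"
    using Cons.prems by (intro assms(1)) auto
  moreover have "path_scalar c w (n + a) = path_scalar d w (n + a)"
    using Cons.prems by (intro Cons.IH) auto
  ultimately show ?case by simp
qed simp

text \<open>
  The scalar of a closed path depends only on the germ of the module at infinity: rotating a
  closed path shifts its base point by the first letter, and permuting its letters changes it by
  shorter closed paths, so the difference of the two scalars is periodic, while it vanishes far out.
\<close>

lemma closed_path_scalar_eq:
  assumes c: "witt_coeffs s c" and d: "witt_coeffs s d"
    and far: "\<And>m n. n \<ge> N \<Longrightarrow> n + m \<ge> N \<Longrightarrow> c m n = d m n"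
    and "sum_list w = 0"
  shows "path_scalar c w n = path_scalar d w n"
  using assms(4)
proof (induction w arbitrary: n rule: length_induct)
  case (1 w)
  then have IH: "\<And>v n. length v < length w \<Longrightarrow> sum_list v = 0 \<Longrightarrow>
      path_scalar c v n = path_scalar d v n" by blast
  define D where "D v n = path_scalar c v n - path_scalar d v n" for v n
  show ?case
  proof (cases w)
    case (Cons a v)
    have move: "D (u @ a # v) n = D (u @ v @ [a]) n"
      if "length u + length v < length w" "sum_list u + a + sum_list v = 0" for u v n
      using that
    proof (induction v arbitrary: u)
      case (Cons b v)
      have "D (u @ a # b # v) n - D (u @ b # a # v) n = of_int (a - b) * D (u @ (a + b) # v) n"
        using path_scalar_swap[OF c, of u a b v n] path_scalar_swap[OF d, of u a b v n]
        by (simp add: D_def algebra_simps)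
      also have "D (u @ (a + b) # v) n = 0"
        using IH[of "u @ (a + b) # v"] Cons.prems by (simp add: D_def algebra_simps)
      finally have "D (u @ a # b # v) n = D ((u @ [b]) @ a # v) n" by simp
      also have "\<dots> = D ((u @ [b]) @ v @ [a]) n"
        by (rule Cons.IH) (use Cons.prems in auto)
      finally show ?case by simp
    qed simp
    show ?thesis
    \<comment> \<open>A leading letter 0 does not move the base point and gives no period, but it
      contributes the same weight as a factor on both sides.\<close>
    proof (cases "a = 0")
      case True
      then show ?thesis
        using IH[of v n] 1(2) witt_coeffs_0[OF c] witt_coeffs_0[OF d] Cons by simp
    next
      case False
      have per: "D w (n + a) = D w n" for n
      proof -
        have "sum_list v = - a" using 1(2) Cons by simp
        then have "D w n = D (v @ [a]) (n + a)"
          by (simp add: Cons D_def path_scalar_append)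
        also have "\<dots> = D w (n + a)"
          using move[of "[]" v "n + a"] \<open>sum_list v = - a\<close> by (simp add: Cons)
        finally show ?thesis by simp
      qed
      have per_abs: "D w (n + \<bar>a\<bar>) = D w n" for n
        using per[of n] per[of "n - a"] by (cases "a \<ge> 0") simp_all
      have per_k: "D w (n + int k * \<bar>a\<bar>) = D w n" for k
      proof (induction k)
        case (Suc k)
        then show ?case
          using per_abs[of "n + int k * \<bar>a\<bar>"] by (simp add: algebra_simps)
      qed simp
      define k where "k = nat (N + sum_list (map abs w) - n)"
      have "int k * \<bar>a\<bar> \<ge> int k * 1"
        by (rule mult_left_mono) (use False in auto)
      then have "n + int k * \<bar>a\<bar> \<ge> N + sum_list (map abs w)"
        unfolding k_def by linarith
      then have "D w (n + int k * \<bar>a\<bar>) = 0"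
        unfolding D_def using path_scalar_agree_far[OF far] by simp
      then show ?thesis
        using per_k[of k] by (simp add: D_def)
    qed
  qed simp
qed

text \<open>The rescaling at \<open>n\<close> is the ratio of the two scalars along a path from
  \<open>x0\<close> to \<open>n\<close>. Closing this path by a return path to \<open>x0\<close>
  shows that the scalar for \<open>c\<close> is nonzero as well; inserting an edge before the return
  compares the coefficients of that edge. Only vanishing for \<open>d\<close> obstructs the choice
  of paths, so \<open>S\<close> may be any set on which \<open>d\<close> allows travel from and to
  \<open>x0\<close>.\<close>

lemma gauge_on_strongly_connected:
  assumes loops: "\<And>w n. sum_list w = 0 \<Longrightarrow> path_scalar c w n = path_scalar d w n"
    and out: "\<And>n. n \<in> S \<Longrightarrow> \<exists>A. sum_list A = n - x0 \<and> path_scalar d A x0 \<noteq> 0"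
    and return: "\<And>n. n \<in> S \<Longrightarrow> \<exists>B. sum_list B = x0 - n \<and> path_scalar d B n \<noteq> 0"
  obtains g where "\<And>n. g n \<noteq> 0" "\<And>m n. n \<in> S \<Longrightarrow> n + m \<in> S \<Longrightarrow> g n * c m n = d m n * g (n + m)"
proof -
  obtain A where A: "\<And>n. n \<in> S \<Longrightarrow> sum_list (A n) = n - x0"
    "\<And>n. n \<in> S \<Longrightarrow> path_scalar d (A n) x0 \<noteq> 0"
    using out by metis
  obtain B where B: "\<And>n. n \<in> S \<Longrightarrow> sum_list (B n) = x0 - n"
    "\<And>n. n \<in> S \<Longrightarrow> path_scalar d (B n) n \<noteq> 0"
    using return by metis
  have loop: "path_scalar c (A n) x0 * path_scalar c (B n) n =
      path_scalar d (A n) x0 * path_scalar d (B n) n" if "n \<in> S" for n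
    using loops[of "A n @ B n" x0] A(1) B(1) that by (simp add: path_scalar_append)
  have cA: "path_scalar c (A n) x0 \<noteq> 0" if "n \<in> S" for n
    using loop[OF that] A(2) B(2) that by auto
  define g where "g n = (if n \<in> S then path_scalar c (A n) x0 / path_scalar d (A n) x0 else 1)" for n
  have "g n \<noteq> 0" for n
    using cA A(2) by (simp add: g_def)
  moreover have "g n * c m n = d m n * g (n + m)" if S: "n \<in> S" "n + m \<in> S" for m n
  proof -
    have "path_scalar c (A n) x0 * (c m n * path_scalar c (B (n + m)) (n + m)) =
        path_scalar d (A n) x0 * (d m n * path_scalar d (B (n + m)) (n + m))"
      using loops[of "A n @ [m] @ B (n + m)" x0] A(1) B(1) S by (simp add: path_scalar_append)
    moreover note loop[OF S(2)] cA[OF S(2)] A(2)[OF S(1)] A(2)[OF S(2)] B(2)[OF S(2)]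
    ultimately show ?thesis
      using S by (simp add: g_def field_simps) algebra
  qed
  ultimately show thesis using that by blast
qed

lemma avoid_two_zeros:
  fixes a b p q :: complex
  assumes "a \<noteq> 0" "b \<noteq> 0"
  obtains z :: int where "a * of_int z + p \<noteq> 0" "b * of_int z + q \<noteq> 0"
proof -
  have "inj (\<lambda>z::int. a * of_int z + p)" "inj (\<lambda>z::int. b * of_int z + q)"
    using assms by (auto simp: inj_def)
  then have "finite ((\<lambda>z::int. a * of_int z + p) -` {0} \<union> (\<lambda>z::int. b * of_int z + q) -` {0})"
    by (simp add: finite_vimageI)
  then obtain z where "z \<notin> (\<lambda>z::int. a * of_int z + p) -` {0} \<union> (\<lambda>z::int. b * of_int z + q) -` {0}"
    using ex_new_if_finite[OF infinite_UNIV_int] by blast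
  then show thesis using that by auto
qed

lemma witt_coeffs_Omega: "witt_coeffs s (\<lambda>m n. of_int m * d + (s + of_int n))"
  by (simp add: witt_coeffs_def algebra_simps)

text \<open>The differential multiplies each basis vector by its weight, and no weight is 0 when
  \<open>s\<close> is not an integer.\<close>

lemma Omega_1_iso_Omega_0:
  assumes "s \<notin> \<int>" shows "Omega 1 s \<cong>\<^sub>W Omega 0 s"
  unfolding Omega_eq_graded
proof (rule graded_module_iso_gauge[where g = "\<lambda>n. s + of_int n"])
  show "s + of_int n \<noteq> 0" for n
  proof
    assume "s + of_int n = 0"
    then have "s = of_int (- n)" by (simp add: eq_neg_iff_add_eq_0)
    then show False using assms by (metis Ints_of_int)
  qed
qed (simp add: algebra_simps)

text \<open>Agreement with Omega^0_s except for arrows into or out of weight 0, which stay free; all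
  modules of degree {0, 1} can thus be treated together.\<close>

definition form0 :: "complex \<Rightarrow> (int \<Rightarrow> int \<Rightarrow> complex) \<Rightarrow> bool" where
  "form0 s c \<longleftrightarrow>
     (\<forall>m n. s + of_int n \<noteq> 0 \<longrightarrow> s + of_int (n + m) \<noteq> 0 \<longrightarrow> c m n = s + of_int n)"

lemma form0D:
  "form0 s c \<Longrightarrow> s + of_int n \<noteq> 0 \<Longrightarrow> s + of_int (n + m) \<noteq> 0 \<Longrightarrow> c m n = s + of_int n"
  by (simp add: form0_def)

text \<open>For integral weights and \<open>d\<close> in {0, 1} the density module is not
  irreducible, so closed paths determine the coefficients only off weight 0. What they still say
  about weight 0 is the product condition: arrows into weight 0 and arrows out of it cannot both
  occur.\<close>

lemma witt_coeffs_classification: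
  assumes c: "witt_coeffs s c" and s: "s = 0 \<or> s \<notin> \<int>"
  shows "(\<exists>d. d \<notin> {0, 1} \<and> graded_module c \<cong>\<^sub>W Omega d s) \<or>
    (s \<notin> \<int> \<and> graded_module c \<cong>\<^sub>W Omega 0 s) \<or>
    (s = 0 \<and> (\<exists>c'. graded_module c \<cong>\<^sub>W graded_module c' \<and> witt_coeffs 0 c' \<and> form0 0 c' \<and>
      (\<forall>k m. k \<noteq> 0 \<longrightarrow> m \<noteq> 0 \<longrightarrow> c' k (- k) * c' m 0 = 0)))"
proof -
  obtain d c1 N where iso: "graded_module c \<cong>\<^sub>W graded_module c1" and c1: "witt_coeffs s c1"
    and far: "\<And>m n. n \<ge> N \<Longrightarrow> n + m \<ge> N \<Longrightarrow> c1 m n = of_int m * d + (s + of_int n)"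
    by (rule witt_coeffs_germ[OF c]) (rule that)
  define D where "D m n = of_int m * d + (s + of_int n)" for m n
  have D: "witt_coeffs s D"
    unfolding D_def by (rule witt_coeffs_Omega)
  have Omega: "Omega d s = graded_module D"
    by (simp add: Omega_eq_graded D_def[abs_def])
  have loops: "path_scalar c1 w n = path_scalar D w n" if "sum_list w = 0" for w n
    using closed_path_scalar_eq[OF c1 D _ that, of N] far by (simp add: D_def)
  consider "d \<notin> {0, 1}" | "d \<in> {0, 1}" "s \<notin> \<int>" | "d \<in> {0, 1}" "s = 0"
    using s by blast
  then show ?thesis
  proof cases
    case 1
    then have nz: "d \<noteq> 0" "1 - d \<noteq> 0" by auto
    \<comment> \<open>The two factors of the two-letter path through \<open>x + z\<close> are affine
      in \<open>z\<close> with slopes \<open>d\<close> and \<open>1 - d\<close>. Both slopes are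
      nonzero exactly because \<open>d\<close> is neither 0 nor 1, so some \<open>z\<close> avoids
      both zeros.\<close>
    have path: "\<exists>A. sum_list A = y - x \<and> path_scalar D A x \<noteq> 0" for x y
    proof -
      obtain z where "d * of_int z + (s + of_int x) \<noteq> 0"
        "(1 - d) * of_int z + (of_int (y - x) * d + s + of_int x) \<noteq> 0"
        using avoid_two_zeros[OF nz] by blast
      moreover have "D z x = d * of_int z + (s + of_int x)"
        "D (y - x - z) (x + z) = (1 - d) * of_int z + (of_int (y - x) * d + s + of_int x)"
        by (simp_all add: D_def algebra_simps)
      ultimately have "path_scalar D [z, y - x - z] x \<noteq> 0"
        by simp
      then show ?thesis by (intro exI[of _ "[z, y - x - z]"]) simp
    qed
    obtain g where "\<And>n. g n \<noteq> 0" "\<And>m n. g n * c1 m n = D m n * g (n + m)"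
      using gauge_on_strongly_connected[of c1 D UNIV 0, OF loops path path] by auto
    then have "graded_module c \<cong>\<^sub>W Omega d s"
      unfolding Omega using witt_iso_trans[OF iso graded_module_iso_gauge] by blast
    with 1 show ?thesis by blast
  next
    case 2
    have D_nz: "D m n \<noteq> 0" for m n
    proof
      assume "D m n = 0"
      then have "s + of_int (if d = 0 then n else m + n) = 0"
        using 2(1) by (auto simp: D_def add_ac)
      then have "s = of_int (- (if d = 0 then n else m + n))"
        by (simp only: of_int_minus eq_neg_iff_add_eq_0)
      then show False using 2(2) Ints_of_int by blast
    qed
    have path: "\<exists>A. sum_list A = y - x \<and> path_scalar D A x \<noteq> 0" for x y
      by (intro exI[of _ "[y - x]"]) (simp add: D_nz)
    obtain g where "\<And>n. g n \<noteq> 0" "\<And>m n. g n * c1 m n = D m n * g (n + m)"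
      using gauge_on_strongly_connected[of c1 D UNIV 0, OF loops path path] by auto
    then have "graded_module c \<cong>\<^sub>W Omega d s"
      unfolding Omega using witt_iso_trans[OF iso graded_module_iso_gauge] by blast
    then show ?thesis
      using 2 witt_iso_trans[OF _ Omega_1_iso_Omega_0] by auto
  next
    case 3
    have path: "\<exists>A. sum_list A = y - x \<and> path_scalar D A x \<noteq> 0" if "x \<noteq> 0" "y \<noteq> 0" for x y
      using that 3 by (intro exI[of _ "[y - x]"]) (auto simp: D_def)
    obtain g where g: "\<And>n. g n \<noteq> 0"
      "\<And>m n. n \<noteq> 0 \<Longrightarrow> n + m \<noteq> 0 \<Longrightarrow> g n * c1 m n = D m n * g (n + m)"
      by (rule gauge_on_strongly_connected[of c1 D "- {0}" 1, OF loops]) (use path in auto)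
    \<comment> \<open>For \<open>d = 1\<close> the additional factor \<open>n\<close> turns Omega^1
      form into Omega^0 form off weight 0; the value at \<open>n = 0\<close> only has to be
      nonzero.\<close>
    define h where "h n = (if d = 0 \<or> n = 0 then 1 else of_int n) * g n" for n
    have h: "h n \<noteq> 0" for n
      using g(1) by (simp add: h_def)
    define c' where "c' m n = h n * c1 m n / h (n + m)" for m n
    have eq: "h n * c1 m n = c' m n * h (n + m)" for m n
      using h by (simp add: c'_def)
    have c': "witt_coeffs 0 c'"
      using witt_coeffs_gauge[OF c1 h eq] 3 by simp
    have form: "c' m n = of_int n" if "n \<noteq> 0" "n + m \<noteq> 0" for m n
    proof -
      have "of_int n + of_int m \<noteq> (0::complex)"
        using that(2) by (metis of_int_add of_int_eq_0_iff)
      then show ?thesis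
        using 3 g(2)[OF that] h[of "n + m"] g(1)[of "n + m"] that
        by (auto simp: c'_def h_def D_def field_simps)
    qed
    \<comment> \<open>The closed path from -k through 0 and m back to -k has scalar 0 for
      \<open>D\<close>: its first letter vanishes if \<open>d = 1\<close>, its second if
      \<open>d = 0\<close>. The last letter joins two nonzero weights and does not vanish.\<close>
    have "c' k (- k) * c' m 0 = 0" if "k \<noteq> 0" "m \<noteq> 0" for k m
    proof -
      have "c1 k (- k) * (c1 m 0 * c1 (- m - k) m) = D k (- k) * (D m 0 * D (- m - k) m)"
        using loops[of "[k, m, - m - k]" "- k"] by simp
      also have "\<dots> = 0"
        using 3 by (auto simp: D_def)
      finally have "c1 k (- k) * (c1 m 0 * c1 (- m - k) m) = 0" .
      moreover have "c1 (- m - k) m \<noteq> 0"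
        using form[of m "- m - k"] that by (auto simp: c'_def)
      ultimately show ?thesis by (auto simp: c'_def)
    qed
    moreover have "graded_module c \<cong>\<^sub>W graded_module c'"
      using witt_iso_trans[OF iso graded_module_iso_gauge[OF h eq]] .
    moreover have "form0 0 c'"
      using form by (auto simp: form0_def simp flip: of_int_add)
    ultimately show ?thesis
      using 3 c' by blast
  qed
qed

text \<open>A solution is determined by its values at 1 and 2, and \<open>a\<close>,
  \<open>b\<close> are chosen to match these. The difference \<open>h\<close> is then propagated
  upwards by the pairs \<open>(1, n)\<close> with n at least 2 (for n = 1 the left factor is 0, so
  the value at 2 is free), to -1 and -2 by \<open>(2, -1)\<close> and \<open>(1, -2)\<close>, and
  downwards by \<open>(-1, n)\<close>.\<close>

lemma quadratic_functional_equation: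
  fixes f :: "int \<Rightarrow> complex"
  assumes f: "\<And>m n. m \<noteq> 0 \<Longrightarrow> n \<noteq> 0 \<Longrightarrow> m + n \<noteq> 0 \<Longrightarrow>
    of_int (n - m) * f (m + n) = of_int (m + n) * (f n - f m)"
  obtains a b where "\<And>m. m \<noteq> 0 \<Longrightarrow> f m = a * of_int m ^ 2 + b * of_int m"
proof -
  define a where "a = (f 2 - 2 * f 1) / 2"
  define b where "b = f 1 - a"
  define h where "h m = f m - (a * of_int m ^ 2 + b * of_int m)" for m
  have h: "of_int (n - m) * h (m + n) = of_int (m + n) * (h n - h m)"
    if "m \<noteq> 0" "n \<noteq> 0" "m + n \<noteq> 0" for m n
  proof -
    have "of_int (n - m) * (a * of_int (m + n) ^ 2 + b * of_int (m + n)) =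
      of_int (m + n) * (a * of_int n ^ 2 + b * of_int n - (a * of_int m ^ 2 + b * of_int m))"
      by (simp add: algebra_simps power2_eq_square)
    then show ?thesis
      using f[OF that] unfolding h_def right_diff_distrib by algebra
  qed
  have h1: "h 1 = 0" "h 2 = 0"
    by (simp_all add: h_def a_def b_def power2_eq_square field_simps)
  have pos: "h (int k + 2) = 0" for k
  proof (induction k)
    case (Suc k)
    have "of_int (int k + 1) * h (int k + 3) = of_int (int k + 3) * (h (int k + 2) - h 1)"
      using h[of 1 "int k + 2"] by (simp add: add_ac)
    then have "of_nat (Suc k) * h (int k + 3) = 0"
      using Suc h1 by (simp add: add.commute)
    then have "h (int k + 3) = 0"
      using of_nat_neq_0[of k, where ?'a = complex] by (metis mult_eq_0_iff)
    then show ?case by (simp add: add_ac)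
  qed (use h1 in simp)
  have m1: "h (- 1) = 0"
    using h[of 2 "- 1"] h1 by simp
  have m2: "h (- 2) = 0"
    using h[of 1 "- 2"] h1 m1 by simp
  have neg: "h (- int k - 2) = 0" for k
  proof (induction k)
    case (Suc k)
    have "of_int (- int k - 1) * h (- int k - 3) = of_int (- int k - 3) * (h (- int k - 2) - h (- 1))"
      using h[of "- 1" "- int k - 2"] by (simp add: algebra_simps)
    moreover have "of_int (- int k - 1) = (- of_nat (Suc k) :: complex)"
      by simp
    ultimately have "- of_nat (Suc k) * h (- int k - 3) = 0"
      by (simp only: Suc m1 diff_self mult_zero_right)
    then have "h (- int k - 3) = 0"
      using of_nat_neq_0[of k, where ?'a = complex] by (metis mult_eq_0_iff neg_equal_0_iff_equal)
    then show ?case by (simp add: algebra_simps)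
  qed (use m2 in simp)
  have "h m = 0" if "m \<noteq> 0" for m
  proof -
    have "m = 1 \<or> m = - 1 \<or> m \<ge> 2 \<or> m \<le> - 2" using that by presburger
    then consider "m = 1" | "m = - 1" | "m \<ge> 2" | "m \<le> - 2" by blast
    then show ?thesis
    proof cases
      case 3
      then show ?thesis using pos[of "nat (m - 2)"] by simp
    next
      case 4
      then show ?thesis using neg[of "nat (- m - 2)"] by simp
    qed (use h1 m1 in auto)
  qed
  then show thesis
    using that[of a b] by (simp add: h_def)
qed

text \<open>Without arrows into or out of index 0, both the line at index 0 and the span of all
  other basis vectors are submodules. \<open>T X\<close> consists of the vectors supported on
  \<open>X\<close>.\<close>

lemma decomposable_of_split:
  fixes M :: "'m::ab_group_add wmod"
  assumes iso: "M \<cong>\<^sub>W graded_module c"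
    and c: "\<And>m. m \<noteq> 0 \<Longrightarrow> c m 0 = 0" "\<And>m. m \<noteq> 0 \<Longrightarrow> c m (- m) = 0"
  shows "\<not> indecomposable M"
proof
  assume ind: "indecomposable M"
  obtain f where f: "Vector_Spaces.linear (scale M) pm_scale f" "bij f"
    "\<And>x v. f (act M x v) = graded_bilin c x (f v)"
    using iso by (auto simp: witt_iso_def)
  interpret vs: vector_space "scale M"
    using f(1) by (simp add: Vector_Spaces.linear_iff)
  have inj: "f v = f w \<longleftrightarrow> v = w" for v w
    using f(2) by (simp add: bij_is_inj inj_eq)
  have surj: "\<exists>v. f v = p" for p
    using f(2) by (metis bij_pointE)
  define T where "T X = {v. \<forall>n. n \<notin> X \<longrightarrow> Poly_Mapping.lookup (f v) n = 0}" for X :: "int set"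
  have sub: "submodule M (T X)" if X: "\<And>m n. n \<in> X \<Longrightarrow> n + m \<notin> X \<Longrightarrow> c m n = 0" for X
  proof -
    have "Poly_Mapping.lookup (graded_bilin c x p) n = 0"
      if p: "\<And>n. n \<notin> X \<Longrightarrow> Poly_Mapping.lookup p n = 0" and n: "n \<notin> X" for x p n
    proof (induction x rule: poly_mapping_additive_induct)
      case (2 m a)
      have "graded_bilin c (Poly_Mapping.single m a) p = pm_scale a (graded_bilin c (L m) p)"
        by (simp add: L_def pm_scale_single flip: graded_bilin_scale_left)
      moreover have "Poly_Mapping.lookup p (n - m) * c m (n - m) = 0"
        using p[of "n - m"] X[of "n - m" m] n by (cases "n - m \<in> X") auto
      ultimately show ?case
        by (simp add: lookup_graded_bilin_L)
    qed (simp_all add: graded_bilin_add_left lookup_add)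
    then show ?thesis
      by (auto simp: submodule_def vs.subspace_def T_def f(3) linear_mapD[OF f(1)] lookup_add)
  qed
  define U where "U = T {0}"
  define V where "V = T (- {0})"
  have "submodule M U"
    unfolding U_def by (rule sub) (use c(1) in auto)
  moreover have "submodule M V"
    unfolding V_def by (rule sub) (metis ComplD ComplI add_eq_0_iff c(2) minus_minus neg_equal_0_iff_equal singletonD singletonI)
  moreover have "U \<inter> V = {0}"
  proof -
    have "v = 0" if "v \<in> U" "v \<in> V" for v
    proof -
      have "Poly_Mapping.lookup (f v) n = 0" for n
        using that by (cases "n = 0") (auto simp: U_def V_def T_def)
      then have "f v = f 0"
        by (simp add: linear_mapD[OF f(1)] poly_mapping_eqI)
      then show ?thesis by (simp add: inj)
    qed
    moreover have "0 \<in> U" "0 \<in> V"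
      by (simp_all add: U_def V_def T_def linear_mapD[OF f(1)])
    ultimately show ?thesis by blast
  qed
  moreover have "{u + v |u v. u \<in> U \<and> v \<in> V} = UNIV"
  proof -
    have "\<exists>u v. w = u + v \<and> u \<in> U \<and> v \<in> V" for w
    proof -
      obtain u where u: "f u = Poly_Mapping.single 0 (Poly_Mapping.lookup (f w) 0)"
        using surj by blast
      have "w = u + (w - u)" "u \<in> U" "w - u \<in> V"
        by (auto simp: U_def V_def T_def u linear_mapD[OF f(1)] lookup_minus lookup_single)
      then show ?thesis by blast
    qed
    then show ?thesis by blast
  qed
  ultimately have "U = {0} \<or> V = {0}"
    using ind unfolding indecomposable_def by blast
  moreover have "U \<noteq> {0}"
  proof -
    obtain u where u: "f u = unit_vec 0" using surj by blast
    then have "u \<in> U" by (simp add: U_def T_def lookup_single del: single_one)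
    moreover have "u \<noteq> 0"
      using u linear_mapD(4)[OF f(1)] by auto
    ultimately show ?thesis by blast
  qed
  moreover have "V \<noteq> {0}"
  proof -
    obtain u where u: "f u = unit_vec 1" using surj by blast
    then have "u \<in> V" by (simp add: V_def T_def lookup_single)
    moreover have "u \<noteq> 0"
      using arg_cong[OF u, of "\<lambda>p. Poly_Mapping.lookup p 1"] linear_mapD(4)[OF f(1)] by auto
    ultimately show ?thesis by blast
  qed
  ultimately show False by blast
qed

lemma B_mod_0_iso_Omega:
  assumes "b \<noteq> 0" shows "B_mod (0, b) \<cong>\<^sub>W Omega 0 0"
  unfolding B_mod_eq_graded Omega_eq_graded
  by (rule graded_module_iso_gauge[where g = "\<lambda>n. if n = 0 then - b else 1"])
    (use assms in \<open>auto simp: add_eq_0_iff\<close>)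

lemma A_mod_0_iso_Omega:
  assumes "b \<noteq> 0" shows "A_mod (0, b) \<cong>\<^sub>W Omega 1 0"
  unfolding A_mod_eq_graded Omega_eq_graded
  by (rule graded_module_iso_gauge[where g = "\<lambda>n. if n = 0 then 1 / b else 1"])
    (use assms in \<open>auto simp: add_eq_0_iff\<close>)

text \<open>Indecomposability serves to exclude \<open>(a, b) = (0, 0)\<close>, where weight 0
  splits off. The point at infinity is distributed asymmetrically: B_{0,b} is listed under
  Omega^0_0, whereas Omega^1_0 remains in the family \<open>A\<close>.\<close>

lemma class_S_degree_01_cases:
  fixes M :: "'m::ab_group_add wmod"
  assumes M: "class_S M" "indecomposable M" "deg M = {0, 1}"
  obtains (Omega) s where "s = 0 \<or> s \<notin> \<int>" "M \<cong>\<^sub>W Omega 0 s"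
    | (A) a b where "(a, b) \<noteq> (0, 0)" "M \<cong>\<^sub>W A_mod (a, b)"
    | (B) a b where "a \<noteq> 0" "M \<cong>\<^sub>W B_mod (a, b)"
proof -
  obtain s c where s: "s = 0 \<or> s \<notin> \<int>" and iso: "M \<cong>\<^sub>W graded_module c" and c: "witt_coeffs s c"
    by (rule class_S_graded[OF M(1)]) (rule that)
  have "\<not> (d \<notin> {0, 1} \<and> graded_module c \<cong>\<^sub>W Omega d s)" for d
  proof
    assume "d \<notin> {0, 1} \<and> graded_module c \<cong>\<^sub>W Omega d s"
    then have "\<exists>d s. d \<notin> {0, 1} \<and> M \<cong>\<^sub>W Omega d s"
      using witt_iso_trans[OF iso] by blast
    then have "0 \<notin> deg M" by (simp add: deg_def)
    then show False using M(3) by simp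
  qed
  with witt_coeffs_classification[OF c s] consider
    "s \<notin> \<int>" "graded_module c \<cong>\<^sub>W Omega 0 s"
    | c' where "graded_module c \<cong>\<^sub>W graded_module c'" "witt_coeffs 0 c'" "form0 0 c'"
      "\<And>k m. k \<noteq> 0 \<Longrightarrow> m \<noteq> 0 \<Longrightarrow> c' k (- k) * c' m 0 = 0"
    by blast
  then show thesis
  proof cases
    case 1
    then show ?thesis using Omega witt_iso_trans[OF iso] by blast
  next
    case 2
    have iso': "M \<cong>\<^sub>W graded_module c'"
      using witt_iso_trans[OF iso 2(1)] .
    have form: "c' m n = of_int n" if "n \<noteq> 0" "n + m \<noteq> 0" for m n
      using form0D[OF 2(3), of n m] that by (simp flip: of_int_add)
    have c00: "c' 0 0 = 0"
      using witt_coeffs_0[OF 2(2), of 0] by simp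
    \<comment> \<open>Either no arrow leads into weight 0, which gives the family \<open>A\<close>,
      or none leads out of it, which gives the family \<open>B\<close>.\<close>
    consider "\<And>k. k \<noteq> 0 \<Longrightarrow> c' k (- k) = 0" | "\<And>m. m \<noteq> 0 \<Longrightarrow> c' m 0 = 0"
      using 2(4) by (metis mult_eq_0_iff)
    then show ?thesis
    proof cases
      case 1
      \<comment> \<open>The bracket relation on the vector of weight 0 relates the values
        \<open>n * c' n 0\<close>; multiplying by \<open>m + n\<close> puts it into the shape of the
        functional equation.\<close>
      have "of_int (n - m) * (of_int (m + n) * c' (m + n) 0) =
          of_int (m + n) * (of_int n * c' n 0 - of_int m * c' m 0)"
        if "m \<noteq> 0" "n \<noteq> 0" "m + n \<noteq> 0" for m n
      proof -
        have "of_int n * c' n 0 - of_int m * c' m 0 = of_int (n - m) * c' (m + n) 0"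
          using witt_coeffs_rel[OF 2(2), of n 0 m] form[of n m] form[of m n] that
          by (simp add: algebra_simps)
        then show ?thesis by (simp only: mult.left_commute)
      qed
      from quadratic_functional_equation[of "\<lambda>m. of_int m * c' m 0", OF this]
      obtain a b where ab: "\<And>m. m \<noteq> 0 \<Longrightarrow> of_int m * c' m 0 = a * of_int m ^ 2 + b * of_int m"
        by blast
      have isoA: "graded_module c' \<cong>\<^sub>W A_mod (a, b)"
        unfolding A_mod_eq_graded
      \<comment> \<open>Passing from Omega^0 form to Omega^1 form by the factor \<open>1 / n\<close>
        multiplies the arrow from 0 to \<open>m\<close> by \<open>m\<close>, which is why the
        quadratic was found for \<open>m * c' m 0\<close>.\<close>
      proof (rule graded_module_iso_gauge[where g = "\<lambda>n. if n = 0 then 1 else 1 / of_int n"])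
        fix m n :: int
        consider "n = 0" "m = 0" | "n = 0" "m \<noteq> 0" | "n \<noteq> 0" "n + m = 0" | "n \<noteq> 0" "n + m \<noteq> 0"
          by blast
        then show "(if n = 0 then 1 else 1 / of_int n) * c' m n =
          (if n \<noteq> 0 then of_int (m + n) else a * of_int m ^ 2 + b * of_int m) *
            (if n + m = 0 then 1 else 1 / of_int (n + m))"
        proof cases
          case 2
          then show ?thesis using ab[of m] by (simp add: field_simps)
        next
          case 3
          then have "m \<noteq> 0" "n = - m" by auto
          then show ?thesis using 1[of m] by simp
        next
          case 4
          then have "of_int m + of_int n \<noteq> (0::complex)"
            by (metis add.commute of_int_add of_int_eq_0_iff)
          then show ?thesis using 4 form[of n m] by (simp add: add.commute)
        qed (simp add: c00)
      qed simp
      have "(a, b) \<noteq> (0, 0)"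
      proof
        assume "(a, b) = (0, 0)"
        then have "c' m 0 = 0" if "m \<noteq> 0" for m
          using ab[OF that] that by simp
        then show False
          using decomposable_of_split[OF iso'] 1 M(2) by blast
      qed
      then show ?thesis
        using A witt_iso_trans[OF iso' isoA] by blast
    next
      case 2
      \<comment> \<open>For arrows into weight 0 the relation is evaluated at index -(m + n), so
        that both orders of the product end at 0; the common factor m + n comes from the first
        letter of each.\<close>
      have "of_int (n - m) * c' (m + n) (- (m + n)) =
          of_int (m + n) * (c' n (- n) - c' m (- m))"
        if "m \<noteq> 0" "n \<noteq> 0" "m + n \<noteq> 0" for m n
      proof -
        have f: "c' m (- (m + n)) = - of_int (m + n)" "c' n (- (m + n)) = - of_int (m + n)"
          using form[of "- (m + n)" m] form[of "- (m + n)" n] that by simp_all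
        have "n + - (m + n) = - m" "m + - (m + n) = - n" by simp_all
        then show ?thesis
          using witt_coeffs_rel[OF \<open>witt_coeffs 0 c'\<close>, of n "- (m + n)" m]
          by (simp only: f) (simp add: algebra_simps)
      qed
      from quadratic_functional_equation[of "\<lambda>m. c' m (- m)", OF this]
      obtain a b where ab: "\<And>m. m \<noteq> 0 \<Longrightarrow> c' m (- m) = a * of_int m ^ 2 + b * of_int m"
        by blast
      have "c' m n = (if m + n \<noteq> 0 then of_int n else a * of_int m ^ 2 + b * of_int m)" for m n
      proof -
        consider "n = 0" "m = 0" | "n = 0" "m \<noteq> 0" | "n \<noteq> 0" "n + m = 0" | "n \<noteq> 0" "n + m \<noteq> 0"
          by blast
        then show ?thesis
        proof cases
          case 3
          then have "m \<noteq> 0" "n = - m" by auto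
          then show ?thesis using ab[of m] by simp
        qed (use 2 form[of n m] c00 in \<open>auto simp: add.commute\<close>)
      qed
      then have "c' = (\<lambda>m n. if m + n \<noteq> 0 then of_int n else a * of_int m ^ 2 + b * of_int m)"
        by (intro ext)
      then have c'B: "graded_module c' = B_mod (a, b)"
        by (simp add: B_mod_eq_graded)
      have "(a, b) \<noteq> (0, 0)"
      proof
        assume "(a, b) = (0, 0)"
        then have "c' m (- m) = 0" if "m \<noteq> 0" for m
          using ab[OF that] that by simp
        then show False
          using decomposable_of_split[OF iso'] 2 M(2) by blast
      qed
      then consider "a \<noteq> 0" | "a = 0" "b \<noteq> 0" by auto
      then show ?thesis
      proof cases
        case 1
        then show ?thesis using B iso' c'B by simp
      next
        case 2
        then have "M \<cong>\<^sub>W Omega 0 0"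
          using iso' witt_iso_trans[OF _ B_mod_0_iso_Omega] by (simp add: c'B)
        then show ?thesis using Omega[of 0] by simp
      qed
    qed
  qed
qed

section \<open>Equivariant bilinear maps in coordinates\<close>

lemma witt_iso_gradedE:
  fixes M :: "'m::ab_group_add wmod"
  assumes "M \<cong>\<^sub>W graded_module c"
  obtains f F where "Vector_Spaces.linear (scale M) pm_scale f" "Vector_Spaces.linear pm_scale (scale M) F"
    "\<And>v. F (f v) = v" "\<And>p. f (F p) = p" "\<And>x v. f (act M x v) = graded_bilin c x (f v)"
    "\<And>x p. F (graded_bilin c x p) = act M x (F p)"
proof -
  obtain f where f: "Vector_Spaces.linear (scale M) pm_scale f" "bij f"
    "\<And>x v. f (act M x v) = graded_bilin c x (f v)"
    using assms by (auto simp: witt_iso_def)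
  define F where "F = inv f"
  have Ff: "F (f v) = v" and fF: "f (F p) = p" for v p
    using f(2) by (simp_all add: F_def bij_is_inj bij_is_surj surj_f_inv_f)
  have inj: "v = w" if "f v = f w" for v w
    using that Ff by metis
  have "Vector_Spaces.linear pm_scale (scale M) F"
    unfolding Vector_Spaces.linear_iff
    using f(1) by (auto simp: Vector_Spaces.linear_iff fF intro!: inj)
  moreover have "F (graded_bilin c x p) = act M x (F p)" for x p
    by (rule inj) (simp add: f(3) fF)
  ultimately show thesis
    using that f(1,3) Ff fF by blast
qed

definition equivariant ::
  "(int \<Rightarrow> int \<Rightarrow> complex) \<Rightarrow> (int \<Rightarrow> int \<Rightarrow> complex) \<Rightarrow> (int \<Rightarrow> int \<Rightarrow> complex) \<Rightarrow>
    (int \<Rightarrow> int \<Rightarrow> complex) \<Rightarrow> bool" where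
  "equivariant cM cN cP k \<longleftrightarrow>
     (\<forall>m i j. cP m (i + j) * k i j = cM m i * k (i + m) j + cN m j * k i (j + m))"

definition germ_zero :: "(int \<Rightarrow> int \<Rightarrow> complex) \<Rightarrow> bool" where
  "germ_zero k \<longleftrightarrow> (\<exists>X. \<forall>i\<ge>X. \<forall>j\<ge>X. k i j = 0)"

lemma equivariantD:
  "equivariant cM cN cP k \<Longrightarrow> cP m (i + j) * k i j = cM m i * k (i + m) j + cN m j * k i (j + m)"
  by (simp add: equivariant_def)

lemma equivariant_swap:
  "equivariant cM cN cP k \<Longrightarrow> equivariant cN cM cP (\<lambda>i j. k j i)"
  unfolding equivariant_def by (metis add.commute)

lemma germ_zero_swap: "germ_zero (\<lambda>i j. k j i) \<longleftrightarrow> germ_zero k"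
  by (auto simp: germ_zero_def)

lemma graded_bilin_coeff_add:
  "graded_bilin (\<lambda>i j. k i j + l i j) p q = graded_bilin k p q + graded_bilin l p q"
  by (simp add: graded_bilin_def algebra_simps single_add sum.distrib)

lemma graded_bilin_coeff_scale:
  "graded_bilin (\<lambda>i j. a * k i j) p q = pm_scale a (graded_bilin k p q)"
  by (simp add: graded_bilin_def pm_scale_sum pm_scale_single algebra_simps)

lemma graded_bilin_equivariant_iff:
  "equivariant cM cN cP k \<longleftrightarrow>
    (\<forall>x p q. graded_bilin cP x (graded_bilin k p q) =
      graded_bilin k (graded_bilin cM x p) q + graded_bilin k p (graded_bilin cN x q))"
proof
  assume k: "equivariant cM cN cP k"
  show "\<forall>x p q. graded_bilin cP x (graded_bilin k p q) =
      graded_bilin k (graded_bilin cM x p) q + graded_bilin k p (graded_bilin cN x q)"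
  proof (intro allI)
    fix x p q
    show "graded_bilin cP x (graded_bilin k p q) =
      graded_bilin k (graded_bilin cM x p) q + graded_bilin k p (graded_bilin cN x q)"
    proof (induction p rule: poly_mapping_additive_induct)
      case (2 i a)
      show ?case
      proof (induction q rule: poly_mapping_additive_induct)
        case (2 j b)
        show ?case
        proof (induction x rule: poly_mapping_additive_induct)
          case (2 m d)
          have "d * a * b * (cP m (i + j) * k i j) =
              d * a * b * (cM m i * k (i + m) j + cN m j * k i (j + m))"
            by (simp only: equivariantD[OF k])
          then have "d * (a * b * k i j) * cP m (i + j) =
              d * a * cM m i * b * k (m + i) j + a * (d * b * cN m j) * k i (m + j)"
            by (simp add: algebra_simps)
          moreover have "m + (i + j) = m + i + j" "m + i + j = i + (m + j)" by simp_all
          ultimately show ?case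
            by (simp only: graded_bilin_single) (simp add: single_add add_ac)
        qed (simp_all add: graded_bilin_add_left graded_bilin_add_right)
      qed (simp_all add: graded_bilin_add_left graded_bilin_add_right)
    qed (simp_all add: graded_bilin_add_left graded_bilin_add_right)
  qed
next
  assume eq: "\<forall>x p q. graded_bilin cP x (graded_bilin k p q) =
      graded_bilin k (graded_bilin cM x p) q + graded_bilin k p (graded_bilin cN x q)"
  have "cP m (i + j) * k i j = cM m i * k (i + m) j + cN m j * k i (j + m)" for m i j
  proof -
    have "Poly_Mapping.lookup (graded_bilin cP (L m) (graded_bilin k (unit_vec i) (unit_vec j))) (m + i + j) =
       Poly_Mapping.lookup (graded_bilin k (graded_bilin cM (L m) (unit_vec i)) (unit_vec j) +
         graded_bilin k (unit_vec i) (graded_bilin cN (L m) (unit_vec j))) (m + i + j)"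
      using eq by simp
    then show ?thesis
      by (simp add: L_def graded_bilin_single lookup_add lookup_single add_ac mult_ac del: single_one)
  qed
  then show "equivariant cM cN cP k"
    by (simp add: equivariant_def)
qed

lemma lookup_of_eigenvector:
  assumes "\<And>n. c 0 n = r + of_int n" "graded_bilin c (L 0) p = pm_scale t p"
    and "r + of_int n \<noteq> t"
  shows "Poly_Mapping.lookup p n = 0"
proof -
  have "Poly_Mapping.lookup (graded_bilin c (L 0) p) n = Poly_Mapping.lookup (pm_scale t p) n"
    using assms(2) by simp
  then have "Poly_Mapping.lookup p n * (r + of_int n - t) = 0"
    by (simp add: lookup_graded_bilin_L assms(1) algebra_simps)
  then show ?thesis using assms(3) by simp
qed

lemma graded_bilin_L_0:
  assumes "\<And>n. c 0 n = r + of_int n"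
  shows "graded_bilin c (L 0) (unit_vec n) = pm_scale (r + of_int n) (unit_vec n)"
  by (simp add: L_def graded_bilin_single pm_scale_single assms del: single_one)

lemma bilin_pm_eqI:
  assumes "\<And>p. Vector_Spaces.linear pm_scale pm_scale (B p)"
    "\<And>q. Vector_Spaces.linear pm_scale pm_scale (\<lambda>p. B p q)"
    "\<And>i j. B (unit_vec i) (unit_vec j) = Poly_Mapping.single (i + j) (k i j)"
  shows "B p q = graded_bilin k p q"
proof (rule linear_pm_eqI[OF assms(1) linear_graded_bilin(1)])
  show "B p (unit_vec j) = graded_bilin k p (unit_vec j)" for j
  proof (rule linear_pm_eqI[OF assms(2) linear_graded_bilin(2)])
    show "B (unit_vec i) (unit_vec j) = graded_bilin k (unit_vec i) (unit_vec j)" for i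
      by (simp add: assms(3) graded_bilin_single del: single_one)
  qed
qed

locale graded_triple =
  fixes M :: "'m::ab_group_add wmod" and N :: "'n::ab_group_add wmod" and P :: "'p::ab_group_add wmod"
    and cM cN cP :: "int \<Rightarrow> int \<Rightarrow> complex" and s t r :: complex
  assumes isoM: "M \<cong>\<^sub>W graded_module cM" and isoN: "N \<cong>\<^sub>W graded_module cN"
    and isoP: "P \<cong>\<^sub>W graded_module cP"
    and cM0: "\<And>n. cM 0 n = s + of_int n" and cN0: "\<And>n. cN 0 n = t + of_int n"
    and cP0: "\<And>n. cP 0 n = r + of_int n"
begin

text \<open>Equivariance under L_0 makes \<open>B (unit_vec i) (unit_vec j)\<close> an eigenvector
  for the sum of the two weights, so it has no component at any other weight of the target.\<close>

lemma bilin_W_coordinates: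
  assumes f: "Vector_Spaces.linear (scale M) pm_scale f" "Vector_Spaces.linear pm_scale (scale M) F"
      "\<And>v. F (f v) = v" "\<And>p. f (F p) = p" "\<And>x v. f (act M x v) = graded_bilin cM x (f v)"
      "\<And>x p. F (graded_bilin cM x p) = act M x (F p)"
    and g: "Vector_Spaces.linear (scale N) pm_scale g" "Vector_Spaces.linear pm_scale (scale N) G"
      "\<And>v. G (g v) = v" "\<And>p. g (G p) = p" "\<And>x v. g (act N x v) = graded_bilin cN x (g v)"
      "\<And>x p. G (graded_bilin cN x p) = act N x (G p)"
    and h: "Vector_Spaces.linear (scale P) pm_scale h" "Vector_Spaces.linear pm_scale (scale P) H"
      "\<And>v. H (h v) = v" "\<And>p. h (H p) = p" "\<And>x v. h (act P x v) = graded_bilin cP x (h v)"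
      "\<And>x p. H (graded_bilin cP x p) = act P x (H p)"
    and pi: "\<pi> \<in> bilin_W M N P"
  defines "B \<equiv> \<lambda>p q. h (\<pi> (F p) (G q))"
  shows "Vector_Spaces.linear pm_scale pm_scale (B p)"
    "Vector_Spaces.linear pm_scale pm_scale (\<lambda>p. B p q)"
    "r + of_int n \<noteq> s + of_int i + (t + of_int j) \<Longrightarrow>
      Poly_Mapping.lookup (B (unit_vec i) (unit_vec j)) n = 0"
    "graded_bilin cP x (B p q) = B (graded_bilin cM x p) q + B p (graded_bilin cN x q)"
proof -
  have pi1: "Vector_Spaces.linear (scale N) (scale P) (\<pi> m)"
    and pi2: "Vector_Spaces.linear (scale M) (scale P) (\<lambda>m. \<pi> m n)"
    and pi3: "act P x (\<pi> m n) = \<pi> (act M x m) n + \<pi> m (act N x n)" for x m n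
    using pi by (auto simp: bilin_W_def)
  show 1: "Vector_Spaces.linear pm_scale pm_scale (B p)" for p
    by (auto simp: Vector_Spaces.linear_iff B_def vector_space_pm_scale linear_mapD[OF h(1)]
        linear_mapD[OF g(2)] linear_mapD[OF pi1])
  show 2: "Vector_Spaces.linear pm_scale pm_scale (\<lambda>p. B p q)" for q
    by (auto simp: Vector_Spaces.linear_iff B_def vector_space_pm_scale linear_mapD[OF h(1)]
        linear_mapD[OF f(2)] linear_mapD[OF pi2])
  show 3: "graded_bilin cP x (B p q) = B (graded_bilin cM x p) q + B p (graded_bilin cN x q)" for x p q
    unfolding B_def h(5)[symmetric] pi3 linear_mapD(1)[OF h(1)] f(6) g(6) ..
  show "Poly_Mapping.lookup (B (unit_vec i) (unit_vec j)) n = 0"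
    if "r + of_int n \<noteq> s + of_int i + (t + of_int j)"
  proof (rule lookup_of_eigenvector[of cP, OF cP0 _ that])
    have "pm_scale (a + b) p = pm_scale a p + pm_scale b p" for a b p
      by (rule poly_mapping_eqI) (simp add: lookup_add algebra_simps)
    then show "graded_bilin cP (L 0) (B (unit_vec i) (unit_vec j)) =
        pm_scale (s + of_int i + (t + of_int j)) (B (unit_vec i) (unit_vec j))"
      unfolding 3 graded_bilin_L_0[of cM, OF cM0] graded_bilin_L_0[of cN, OF cN0]
        linear_mapD(2)[OF 1] linear_mapD(2)[OF 2] by simp
  qed
qed

lemma bilin_W_trivial:
  assumes "s + t - r \<notin> \<int>" "\<pi> \<in> bilin_W M N P"
  shows "\<pi> = (\<lambda>_ _. 0)"
proof -
  obtain f F where f: "Vector_Spaces.linear (scale M) pm_scale f" "Vector_Spaces.linear pm_scale (scale M) F"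
      "\<And>v. F (f v) = v" "\<And>p. f (F p) = p" "\<And>x v. f (act M x v) = graded_bilin cM x (f v)"
      "\<And>x p. F (graded_bilin cM x p) = act M x (F p)"
    by (rule witt_iso_gradedE[OF isoM]) (rule that)
  obtain g G where g: "Vector_Spaces.linear (scale N) pm_scale g" "Vector_Spaces.linear pm_scale (scale N) G"
      "\<And>v. G (g v) = v" "\<And>p. g (G p) = p" "\<And>x v. g (act N x v) = graded_bilin cN x (g v)"
      "\<And>x p. G (graded_bilin cN x p) = act N x (G p)"
    by (rule witt_iso_gradedE[OF isoN]) (rule that)
  obtain h H where h: "Vector_Spaces.linear (scale P) pm_scale h" "Vector_Spaces.linear pm_scale (scale P) H"
      "\<And>v. H (h v) = v" "\<And>p. h (H p) = p" "\<And>x v. h (act P x v) = graded_bilin cP x (h v)"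
      "\<And>x p. H (graded_bilin cP x p) = act P x (H p)"
    by (rule witt_iso_gradedE[OF isoP]) (rule that)
  note B = bilin_W_coordinates[OF f g h assms(2)]
  have ne: "r + of_int n \<noteq> s + of_int i + (t + of_int j)" for n i j
  proof
    assume "r + of_int n = s + of_int i + (t + of_int j)"
    then have "s + t - r = of_int (n - i - j)" by (simp add: algebra_simps)
    then show False using assms(1) by simp
  qed
  have "h (\<pi> (F (unit_vec i)) (G (unit_vec j))) = Poly_Mapping.single (i + j) 0" for i j
    by (rule poly_mapping_eqI) (simp add: B(3)[OF ne])
  then have "h (\<pi> (F p) (G q)) = graded_bilin (\<lambda>_ _. 0) p q" for p q
    by (rule bilin_pm_eqI[where B = "\<lambda>p q. h (\<pi> (F p) (G q))", OF B(1,2)])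
  then have "h (\<pi> (F p) (G q)) = 0" for p q
    by (simp add: graded_bilin_def)
  then have "\<pi> (F p) (G q) = 0" for p q
    using h(3) linear_mapD(4)[OF h(2)] by metis
  then have "\<pi> m n = 0" for m n
    using f(3) g(3) by metis
  then show ?thesis by blast
qed

text \<open>\<open>\<Phi> k\<close> is the map with coefficients \<open>k\<close>, transported
  through chosen isomorphisms. Only its linearity and the translation of the two subspaces are
  exported, so everything later concerns arrays. The exact equality \<open>r = s + t\<close>, not
  just a congruence, makes \<open>i + j\<close> the index in the target.\<close>

lemma bilin_W_parametrization:
  assumes r: "r = s + t"
  obtains \<Phi> :: "(int \<Rightarrow> int \<Rightarrow> complex) \<Rightarrow> 'm \<Rightarrow> 'n \<Rightarrow> 'p" where
    "\<And>\<pi>. \<pi> \<in> bilin_W M N P \<longleftrightarrow> (\<exists>k. equivariant cM cN cP k \<and> \<pi> = \<Phi> k)"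
    "\<And>k. equivariant cM cN cP k \<Longrightarrow> \<Phi> k \<in> bilin_W0 M N P \<longleftrightarrow> germ_zero k"
    "\<And>k l. \<Phi> (\<lambda>i j. k i j + l i j) = \<Phi> k + \<Phi> l"
    "\<And>a k. \<Phi> (\<lambda>i j. a * k i j) = (\<lambda>m n. scale P a (\<Phi> k m n))"
proof -
  obtain f F where f: "Vector_Spaces.linear (scale M) pm_scale f" "Vector_Spaces.linear pm_scale (scale M) F"
      "\<And>v. F (f v) = v" "\<And>p. f (F p) = p" "\<And>x v. f (act M x v) = graded_bilin cM x (f v)"
      "\<And>x p. F (graded_bilin cM x p) = act M x (F p)"
    by (rule witt_iso_gradedE[OF isoM]) (rule that)
  obtain g G where g: "Vector_Spaces.linear (scale N) pm_scale g" "Vector_Spaces.linear pm_scale (scale N) G"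
      "\<And>v. G (g v) = v" "\<And>p. g (G p) = p" "\<And>x v. g (act N x v) = graded_bilin cN x (g v)"
      "\<And>x p. G (graded_bilin cN x p) = act N x (G p)"
    by (rule witt_iso_gradedE[OF isoN]) (rule that)
  obtain h H where h: "Vector_Spaces.linear (scale P) pm_scale h" "Vector_Spaces.linear pm_scale (scale P) H"
      "\<And>v. H (h v) = v" "\<And>p. h (H p) = p" "\<And>x v. h (act P x v) = graded_bilin cP x (h v)"
      "\<And>x p. H (graded_bilin cP x p) = act P x (H p)"
    by (rule witt_iso_gradedE[OF isoP]) (rule that)
  define \<Phi> where "\<Phi> k = (\<lambda>m n. H (graded_bilin k (f m) (g n)))" for k
  have vsM: "vector_space (scale M)" and vsN: "vector_space (scale N)" and vsP: "vector_space (scale P)"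
    using f(1) g(1) h(1) by (simp_all add: Vector_Spaces.linear_iff)
  have H_inj: "H p = H q \<longleftrightarrow> p = q" for p q
    using h(4) by metis
  have \<Phi>_in: "\<Phi> k \<in> bilin_W M N P" if "equivariant cM cN cP k" for k
    unfolding bilin_W_def
  proof (intro CollectI conjI allI)
    fix m n x
    show "Vector_Spaces.linear (scale N) (scale P) (\<Phi> k m)"
      by (simp add: Vector_Spaces.linear_iff \<Phi>_def vsN vsP linear_mapD[OF g(1)] linear_mapD[OF h(2)]
          graded_bilin_add_right graded_bilin_scale_right)
    show "Vector_Spaces.linear (scale M) (scale P) (\<lambda>m. \<Phi> k m n)"
      by (simp add: Vector_Spaces.linear_iff \<Phi>_def vsM vsP linear_mapD[OF f(1)] linear_mapD[OF h(2)]
          graded_bilin_add_left graded_bilin_scale_left)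
    show "act P x (\<Phi> k m n) = \<Phi> k (act M x m) n + \<Phi> k m (act N x n)"
      using that unfolding graded_bilin_equivariant_iff
      by (simp add: \<Phi>_def f(5) g(5) linear_mapD(1)[OF h(2), symmetric] flip: h(6))
  qed
  have ex: "\<exists>k. equivariant cM cN cP k \<and> \<pi> = \<Phi> k" if pi: "\<pi> \<in> bilin_W M N P" for \<pi>
  proof -
    note B = bilin_W_coordinates[OF f g h pi]
    define k where "k i j = Poly_Mapping.lookup (h (\<pi> (F (unit_vec i)) (G (unit_vec j)))) (i + j)" for i j
    have "h (\<pi> (F (unit_vec i)) (G (unit_vec j))) = Poly_Mapping.single (i + j) (k i j)" for i j
    proof (rule poly_mapping_eqI)
      fix n
      show "Poly_Mapping.lookup (h (\<pi> (F (unit_vec i)) (G (unit_vec j)))) n =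
          Poly_Mapping.lookup (Poly_Mapping.single (i + j) (k i j)) n"
      proof (cases "n = i + j")
        case False
        have "r + of_int n \<noteq> s + of_int i + (t + of_int j)"
        proof
          assume "r + of_int n = s + of_int i + (t + of_int j)"
          then have "of_int n = (of_int (i + j) :: complex)" by (simp add: r)
          then show False using False by (simp only: of_int_eq_iff)
        qed
        then show ?thesis using B(3) False by (simp add: lookup_single)
      qed (simp add: k_def)
    qed
    then have hB: "h (\<pi> (F p) (G q)) = graded_bilin k p q" for p q
      by (rule bilin_pm_eqI[where B = "\<lambda>p q. h (\<pi> (F p) (G q))", OF B(1,2)])
    have "equivariant cM cN cP k"
      unfolding graded_bilin_equivariant_iff using B(4) by (simp add: hB)
    moreover have "\<pi> m n = \<Phi> k m n" for m n
      using h(3)[of "\<pi> m n"] by (simp add: \<Phi>_def f(3) g(3) flip: hB)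
    ultimately show ?thesis by blast
  qed
  \<comment> \<open>The vectors supported on indices of weight with real part at least
    \<open>x\<close> form a subspace that contains all generating weight vectors, hence their span.
    The module is arbitrary, so that both factors are covered.\<close>
  have weight_ge_support: "\<forall>n. Poly_Mapping.lookup (e v) n \<noteq> 0 \<longrightarrow> Re u + of_int n \<ge> x"
    if e: "Vector_Spaces.linear (scale Q) pm_scale e" "\<And>x v. e (act Q x v) = graded_bilin c x (e v)"
      and c0: "\<And>n. c 0 n = u + of_int n" and v: "v \<in> weight_ge Q x"
    for Q :: "'q::ab_group_add wmod" and e c u x v
  proof -
    interpret vs: vector_space "scale Q"
      using e(1) by (simp add: Vector_Spaces.linear_iff)
    define T where "T = {v. \<forall>n. Poly_Mapping.lookup (e v) n \<noteq> 0 \<longrightarrow> Re u + of_int n \<ge> x}"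
    have "vs.span (\<Union>s\<in>{s. Re s \<ge> x}. weight_space Q s) \<subseteq> T"
    proof (rule vs.span_minimal)
      show "vs.subspace T"
        unfolding vs.subspace_def T_def
        by (auto simp: linear_mapD[OF e(1)] lookup_add) (metis add.right_neutral)
      show "(\<Union>s\<in>{s. Re s \<ge> x}. weight_space Q s) \<subseteq> T"
      proof clarify
        fix w z assume z: "x \<le> Re z" and w: "w \<in> weight_space Q z"
        have "graded_bilin c (L 0) (e w) = pm_scale z (e w)"
          using w by (simp add: weight_space_def linear_mapD[OF e(1)] flip: e(2))
        then have "u + of_int n = z" if "Poly_Mapping.lookup (e w) n \<noteq> 0" for n
          using lookup_of_eigenvector[of c, OF c0] that by blast
        then show "w \<in> T"
          using z by (force simp: T_def)
      qed
    qed
    then show ?thesis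
      using v by (auto simp: weight_ge_def T_def)
  qed
  have weight_ge_unit: "E (unit_vec n) \<in> weight_ge Q x"
    if E: "Vector_Spaces.linear pm_scale (scale Q) E" "\<And>x p. E (graded_bilin c x p) = act Q x (E p)"
      and c0: "\<And>n. c 0 n = u + of_int n" and n: "Re u + of_int n \<ge> x"
    for Q :: "'q::ab_group_add wmod" and E c u x n
  proof -
    interpret vs: vector_space "scale Q"
      using E(1) by (simp add: Vector_Spaces.linear_iff)
    have "E (unit_vec n) \<in> weight_space Q (u + of_int n)"
      unfolding weight_space_def mem_Collect_eq E(2)[symmetric] graded_bilin_L_0[of c, OF c0]
      by (rule linear_mapD(2)[OF E(1)])
    then show ?thesis
      unfolding weight_ge_def using n by (intro vs.span_base UN_I[of "u + of_int n"]) auto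
  qed
  have zero_iff: "\<Phi> k \<in> bilin_W0 M N P \<longleftrightarrow> germ_zero k" if k: "equivariant cM cN cP k" for k
  proof
    assume "\<Phi> k \<in> bilin_W0 M N P"
    then obtain x where x: "\<And>m n. m \<in> weight_ge M x \<Longrightarrow> n \<in> weight_ge N x \<Longrightarrow> \<Phi> k m n = 0"
      by (force simp: bilin_W0_def eventually_at_top_linorder)
    \<comment> \<open>Turns a bound on real parts of weights into a bound on indices, valid for both
      factors simultaneously.\<close>
    define X where "X = \<lceil>\<bar>x\<bar> + \<bar>Re s\<bar> + \<bar>Re t\<bar>\<rceil>"
    have "k i j = 0" if "i \<ge> X" "j \<ge> X" for i j
    proof -
      have "Re s + of_int i \<ge> x" "Re t + of_int j \<ge> x"
        using that unfolding X_def by linarith+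
      then have "\<Phi> k (F (unit_vec i)) (G (unit_vec j)) = 0"
        by (intro x weight_ge_unit[OF f(2,6) cM0] weight_ge_unit[OF g(2,6) cN0])
      then have "graded_bilin k (unit_vec i) (unit_vec j) = 0"
        using H_inj[of _ 0] linear_mapD(4)[OF h(2)] by (simp add: \<Phi>_def f(4) g(4))
      then have "Poly_Mapping.single (i + j) (k i j) = 0"
        by (simp only: graded_bilin_single) simp
      then show ?thesis
        by (metis lookup_single_eq lookup_zero)
    qed
    then show "germ_zero k" by (auto simp: germ_zero_def)
  next
    assume "germ_zero k"
    then obtain X where X: "\<And>i j. i \<ge> X \<Longrightarrow> j \<ge> X \<Longrightarrow> k i j = 0"
      by (auto simp: germ_zero_def)
    have "\<Phi> k m n = 0" if x: "x \<ge> \<bar>of_int X\<bar> + \<bar>Re s\<bar> + \<bar>Re t\<bar>"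
      and mn: "m \<in> weight_ge M x" "n \<in> weight_ge N x" for x m n
    proof -
      have "k i j = 0" if "i \<in> Poly_Mapping.keys (f m)" "j \<in> Poly_Mapping.keys (g n)" for i j
      proof (rule X)
        have "Re s + of_int i \<ge> x" "Re t + of_int j \<ge> x"
          using weight_ge_support[OF f(1,5) cM0 mn(1)] weight_ge_support[OF g(1,5) cN0 mn(2)] that
          by (auto simp: in_keys_iff)
        then show "i \<ge> X" "j \<ge> X"
          using x by linarith+
      qed
      then have "graded_bilin k (f m) (g n) = 0"
        by (simp add: graded_bilin_def)
      then show ?thesis
        by (simp add: \<Phi>_def linear_mapD(4)[OF h(2)])
    qed
    then have "\<forall>\<^sub>F x in at_top. \<forall>m\<in>weight_ge M x. \<forall>n\<in>weight_ge N x. \<Phi> k m n = 0"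
      unfolding eventually_at_top_linorder by blast
    then show "\<Phi> k \<in> bilin_W0 M N P"
      using \<Phi>_in[OF k] by (simp add: bilin_W0_def)
  qed
  show thesis
  proof (rule that[of \<Phi>])
    show "\<pi> \<in> bilin_W M N P \<longleftrightarrow> (\<exists>k. equivariant cM cN cP k \<and> \<pi> = \<Phi> k)" for \<pi>
      using ex \<Phi>_in by blast
    show "\<Phi> (\<lambda>i j. k i j + l i j) = \<Phi> k + \<Phi> l" for k l
      by (simp add: \<Phi>_def fun_eq_iff graded_bilin_coeff_add linear_mapD[OF h(2)])
    show "\<Phi> (\<lambda>i j. a * k i j) = (\<lambda>m n. scale P a (\<Phi> k m n))" for a k
      by (simp add: \<Phi>_def fun_eq_iff graded_bilin_coeff_scale linear_mapD[OF h(2)])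
  qed (rule zero_iff)
qed

end

section \<open>The quotient by maps with zero germ\<close>

lemma coset_eq_iff:
  assumes W: "0 \<in> W" "\<And>v w. v \<in> W \<Longrightarrow> w \<in> W \<Longrightarrow> v + w \<in> W" "\<And>w. w \<in> W \<Longrightarrow> - w \<in> W"
  shows "coset W v = coset W w \<longleftrightarrow> v - w \<in> W"
proof
  assume "coset W v = coset W w"
  moreover have "v \<in> coset W v"
    using W(1) unfolding coset_def by force
  ultimately obtain u where "v = w + u" "u \<in> W"
    unfolding coset_def by blast
  then show "v - w \<in> W" by simp
next
  assume vw: "v - w \<in> W"
  have "v + u \<in> coset W w" if "u \<in> W" for u
    unfolding coset_def using W(2)[OF vw that] by (intro CollectI exI[of _ "v - w + u"]) simp
  moreover have "w + u \<in> coset W v" if "u \<in> W" for u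
    unfolding coset_def using W(2)[OF W(3)[OF vw] that]
    by (intro CollectI exI[of _ "- (v - w) + u"]) simp
  ultimately show "coset W v = coset W w"
    unfolding coset_def by blast
qed

lemma equivariant_add:
  "equivariant cM cN cP k \<Longrightarrow> equivariant cM cN cP l \<Longrightarrow> equivariant cM cN cP (\<lambda>i j. k i j + l i j)"
  by (simp add: equivariant_def algebra_simps)

lemma equivariant_scale:
  assumes "equivariant cM cN cP k" shows "equivariant cM cN cP (\<lambda>i j. a * k i j)"
  unfolding equivariant_def
proof (intro allI)
  fix m i j
  show "cP m (i + j) * (a * k i j) = cM m i * (a * k (i + m) j) + cN m j * (a * k i (j + m))"
    using arg_cong[OF equivariantD[OF assms, of m i j], of "\<lambda>x. a * x"] by (simp add: algebra_simps)
qed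

lemma equivariant_sum:
  fixes d :: nat
  assumes "\<And>l. l < d \<Longrightarrow> equivariant cM cN cP (b l)"
  shows "equivariant cM cN cP (\<lambda>i j. \<Sum>l<d. a l * b l i j)"
  using assms
proof (induction d)
  case (Suc d)
  then show ?case
    using equivariant_add[OF Suc.IH equivariant_scale[of cM cN cP "b d" "a d"]] by simp
qed (simp add: equivariant_def)

lemma germ_zero_add: "germ_zero k \<Longrightarrow> germ_zero l \<Longrightarrow> germ_zero (\<lambda>i j. k i j + l i j)"
proof -
  assume "germ_zero k" "germ_zero l"
  then obtain X Y where "\<forall>i\<ge>X. \<forall>j\<ge>X. k i j = 0" "\<forall>i\<ge>Y. \<forall>j\<ge>Y. l i j = 0"
    by (auto simp: germ_zero_def)
  then show ?thesis
    unfolding germ_zero_def by (intro exI[of _ "max X Y"]) auto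
qed

context graded_triple
begin

lemma subgroup_bilin_W0:
  assumes r: "r = s + t"
  shows "0 \<in> bilin_W0 M N P"
    "v \<in> bilin_W0 M N P \<Longrightarrow> w \<in> bilin_W0 M N P \<Longrightarrow> v + w \<in> bilin_W0 M N P"
    "w \<in> bilin_W0 M N P \<Longrightarrow> - w \<in> bilin_W0 M N P"
proof -
  obtain \<Phi> :: "(int \<Rightarrow> int \<Rightarrow> complex) \<Rightarrow> 'm \<Rightarrow> 'n \<Rightarrow> 'p" where
    V: "\<And>\<pi>. \<pi> \<in> bilin_W M N P \<longleftrightarrow> (\<exists>k. equivariant cM cN cP k \<and> \<pi> = \<Phi> k)" and
    W: "\<And>k. equivariant cM cN cP k \<Longrightarrow> \<Phi> k \<in> bilin_W0 M N P \<longleftrightarrow> germ_zero k" and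
    add: "\<And>k l. \<Phi> (\<lambda>i j. k i j + l i j) = \<Phi> k + \<Phi> l" and
    scale: "\<And>a k. \<Phi> (\<lambda>i j. a * k i j) = (\<lambda>m n. scale P a (\<Phi> k m n))"
    by (rule bilin_W_parametrization[OF r]) (rule that)
  have zero: "\<Phi> (\<lambda>_ _. 0) = 0"
    using add[of "\<lambda>_ _. 0" "\<lambda>_ _. 0"] by simp
  have uminus: "\<Phi> (\<lambda>i j. - k i j) = - \<Phi> k" for k
    using add[of k "\<lambda>i j. - k i j"] zero by (simp add: eq_neg_iff_add_eq_0 add.commute)
  have W': "\<exists>k. equivariant cM cN cP k \<and> germ_zero k \<and> \<pi> = \<Phi> k" if "\<pi> \<in> bilin_W0 M N P" for \<pi>
  proof -
    have "\<pi> \<in> bilin_W M N P" using that by (simp add: bilin_W0_def)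
    then show ?thesis using that W unfolding V by blast
  qed
  have "equivariant cM cN cP (\<lambda>_ _. 0)" "germ_zero (\<lambda>_ _. 0)"
    by (simp_all add: equivariant_def germ_zero_def)
  then show "0 \<in> bilin_W0 M N P"
    using W[of "\<lambda>_ _. 0"] by (simp add: zero)
  show "v + w \<in> bilin_W0 M N P" if vw: "v \<in> bilin_W0 M N P" "w \<in> bilin_W0 M N P"
  proof -
    obtain k l where kl: "equivariant cM cN cP k" "germ_zero k" "v = \<Phi> k"
      "equivariant cM cN cP l" "germ_zero l" "w = \<Phi> l"
      using W'[OF vw(1)] W'[OF vw(2)] by blast
    show ?thesis
      unfolding kl(3,6) add[symmetric]
      using W[OF equivariant_add[OF kl(1,4)]] germ_zero_add[OF kl(2,5)] by blast
  qed
  show "- w \<in> bilin_W0 M N P" if w: "w \<in> bilin_W0 M N P"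
  proof -
    obtain k where k: "equivariant cM cN cP k" "germ_zero k" "w = \<Phi> k"
      using W'[OF w] by blast
    have "germ_zero (\<lambda>i j. - k i j)" using k(2) by (simp add: germ_zero_def)
    moreover have "equivariant cM cN cP (\<lambda>i j. - k i j)"
      using equivariant_scale[OF k(1), of "- 1"] by simp
    ultimately show ?thesis
      unfolding k(3) uminus[symmetric] using W by blast
  qed
qed

lemma coset_bilin_W0_eq_iff:
  assumes "r = s + t"
  shows "coset (bilin_W0 M N P) v = coset (bilin_W0 M N P) w \<longleftrightarrow> v - w \<in> bilin_W0 M N P"
  by (rule coset_eq_iff) (fact subgroup_bilin_W0[OF assms])+

text \<open>Because \<open>\<Phi>\<close> is linear and matches \<open>germ_zero\<close> with the
  subspace to be divided out, a basis of the quotient amounts to arrays that span and are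
  independent modulo \<open>germ_zero\<close>.\<close>

lemma Bbar_has_dim_of_germs:
  assumes r: "r = s + t" and b: "\<And>l. l < d \<Longrightarrow> equivariant cM cN cP (b l)"
    and span: "\<And>k. equivariant cM cN cP k \<Longrightarrow> \<exists>a. germ_zero (\<lambda>i j. k i j - (\<Sum>l<d. a l * b l i j))"
    and indep: "\<And>a. germ_zero (\<lambda>i j. \<Sum>l<d. a l * b l i j) \<Longrightarrow> \<forall>l<d. a l = 0"
  shows "Bbar_has_dim M N P d"
proof -
  obtain \<Phi> :: "(int \<Rightarrow> int \<Rightarrow> complex) \<Rightarrow> 'm \<Rightarrow> 'n \<Rightarrow> 'p" where
    V: "\<And>\<pi>. \<pi> \<in> bilin_W M N P \<longleftrightarrow> (\<exists>k. equivariant cM cN cP k \<and> \<pi> = \<Phi> k)" and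
    W: "\<And>k. equivariant cM cN cP k \<Longrightarrow> \<Phi> k \<in> bilin_W0 M N P \<longleftrightarrow> germ_zero k" and
    add: "\<And>k l. \<Phi> (\<lambda>i j. k i j + l i j) = \<Phi> k + \<Phi> l" and
    scale: "\<And>a k. \<Phi> (\<lambda>i j. a * k i j) = (\<lambda>m n. scale P a (\<Phi> k m n))"
    by (rule bilin_W_parametrization[OF r]) (rule that)
  have zero: "\<Phi> (\<lambda>_ _. 0) = 0"
    using add[of "\<lambda>_ _. 0" "\<lambda>_ _. 0"] by simp
  have uminus: "\<Phi> (\<lambda>i j. - k i j) = - \<Phi> k" for k
    using add[of k "\<lambda>i j. - k i j"] zero by (simp add: eq_neg_iff_add_eq_0 add.commute)
  have eq_uminus: "equivariant cM cN cP (\<lambda>i j. - k i j)" if "equivariant cM cN cP k" for k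
    using equivariant_scale[OF that, of "- 1"] by simp
  have lin: "\<Phi> (\<lambda>i j. \<Sum>l<e. a l * b l i j) = (\<Sum>l<e. (\<lambda>m n. scale P (a l) (\<Phi> (b l) m n)))" for a e
    by (induction e) (simp_all add: zero add scale)
  have diff: "\<Phi> k - (\<Sum>l<d. (\<lambda>m n. scale P (a l) (\<Phi> (b l) m n))) =
      \<Phi> (\<lambda>i j. k i j - (\<Sum>l<d. a l * b l i j))" for k a
    using add[of k "\<lambda>i j. - (\<Sum>l<d. a l * b l i j)"] by (simp add: uminus lin)
  have eq_diff: "equivariant cM cN cP (\<lambda>i j. k i j - (\<Sum>l<d. a l * b l i j))"
    if "equivariant cM cN cP k" for k a
    using equivariant_add[OF that eq_uminus[OF equivariant_sum[OF b]]] by simp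
  show ?thesis
    unfolding Bbar_has_dim_def quotient_has_dim_def
  proof (intro exI[of _ "\<lambda>l. \<Phi> (b l)"] conjI allI impI ballI)
    show "\<Phi> (b l) \<in> bilin_W M N P" if "l < d" for l
      using V b[OF that] by blast
    fix q assume "q \<in> quotient_space (bilin_W M N P) (bilin_W0 M N P)"
    then obtain k where k: "equivariant cM cN cP k" and q: "q = coset (bilin_W0 M N P) (\<Phi> k)"
      unfolding quotient_space_def using V by auto
    have iff: "q = coset (bilin_W0 M N P) (\<Sum>l<d. (\<lambda>m n. scale P (a l) (\<Phi> (b l) m n))) \<longleftrightarrow>
        germ_zero (\<lambda>i j. k i j - (\<Sum>l<d. a l * b l i j))" for a
      unfolding q coset_bilin_W0_eq_iff[OF r] diff by (rule W[OF eq_diff[OF k]])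
    obtain a0 where a0: "germ_zero (\<lambda>i j. k i j - (\<Sum>l<d. a0 l * b l i j))"
      using span[OF k] by blast
    \<comment> \<open>Values from \<open>d\<close> on are reset to 0, as the uniqueness clause of
      \<open>quotient_has_dim\<close> demands.\<close>
    define a where "a l = (if l < d then a0 l else 0)" for l
    show "\<exists>!c. (\<forall>i\<ge>d. c i = 0) \<and>
        q = coset (bilin_W0 M N P) (\<Sum>l<d. (\<lambda>m n. scale P (c l) (\<Phi> (b l) m n)))"
      unfolding iff
    proof (rule ex1I[of _ a])
      show "(\<forall>i\<ge>d. a i = 0) \<and> germ_zero (\<lambda>i j. k i j - (\<Sum>l<d. a l * b l i j))"
        using a0 by (simp add: a_def)
      fix a' assume a': "(\<forall>i\<ge>d. a' i = 0) \<and> germ_zero (\<lambda>i j. k i j - (\<Sum>l<d. a' l * b l i j))"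
      then have "germ_zero (\<lambda>i j. - (k i j - (\<Sum>l<d. a' l * b l i j)))"
        unfolding germ_zero_def by (metis neg_equal_0_iff_equal)
      from germ_zero_add[OF a0 this]
      have "germ_zero (\<lambda>i j. \<Sum>l<d. (a' l - a0 l) * b l i j)"
        by (simp add: left_diff_distrib sum_subtractf)
      then have "\<forall>l<d. a' l - a0 l = 0"
        by (rule indep)
      then show "a' = a"
        using a' by (auto simp: a_def fun_eq_iff)
    qed
  qed
qed

lemma Bbar_trivial_of_germs:
  assumes r: "r = s + t" and zero: "\<And>k. equivariant cM cN cP k \<Longrightarrow> germ_zero k"
  shows "Bbar M N P = {bilin_W0 M N P}"
proof -
  obtain \<Phi> :: "(int \<Rightarrow> int \<Rightarrow> complex) \<Rightarrow> 'm \<Rightarrow> 'n \<Rightarrow> 'p" where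
    V: "\<And>\<pi>. \<pi> \<in> bilin_W M N P \<longleftrightarrow> (\<exists>k. equivariant cM cN cP k \<and> \<pi> = \<Phi> k)" and
    W: "\<And>k. equivariant cM cN cP k \<Longrightarrow> \<Phi> k \<in> bilin_W0 M N P \<longleftrightarrow> germ_zero k"
    by (rule bilin_W_parametrization[OF r]) (rule that)
  have "\<pi> \<in> bilin_W0 M N P" if "\<pi> \<in> bilin_W M N P" for \<pi>
    using that zero unfolding V using W by blast
  moreover have "coset (bilin_W0 M N P) \<pi> = bilin_W0 M N P" if "\<pi> \<in> bilin_W0 M N P" for \<pi>
    using coset_bilin_W0_eq_iff[OF r, of \<pi> 0] that by (simp add: coset_def)
  moreover have "0 \<in> bilin_W M N P"
    using subgroup_bilin_W0(1)[OF r] by (simp add: bilin_W0_def)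
  ultimately show ?thesis
    unfolding Bbar_def quotient_space_def by force
qed

lemma Bbar_trivial_of_weights:
  assumes "s + t - r \<notin> \<int>"
  shows "Bbar M N P = {bilin_W0 M N P}"
proof -
  obtain f where f: "Vector_Spaces.linear (scale M) pm_scale f"
    using isoM by (auto simp: witt_iso_def)
  obtain g where g: "Vector_Spaces.linear (scale N) pm_scale g"
    using isoN by (auto simp: witt_iso_def)
  obtain h H where h: "Vector_Spaces.linear (scale P) pm_scale h" "Vector_Spaces.linear pm_scale (scale P) H"
      "\<And>v. H (h v) = v" "\<And>p. h (H p) = p" "\<And>x v. h (act P x v) = graded_bilin cP x (h v)"
      "\<And>x p. H (graded_bilin cP x p) = act P x (H p)"
    by (rule witt_iso_gradedE[OF isoP]) (rule that)
  interpret vsP: vector_space "scale P"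
    using h(1) by (simp add: Vector_Spaces.linear_iff)
  have "act P x 0 = 0" for x
    using h(6)[of x 0] by (simp add: linear_mapD(4)[OF h(2)])
  then have "(\<lambda>_ _. 0) \<in> bilin_W M N P"
    using f g h(1) by (simp add: bilin_W_def Vector_Spaces.linear_iff)
  moreover from this have "(\<lambda>_ _. 0) \<in> bilin_W0 M N P"
    by (simp add: bilin_W0_def)
  moreover have "\<pi> = (\<lambda>_ _. 0)" if "\<pi> \<in> bilin_W M N P" for \<pi>
    using bilin_W_trivial[OF assms that] .
  moreover have "bilin_W0 M N P \<subseteq> bilin_W M N P"
    by (auto simp: bilin_W0_def)
  ultimately have "bilin_W M N P = {\<lambda>_ _. 0}" "bilin_W0 M N P = {\<lambda>_ _. 0}"
    by blast+
  then show ?thesis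
    by (simp add: Bbar_def quotient_space_def coset_def plus_fun_def)
qed

end

section \<open>Germs of equivariant bilinear maps\<close>

text \<open>The target is compared with Omega^1 while the factors are compared with Omega^0: in this
  mixed normalization g df and f dg have coefficients linear in the weights.\<close>

definition form1 :: "complex \<Rightarrow> (int \<Rightarrow> int \<Rightarrow> complex) \<Rightarrow> bool" where
  "form1 r c \<longleftrightarrow>
     (\<forall>m n. r + of_int n \<noteq> 0 \<longrightarrow> r + of_int (n + m) \<noteq> 0 \<longrightarrow> c m n = r + of_int (n + m))"

lemma form1D:
  "form1 r c \<Longrightarrow> r + of_int n \<noteq> 0 \<Longrightarrow> r + of_int (n + m) \<noteq> 0 \<Longrightarrow> c m n = r + of_int (n + m)"
  by (simp add: form1_def)

lemma Re_pos_nz: "Re z > 0 \<Longrightarrow> z \<noteq> 0"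
  by auto

lemma second_difference_zero_affine:
  fixes f :: "nat \<Rightarrow> complex"
  assumes "\<And>n. f n - 2 * f (n + 1) + f (n + 2) = 0"
  shows "f n = f 0 + of_nat n * (f 1 - f 0)"
proof -
  have step: "f (Suc n) - f n = f 1 - f 0" for n
  proof (induction n)
    case (Suc n)
    have "f n - 2 * f (Suc n) + f (Suc (Suc n)) = 0"
      using assms[of n] by simp
    then show ?case using Suc by algebra
  qed simp
  show ?thesis
  proof (induction n)
    case (Suc n)
    have "f (Suc n) = f n + (f 1 - f 0)" using step[of n] by (simp add: algebra_simps)
    then show ?case using Suc by (simp add: algebra_simps)
  qed simp
qed

locale equivariant_forms =
  fixes s t :: complex and cM cN cP k :: "int \<Rightarrow> int \<Rightarrow> complex"
  assumes fM: "form0 s cM" and fN: "form0 t cN" and fP: "form1 (s + t) cP"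
    and k: "equivariant cM cN cP k"
begin

lemma swapped: "equivariant_forms t s cN cM cP (\<lambda>i j. k j i)"
  using fM fN fP equivariant_swap[OF k] by unfold_locales (simp_all add: add.commute)

lemma recursion:
  assumes "s + of_int i \<noteq> 0" "s + of_int (i + m) \<noteq> 0" "t + of_int j \<noteq> 0" "t + of_int (j + m) \<noteq> 0"
    "s + t + of_int (i + j) \<noteq> 0" "s + t + of_int (i + j + m) \<noteq> 0"
  shows "(s + t + of_int (i + j + m)) * k i j =
    (s + of_int i) * k (i + m) j + (t + of_int j) * k i (j + m)"
  using equivariantD[OF k, of m i j] form0D[OF fM assms(1,2)] form0D[OF fN assms(3,4)]
    form1D[OF fP assms(5,6)] by simp

lemma recursion_quadrant:
  assumes "Re s + of_int X > 0" "Re t + of_int X > 0" "i \<ge> X" "j \<ge> X" "m \<ge> 0"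
  shows "(s + t + of_int (i + j + m)) * k i j =
    (s + of_int i) * k (i + m) j + (t + of_int j) * k i (j + m)"
proof -
  have "real_of_int i \<ge> of_int X" "real_of_int j \<ge> of_int X" "real_of_int m \<ge> 0"
    using assms(3-5) by simp_all
  then show ?thesis
    using assms(1,2) by (intro recursion Re_pos_nz) simp_all
qed

text \<open>L_1 at three places and L_2 at one give four linear equations. Eliminating the three
  values with shifted second index leaves a relation within one row, multiplied by
  \<open>x * (x + y + 2)\<close>, which is nonzero in the quadrant.\<close>

lemma second_difference:
  assumes X: "Re s + of_int X > 0" "Re t + of_int X > 0" "i \<ge> X" "j \<ge> X"
  shows "k i j - 2 * k (i + 1) j + k (i + 2) j = 0"
proof -
  define x y where "x = s + of_int i" and "y = t + of_int j"
  have r: "real_of_int i \<ge> of_int X" "real_of_int j \<ge> of_int X"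
    using assms(3,4) by simp_all
  have nz: "x \<noteq> 0" "x + y + 2 \<noteq> 0"
    using X r by (intro Re_pos_nz; simp add: x_def y_def)+
  have "(x + y + 1) * k i j = x * k (i + 1) j + y * k i (j + 1)"
    "(x + y + 2) * k (i + 1) j = (x + 1) * k (i + 2) j + y * k (i + 1) (j + 1)"
    "(x + y + 2) * k i (j + 1) = x * k (i + 1) (j + 1) + (y + 1) * k i (j + 2)"
    "(x + y + 2) * k i j = x * k (i + 2) j + y * k i (j + 2)"
    using recursion_quadrant[OF X(1,2), of i j 1] recursion_quadrant[OF X(1,2), of "i + 1" j 1]
      recursion_quadrant[OF X(1,2), of i "j + 1" 1] recursion_quadrant[OF X(1,2), of i j 2] X(3,4)
    by (simp_all add: x_def y_def algebra_simps)
  then have "x * (x + y + 2) * (k i j - 2 * k (i + 1) j + k (i + 2) j) = 0"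
    by algebra
  then show ?thesis using nz by simp
qed

text \<open>Vanishing second differences in both directions make \<open>k\<close> affine in each
  index, hence of the form A + B x + C y + E x y. The equation for L_1 then removes \<open>A\<close>
  and \<open>E\<close>.\<close>

lemma germ_quadrant:
  assumes X: "Re s + of_int X > 0" "Re t + of_int X > 0"
  obtains \<alpha> \<beta> where "\<And>i j. i \<ge> X \<Longrightarrow> j \<ge> X \<Longrightarrow> k i j = \<alpha> * (s + of_int i) + \<beta> * (t + of_int j)"
proof -
  interpret sw: equivariant_forms t s cN cM cP "\<lambda>i j. k j i"
    by (rule swapped)
  define K where "K a b = k (X + int a) (X + int b)" for a b
  have K1: "K a b = K 0 b + of_nat a * (K 1 b - K 0 b)" for a b
    by (rule second_difference_zero_affine)
      (use second_difference[OF X, of "X + int n" "X + int b" for n] in \<open>simp add: K_def add_ac\<close>)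
  have K2: "K a b = K a 0 + of_nat b * (K a 1 - K a 0)" for a b
    by (rule second_difference_zero_affine)
      (use sw.second_difference[OF X(2,1), of "X + int n" "X + int a" for n] in \<open>simp add: K_def add_ac\<close>)
  define x0 y0 where "x0 = s + of_int X" and "y0 = t + of_int X"
  \<comment> \<open>The coefficients interpolate \<open>K\<close> at the four corners
    \<open>(0, 0)\<close>, \<open>(1, 0)\<close>, \<open>(0, 1)\<close>, \<open>(1, 1)\<close>;
    \<open>E\<close> is the mixed difference.\<close>
  define E where "E = K 1 1 - K 1 0 - K 0 1 + K 0 0"
  define B where "B = K 1 0 - K 0 0 - E * y0"
  define C where "C = K 0 1 - K 0 0 - E * x0"
  define A where "A = K 0 0 - B * x0 - C * y0 - E * x0 * y0"
  have form: "k i j = A + B * (s + of_int i) + C * (t + of_int j) + E * (s + of_int i) * (t + of_int j)"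
    if ij: "i \<ge> X" "j \<ge> X" for i j
  proof -
    define a b where "a = nat (i - X)" and "b = nat (j - X)"
    have i: "i = X + int a" and j: "j = X + int b" using ij by (simp_all add: a_def b_def)
    have "K a b = K 0 0 + of_nat b * (K 0 1 - K 0 0) +
        of_nat a * (K 1 0 + of_nat b * (K 1 1 - K 1 0) - (K 0 0 + of_nat b * (K 0 1 - K 0 0)))"
      using K1[of a b] K2[of 0 b] K2[of 1 b] by simp
    also have "\<dots> = A + B * (x0 + of_nat a) + C * (y0 + of_nat b) + E * (x0 + of_nat a) * (y0 + of_nat b)"
      by (simp add: A_def B_def C_def E_def algebra_simps)
    finally show ?thesis
      by (simp add: K_def i j x0_def y0_def add_ac)
  qed
  \<comment> \<open>The terms in \<open>B\<close> and \<open>C\<close> already solve the L_1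
    equation; what the other two contribute is A - E x y. Varying x by 1 forces
    \<open>E = 0\<close>, then \<open>A = 0\<close>.\<close>
  have AE: "A - E * (s + of_int i) * (t + of_int j) = 0" if ij: "i \<ge> X" "j \<ge> X" for i j
  proof -
    define x y where "x = s + of_int i" and "y = t + of_int j"
    have "(x + y + 1) * k i j = x * k (i + 1) j + y * k i (j + 1)"
      using recursion_quadrant[OF X ij, of 1] by (simp add: x_def y_def algebra_simps)
    moreover have "k i j = A + B * x + C * y + E * x * y"
      "k (i + 1) j = A + B * (x + 1) + C * y + E * (x + 1) * y"
      "k i (j + 1) = A + B * x + C * (y + 1) + E * x * (y + 1)"
      using form[of i j] form[of "i + 1" j] form[of i "j + 1"] ij by (simp_all add: x_def y_def add_ac)
    ultimately have "A - E * x * y = 0"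
      by algebra
    then show ?thesis by (simp add: x_def y_def)
  qed
  have "E * (t + of_int X) = 0"
    using AE[of X X] AE[of "X + 1" X] by (simp add: algebra_simps) algebra
  moreover have "t + of_int X \<noteq> 0"
    using X by (intro Re_pos_nz) simp
  ultimately have "E = 0" by simp
  moreover from this have "A = 0" using AE[of X X] by simp
  ultimately show thesis
    using that[of B C] form by simp
qed

text \<open>With \<open>i\<close> arbitrary, \<open>k i (j + m)\<close> is as unknown as
  \<open>k i j\<close>, so one equation is not enough. Shifting by m from j, by m from j + m and by
  2m from j gives three homogeneous equations for the errors \<open>D 0\<close>, \<open>D m\<close>,
  \<open>D (m + m)\<close>, which force \<open>D 0 = 0\<close> because x is nonzero. The bound on
  \<open>i + j\<close> keeps the total weight away from 0.\<close>

lemma germ_extend_left: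
  assumes X: "Re s + of_int X > 0" "Re t + of_int X > 0"
    and form: "\<And>i j. i \<ge> X \<Longrightarrow> j \<ge> X \<Longrightarrow> k i j = \<alpha> * (s + of_int i) + \<beta> * (t + of_int j)"
    and i: "s + of_int i \<noteq> 0" and j: "j \<ge> X" "i + j \<ge> 2 * X"
  shows "k i j = \<alpha> * (s + of_int i) + \<beta> * (t + of_int j)"
proof -
  define m where "m = \<bar>X - i\<bar> + 1"
  define x y where "x = s + of_int i" and "y = t + of_int j"
  have m: "m \<ge> 0" "i + m \<ge> X" unfolding m_def by linarith+
  have rec: "(s + t + of_int (i + j' + m')) * k i j' =
    (s + of_int i) * k (i + m') j' + (t + of_int j') * k i (j' + m')"
    if "j' \<ge> j" "m' \<ge> m" for j' m'
  proof (rule recursion)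
    have "real_of_int (i + j') \<ge> of_int (2 * X)" "real_of_int j' \<ge> of_int X" "real_of_int m' \<ge> 0"
      "real_of_int (i + m') \<ge> of_int X"
      using that j m by (simp_all only: of_int_le_iff of_int_0_le_iff)
    then show "s + of_int (i + m') \<noteq> 0" "t + of_int j' \<noteq> 0" "t + of_int (j' + m') \<noteq> 0"
      "s + t + of_int (i + j') \<noteq> 0" "s + t + of_int (i + j' + m') \<noteq> 0"
      using X by (intro Re_pos_nz; simp)+
  qed (rule i)
  define D where "D n = k i (j + n) - (\<alpha> * x + \<beta> * (y + of_int n))" for n
  have "(x + y + of_int m) * D 0 = y * D m"
    using rec[of j m] form[of "i + m" j] m j(1)
    by (simp add: D_def x_def y_def algebra_simps)
  moreover have "(x + y + of_int m + of_int m) * D m = (y + of_int m) * D (m + m)"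
    using rec[of "j + m" m] form[of "i + m" "j + m"] m j(1)
    by (simp add: D_def x_def y_def algebra_simps)
  moreover have "(x + y + of_int m + of_int m) * D 0 = y * D (m + m)"
    using rec[of j "m + m"] form[of "i + (m + m)" j] m j(1)
    by (simp add: D_def x_def y_def algebra_simps)
  ultimately have "(x + y + of_int m + of_int m) * (x * D 0) = 0"
    by algebra
  moreover have "x + y + of_int m + of_int m \<noteq> 0"
  proof -
    have "real_of_int (i + j) \<ge> of_int (2 * X)" "real_of_int m \<ge> 0"
      using j m by (simp_all only: of_int_le_iff of_int_0_le_iff)
    then show ?thesis
      using X by (intro Re_pos_nz) (simp add: x_def y_def)
  qed
  ultimately have "D 0 = 0" using i by (simp add: x_def)
  then show ?thesis by (simp add: D_def x_def y_def)
qed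

text \<open>
  Away from the weight $0$ of the three modules, an equivariant map is a combination of
  $(f, g) \mapsto g\,df$ and $(f, g) \mapsto f\,dg$.
\<close>

lemma germ_form:
  obtains \<alpha> \<beta> where "\<And>i j. s + of_int i \<noteq> 0 \<Longrightarrow> t + of_int j \<noteq> 0 \<Longrightarrow> s + t + of_int (i + j) \<noteq> 0 \<Longrightarrow>
    k i j = \<alpha> * (s + of_int i) + \<beta> * (t + of_int j)"
proof -
  interpret sw: equivariant_forms t s cN cM cP "\<lambda>i j. k j i"
    by (rule swapped)
  define X where "X = \<lceil>\<bar>Re s\<bar> + \<bar>Re t\<bar> + 1\<rceil>"
  have X: "Re s + of_int X > 0" "Re t + of_int X > 0"
    unfolding X_def by linarith+
  obtain \<alpha> \<beta> where form: "\<And>i j. i \<ge> X \<Longrightarrow> j \<ge> X \<Longrightarrow> k i j = \<alpha> * (s + of_int i) + \<beta> * (t + of_int j)"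
    by (rule germ_quadrant[OF X]) (rule that)
  have left: "k i j = \<alpha> * (s + of_int i) + \<beta> * (t + of_int j)"
    if "s + of_int i \<noteq> 0" "j \<ge> X" "i + j \<ge> 2 * X" for i j
    by (rule germ_extend_left[OF X form that])
  have right: "k i j = \<alpha> * (s + of_int i) + \<beta> * (t + of_int j)"
    if "t + of_int j \<noteq> 0" "i \<ge> X" "i + j \<ge> 2 * X" for i j
  proof -
    have "k i j = \<beta> * (t + of_int j) + \<alpha> * (s + of_int i)"
      by (rule sw.germ_extend_left[OF X(2,1), where \<alpha> = \<beta> and \<beta> = \<alpha>]) (use form that in auto)
    then show ?thesis by (simp add: add.commute)
  qed
  have "k i j = \<alpha> * (s + of_int i) + \<beta> * (t + of_int j)"
    if nz: "s + of_int i \<noteq> 0" "t + of_int j \<noteq> 0" "s + t + of_int (i + j) \<noteq> 0" for i j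
  proof -
    \<comment> \<open>So large that one application of L_m brings both terms on the right into the
      regions covered by \<open>right\<close> and \<open>left\<close>.\<close>
    define m where "m = 2 * \<bar>X\<bar> + \<bar>i\<bar> + \<bar>j\<bar>"
    define x y where "x = s + of_int i" and "y = t + of_int j"
    have m: "i + m \<ge> X" "j + m \<ge> X" "i + j + m \<ge> 2 * X"
      unfolding m_def by linarith+
    then have r: "real_of_int (i + m) \<ge> of_int X" "real_of_int (j + m) \<ge> of_int X"
      "real_of_int (i + j + m) \<ge> of_int (2 * X)"
      by (simp_all only: of_int_le_iff)
    have nzm: "s + of_int (i + m) \<noteq> 0" "t + of_int (j + m) \<noteq> 0" "s + t + of_int (i + j + m) \<noteq> 0"
      using X r by (intro Re_pos_nz; simp)+
    have "(x + y + of_int m) * k i j = x * k (i + m) j + y * k i (j + m)"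
      using recursion[OF nz(1) nzm(1) nz(2) nzm(2) nz(3) nzm(3)]
      by (simp add: x_def y_def algebra_simps)
    moreover have "k (i + m) j = \<alpha> * (x + of_int m) + \<beta> * y"
      using right[OF nz(2) m(1)] m(3) by (simp add: x_def y_def algebra_simps)
    moreover have "k i (j + m) = \<alpha> * x + \<beta> * (y + of_int m)"
      using left[OF nz(1) m(2)] m(3) by (simp add: x_def y_def algebra_simps)
    ultimately have "(x + y + of_int m) * (k i j - (\<alpha> * x + \<beta> * y)) = 0"
      by algebra
    moreover have "x + y + of_int m \<noteq> 0"
      using nzm(3) by (simp add: x_def y_def algebra_simps)
    ultimately show ?thesis by (simp add: x_def y_def)
  qed
  then show thesis using that by blast
qed

end

text \<open>
  Coefficients of $A_{a,b}$ and $B_{a,b}$ in bases rescaled so that, away from weight $0$, they are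
  those of $\Omega^0_0$ (suffix \<open>0\<close>) or of $\Omega^1_0$ (suffix \<open>1\<close>).
\<close>

definition coeffs_A0 :: "complex \<Rightarrow> complex \<Rightarrow> int \<Rightarrow> int \<Rightarrow> complex" where
  "coeffs_A0 a b m n =
     (if n = 0 then if m = 0 then 0 else a * of_int m + b else if n + m = 0 then 0 else of_int n)"

definition coeffs_A1 :: "complex \<Rightarrow> complex \<Rightarrow> int \<Rightarrow> int \<Rightarrow> complex" where
  "coeffs_A1 a b m n = (if n \<noteq> 0 then of_int (m + n) else a * of_int m ^ 2 + b * of_int m)"

definition coeffs_B0 :: "complex \<Rightarrow> complex \<Rightarrow> int \<Rightarrow> int \<Rightarrow> complex" where
  "coeffs_B0 a b m n = (if m + n \<noteq> 0 then of_int n else a * of_int m ^ 2 + b * of_int m)"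

definition coeffs_B1 :: "complex \<Rightarrow> complex \<Rightarrow> int \<Rightarrow> int \<Rightarrow> complex" where
  "coeffs_B1 a b m n =
     (if n = 0 then 0 else if n + m = 0 then - (a * of_int m + b) else of_int (n + m))"

lemma A_mod_eq_A1: "A_mod (a, b) = graded_module (coeffs_A1 a b)"
  unfolding A_mod_eq_graded coeffs_A1_def[abs_def] ..

lemma B_mod_eq_B0: "B_mod (a, b) = graded_module (coeffs_B0 a b)"
  unfolding B_mod_eq_graded coeffs_B0_def[abs_def] ..

lemma of_int_sum_nz: "m + n \<noteq> 0 \<Longrightarrow> of_int m + of_int n \<noteq> (0::complex)"
  by (metis of_int_add of_int_eq_0_iff)

lemma A_mod_iso_A0: "A_mod (a, b) \<cong>\<^sub>W graded_module (coeffs_A0 a b)"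
  unfolding A_mod_eq_A1
  by (rule graded_module_iso_gauge[where g = "\<lambda>n. if n = 0 then 1 else of_int n"])
    (auto simp: coeffs_A0_def coeffs_A1_def power2_eq_square algebra_simps add_eq_0_iff)

lemma B_mod_iso_B1: "B_mod (a, b) \<cong>\<^sub>W graded_module (coeffs_B1 a b)"
  unfolding B_mod_eq_B0
proof (rule graded_module_iso_gauge[where g = "\<lambda>n. if n = 0 then 1 else 1 / of_int n"])
  show "(if n = 0 then 1 else 1 / of_int n) * coeffs_B0 a b m n =
      coeffs_B1 a b m n * (if n + m = 0 then 1 else 1 / of_int (n + m))" for m n
  proof (cases "n \<noteq> 0 \<and> n + m = 0")
    case True
    then have "m \<noteq> 0" "n = - m" by auto
    then show ?thesis
      by (simp add: coeffs_B0_def coeffs_B1_def field_simps power2_eq_square)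
  qed (use of_int_sum_nz[of n m] in \<open>auto simp: coeffs_B0_def coeffs_B1_def add.commute[of m]\<close>)
qed simp

lemma form0_Omega: "form0 s (\<lambda>m n. of_int m * 0 + (s + of_int n))"
  by (simp add: form0_def)

lemma form1_Omega: "form1 s (\<lambda>m n. of_int m * 1 + (s + of_int n))"
  by (simp add: form1_def)

lemma form0_A0: "form0 0 (coeffs_A0 a b)"
  by (simp add: form0_def coeffs_A0_def del: of_int_add)

lemma form0_B0: "form0 0 (coeffs_B0 a b)"
  by (simp add: form0_def coeffs_B0_def add.commute del: of_int_add)

lemma form1_A1: "form1 0 (coeffs_A1 a b)"
  by (simp add: form1_def coeffs_A1_def add.commute del: of_int_add)

lemma form1_B1: "form1 0 (coeffs_B1 a b)"
  by (simp add: form1_def coeffs_B1_def del: of_int_add)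

lemma coeffs_weight:
  "coeffs_A0 a b 0 n = 0 + of_int n" "coeffs_A1 a b 0 n = 0 + of_int n"
  "coeffs_B0 a b 0 n = 0 + of_int n" "coeffs_B1 a b 0 n = 0 + of_int n"
  by (simp_all add: coeffs_A0_def coeffs_A1_def coeffs_B0_def coeffs_B1_def)

section \<open>Constraints on the germ coming from weight 0\<close>

locale equivariant_germ = equivariant_forms +
  fixes \<alpha> \<beta> :: complex
  assumes germ: "\<And>i j. s + of_int i \<noteq> 0 \<Longrightarrow> t + of_int j \<noteq> 0 \<Longrightarrow> s + t + of_int (i + j) \<noteq> 0 \<Longrightarrow>
    k i j = \<alpha> * (s + of_int i) + \<beta> * (t + of_int j)"
begin

lemma swapped_germ: "equivariant_germ t s cN cM cP (\<lambda>i j. k j i) \<beta> \<alpha>"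
  using fM fN fP equivariant_swap[OF k] germ by unfold_locales (simp_all add: add.commute)

lemma germ_zero_diff: "germ_zero (\<lambda>i j. k i j - (\<alpha> * (s + of_int i) + \<beta> * (t + of_int j)))"
proof -
  define X where "X = \<lceil>\<bar>Re s\<bar> + \<bar>Re t\<bar> + 1\<rceil>"
  have "k i j = \<alpha> * (s + of_int i) + \<beta> * (t + of_int j)" if "i \<ge> X" "j \<ge> X" for i j
  proof -
    have "Re s + of_int i > 0" "Re t + of_int j > 0"
      using that unfolding X_def by linarith+
    then show ?thesis
      by (intro germ Re_pos_nz) simp_all
  qed
  then show ?thesis by (auto simp: germ_zero_def)
qed

text \<open>Arrows leave weight 0 with coefficient \<open>a * m + b\<close>, while the values
  \<open>k 0 j\<close> lie outside the range of the germ. The equations at \<open>(0, j)\<close>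
  overdetermine these values, and their compatibility restricts the germ.\<close>

lemma constraint_A:
  assumes s: "s = 0" and cM: "cM = coeffs_A0 a b"
  shows "b * \<beta> = 0" "a * \<alpha> = 0" "a * \<beta> = 0"
proof -
  define J where "J = \<lceil>\<bar>Re t\<bar> + 1\<rceil>"
  have step: "(t + of_int j + of_int m) * k 0 j =
      (a * of_int m + b) * (\<alpha> * of_int m + \<beta> * (t + of_int j)) + (t + of_int j) * k 0 (j + m)"
    if "j \<ge> J" "m > 0" for j m
  proof -
    have r: "Re t + of_int j > 0" "real_of_int m > 0"
      using that unfolding J_def by simp_all linarith
    then have nz: "t + of_int j \<noteq> 0" "t + of_int (j + m) \<noteq> 0" "t + of_int (m + j) \<noteq> 0"
      by (intro Re_pos_nz; simp)+
    have "k m j = \<alpha> * of_int m + \<beta> * (t + of_int j)"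
      using germ[of m j] nz that s by simp
    moreover have "cP m j = t + of_int (j + m)"
      using form1D[OF fP] nz s by simp
    moreover have "cM m 0 = a * of_int m + b"
      using that by (simp add: cM coeffs_A0_def)
    ultimately show ?thesis
      using equivariantD[OF k, of m 0 j] form0D[OF fN nz(1,2)] by (simp add: add.assoc)
  qed
  \<comment> \<open>Shifts by 1 from j, by 1 from j + 1 and by 2 from j involve just
    \<open>k 0 j\<close>, \<open>k 0 (j + 1)\<close>, \<open>k 0 (j + 2)\<close>, and their
    homogeneous parts are dependent. The relation among the remaining terms, divided by y, is this
    identity.\<close>
  have quad: "a * (\<beta> * y - \<alpha> * (2 + 2 * y)) + b * \<beta> * y * (y + 2) = 0"
    if y: "y = t + of_int j" and j: "j \<ge> J" for y j
  proof -
    have "(y + 1) * k 0 j = (a + b) * (\<alpha> + \<beta> * y) + y * k 0 (j + 1)"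
      "(y + 2) * k 0 (j + 1) = (a + b) * (\<alpha> + \<beta> * (y + 1)) + (y + 1) * k 0 (j + 2)"
      "(y + 2) * k 0 j = (a * 2 + b) * (\<alpha> * 2 + \<beta> * y) + y * k 0 (j + 2)"
      using step[of j 1] step[of "j + 1" 1] step[of j 2] j by (simp_all add: y add_ac)
    moreover have "y \<noteq> 0"
      using j unfolding y J_def by (intro Re_pos_nz) (simp, linarith)
    ultimately show ?thesis by algebra
  qed
  \<comment> \<open>Three consecutive values determine a quadratic in y: the second difference is
    \<open>2 * (b * \<beta>)\<close>, and without it an affine function remains whose constant term
    is \<open>- 2 * (a * \<alpha>)\<close>.\<close>
  define y where "y = t + of_int J"
  have "a * (\<beta> * y - \<alpha> * (2 + 2 * y)) + b * \<beta> * y * (y + 2) = 0"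
    "a * (\<beta> * (y + 1) - \<alpha> * (2 + 2 * (y + 1))) + b * \<beta> * (y + 1) * (y + 1 + 2) = 0"
    "a * (\<beta> * (y + 2) - \<alpha> * (2 + 2 * (y + 2))) + b * \<beta> * (y + 2) * (y + 2 + 2) = 0"
    by (rule quad[of _ J] quad[of _ "J + 1"] quad[of _ "J + 2"]; simp add: y_def)+
  note q = this
  have "2 * (b * \<beta>) = 0" using q by algebra
  then show b: "b * \<beta> = 0" by simp
  have "2 * (a * \<alpha>) = 0" using q b by algebra
  then show a: "a * \<alpha> = 0" by simp
  show "a * \<beta> = 0" using q a b by algebra
qed

text \<open>Moving the first factor into weight 0 by L_{-1} and L_{-2} gives y \<beta> = (a n - b)
  \<open>k 0 j\<close> for n = 1 and n = 2. With \<open>a\<close> nonzero, subtraction kills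
  \<open>k 0 j\<close>, and then \<beta>.\<close>

lemma constraint_B:
  assumes s: "s = 0" and cM: "cM = coeffs_B0 a b" and "a \<noteq> 0"
  shows "\<beta> = 0"
proof -
  define j where "j = \<lceil>\<bar>Re t\<bar> + 3\<rceil>"
  have j: "Re t + of_int j > 2"
    unfolding j_def by linarith
  have step: "(t + of_int j) * \<beta> * of_int n = (a * of_int n ^ 2 - b * of_int n) * k 0 j"
    if "n = 1 \<or> n = 2" for n
  proof -
    have nz: "t + of_int j \<noteq> 0" "t + of_int (j + - n) \<noteq> 0" "t + of_int (n + j) \<noteq> 0"
      "t + of_int (n + j + - n) \<noteq> 0"
      using that j by (intro Re_pos_nz; auto)+
    have "n \<noteq> 0" using that by auto
    have v: "k n j = \<alpha> * of_int n + \<beta> * (t + of_int j)"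
      "k n (j + - n) = \<alpha> * of_int n + \<beta> * (t + of_int j - of_int n)"
      using germ[of n j] germ[of n "j + - n"] nz \<open>n \<noteq> 0\<close> s by (simp_all add: add_diff_eq)
    have cP: "cP (- n) (n + j) = t + of_int j"
      using form1D[OF fP, of "n + j" "- n"] nz s by simp
    have cMn: "cM (- n) n = a * of_int n ^ 2 - b * of_int n"
      by (simp add: cM coeffs_B0_def)
    have "(t + of_int j) * (\<alpha> * of_int n + \<beta> * (t + of_int j)) =
        (a * of_int n ^ 2 - b * of_int n) * k 0 j +
        (t + of_int j) * (\<alpha> * of_int n + \<beta> * (t + of_int j - of_int n))"
      using equivariantD[OF k, of "- n" n j]
      by (simp only: v cP cMn form0D[OF fN nz(1,2)] add.right_inverse)
    then show ?thesis by (simp add: algebra_simps)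
  qed
  define y where "y = t + of_int j"
  have "y * \<beta> = (a - b) * k 0 j" "y * \<beta> * 2 = (a * 4 - b * 2) * k 0 j"
    using step[of 1] step[of 2] by (simp_all add: y_def)
  then have "2 * a * (y * \<beta>) = 0" by algebra
  moreover have "y \<noteq> 0"
    using j unfolding y_def by (intro Re_pos_nz) simp
  ultimately show ?thesis using \<open>a \<noteq> 0\<close> by simp
qed

text \<open>The value \<open>k i (- i)\<close> lands in weight 0 of the target and is not governed
  by the germ, but L_m moves it to two values that are. The lower bound on \<open>i\<close> keeps
  all weights involved nonzero.\<close>

lemma at_weight_0:
  assumes st: "s + t = 0" and m: "m > 0" and i: "Re s + of_int i > of_int m"
  shows "cP m 0 * k i (- i) = (s + of_int i) * of_int m * (\<alpha> - \<beta>)"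
proof -
  have t: "t = - s" using st by (simp add: eq_neg_iff_add_eq_0 add.commute)
  have m': "real_of_int m > 0" using m by simp
  have nz: "s + of_int i \<noteq> 0" "s + of_int (i + m) \<noteq> 0" "s + of_int i - of_int m \<noteq> 0"
    using i m' by (intro Re_pos_nz; simp)+
  have nz': "t + of_int (- i) \<noteq> 0" "t + of_int (- i + m) \<noteq> 0"
  proof -
    have "t + of_int (- i) = - (s + of_int i)" "t + of_int (- i + m) = - (s + of_int i - of_int m)"
      by (simp_all add: t)
    then show "t + of_int (- i) \<noteq> 0" "t + of_int (- i + m) \<noteq> 0"
      using nz(1,3) by (simp_all only: neg_equal_0_iff_equal not_False_eq_True)
  qed
  have v: "k (i + m) (- i) = \<alpha> * (s + of_int i + of_int m) - \<beta> * (s + of_int i)"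
    "k i (- i + m) = \<alpha> * (s + of_int i) - \<beta> * (s + of_int i - of_int m)"
    using germ[of "i + m" "- i"] germ[of i "- i + m"] nz nz' m by (simp_all add: t algebra_simps)
  have c: "cM m i = s + of_int i" "cN m (- i) = - (s + of_int i)"
    using form0D[OF fM nz(1,2)] form0D[OF fN nz'] by (simp_all add: t)
  have "cP m 0 * k i (- i) =
      (s + of_int i) * (\<alpha> * (s + of_int i + of_int m) - \<beta> * (s + of_int i)) +
      - (s + of_int i) * (\<alpha> * (s + of_int i) - \<beta> * (s + of_int i - of_int m))"
    using equivariantD[OF k, of m i "- i"] by (simp only: v c add.right_inverse)
  then show ?thesis by (simp add: algebra_simps)
qed

text \<open>For m = 1 and m = 2 the previous identity reads (a m + b) \<open>k i (- i)\<close> = x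
  (\<alpha> - \<beta>). The right side does not depend on m, so
  \<open>a * k i (- i) = 0\<close>.\<close>

lemma constraint_PA:
  assumes st: "s + t = 0" and cP: "cP = coeffs_A1 a b" and "a \<noteq> 0"
  shows "\<alpha> = \<beta>"
proof -
  define i where "i = \<lceil>\<bar>Re s\<bar> + 3\<rceil>"
  have i: "Re s + of_int i > 2"
    unfolding i_def by linarith
  define x where "x = s + of_int i"
  have "(a + b) * k i (- i) = x * (\<alpha> - \<beta>)" "(a * 4 + b * 2) * k i (- i) = x * 2 * (\<alpha> - \<beta>)"
    using at_weight_0[OF st, of 1 i] at_weight_0[OF st, of 2 i] i
    by (simp_all add: cP coeffs_A1_def x_def)
  then have "2 * a * (x * (\<alpha> - \<beta>)) = 0" by algebra
  moreover have "x \<noteq> 0"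
    using i unfolding x_def by (intro Re_pos_nz) simp
  ultimately show ?thesis using \<open>a \<noteq> 0\<close> by simp
qed

text \<open>No arrow leaves weight 0 in \<open>coeffs_B1\<close>, which gives \<alpha> = \<beta> at
  once. Entering weight 0 from -1 by L_1 and from 1 by L_{-1} yields two equations with the same two
  unknowns and opposite signs; their sum is \<open>2 * (a * \<alpha>) = 0\<close>.\<close>

lemma constraint_PB:
  assumes st: "s + t = 0" and cP: "cP = coeffs_B1 a b"
  shows "\<alpha> = \<beta>" "a * \<alpha> = 0"
proof -
  define i where "i = \<lceil>\<bar>Re s\<bar> + 3\<rceil>"
  have i: "Re s + of_int i > 2"
    unfolding i_def by linarith
  define x where "x = s + of_int i"
  have x: "x \<noteq> 0" "x + 1 \<noteq> 0"
    using i unfolding x_def by (intro Re_pos_nz; simp)+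
  have "0 = x * (\<alpha> - \<beta>)"
    using at_weight_0[OF st, of 1 i] i by (simp add: cP coeffs_B1_def x_def)
  then show eq: "\<alpha> = \<beta>" using x by simp
  have t: "t = - s" using st by (simp add: eq_neg_iff_add_eq_0 add.commute)
  have nz: "s + of_int i \<noteq> 0" "s + of_int (i + 1) \<noteq> 0" "t + of_int (- i) \<noteq> 0" "t + of_int (- i - 1) \<noteq> 0"
  proof -
    have "s + of_int (i + 1) = x + 1" "t + of_int (- i) = - x" "t + of_int (- i - 1) = - (x + 1)"
      by (simp_all add: t x_def)
    then show "s + of_int (i + 1) \<noteq> 0" "t + of_int (- i) \<noteq> 0" "t + of_int (- i - 1) \<noteq> 0"
      using x by (simp_all only: neg_equal_0_iff_equal not_False_eq_True)
  qed (use x in \<open>simp add: x_def\<close>)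
  have v: "k i (- i - 1) = - \<alpha>" "k (i + 1) (- i) = \<alpha>"
    using germ[OF nz(1,4)] germ[OF nz(2,3)] by (simp_all add: t eq algebra_simps)
  have c: "cM 1 i = x" "cN 1 (- i - 1) = - x - 1" "cM (- 1) (i + 1) = x + 1" "cN (- 1) (- i) = - x"
    using form0D[OF fM nz(1,2)] form0D[OF fM nz(2), of "- 1"] form0D[OF fN nz(4), of 1]
      form0D[OF fN nz(3) nz(4)[unfolded diff_conv_add_uminus]] nz by (simp_all add: x_def t)
  have idx: "i + (- i - 1) = - 1" "- i - 1 + 1 = - i" "i + 1 + - i = 1" "i + 1 + - 1 = i" "- i + - 1 = - i - 1"
    by simp_all
  have cP1: "cP 1 (- 1) = - (a + b)" "cP (- 1) 1 = a - b"
    by (simp_all add: cP coeffs_B1_def)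
  have "- (a + b) * - \<alpha> = x * k (i + 1) (- i - 1) + (- x - 1) * k i (- i)"
    using equivariantD[OF k, of 1 i "- i - 1"] by (simp only: idx c v cP1)
  moreover have "(a - b) * \<alpha> = (x + 1) * k i (- i) + - x * k (i + 1) (- i - 1)"
    using equivariantD[OF k, of "- 1" "i + 1" "- i"] by (simp only: idx c v cP1)
  ultimately have "2 * (a * \<alpha>) = 0" by algebra
  then show "a * \<alpha> = 0" by simp
qed

end

section \<open>The exceptional triples\<close>

text \<open>Formulated for coefficients instead of modules, so that exchanging the two factors is
  only a transposition of the array.\<close>

definition one_dim_germs ::
  "(int \<Rightarrow> int \<Rightarrow> complex) \<Rightarrow> (int \<Rightarrow> int \<Rightarrow> complex) \<Rightarrow> (int \<Rightarrow> int \<Rightarrow> complex) \<Rightarrow> bool" where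
  "one_dim_germs cM cN cP \<longleftrightarrow>
     (\<exists>b. equivariant cM cN cP b \<and> \<not> germ_zero b \<and>
       (\<forall>k. equivariant cM cN cP k \<longrightarrow> (\<exists>a. germ_zero (\<lambda>i j. k i j - a * b i j))))"

lemma one_dim_germs_swap:
  assumes "one_dim_germs cM cN cP" shows "one_dim_germs cN cM cP"
proof -
  obtain b where b: "equivariant cM cN cP b" "\<not> germ_zero b"
    "\<And>k. equivariant cM cN cP k \<Longrightarrow> \<exists>a. germ_zero (\<lambda>i j. k i j - a * b i j)"
    using assms unfolding one_dim_germs_def by blast
  have "\<exists>a. germ_zero (\<lambda>i j. k i j - a * b j i)" if k: "equivariant cN cM cP k" for k
  proof -
    obtain a where "germ_zero (\<lambda>i j. k j i - a * b i j)"
      using b(3)[OF equivariant_swap[OF k]] by blast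
    then show ?thesis
      using germ_zero_swap[of "\<lambda>i j. k i j - a * b j i"] by blast
  qed
  then show ?thesis
    unfolding one_dim_germs_def
    using equivariant_swap[OF b(1)] b(2) germ_zero_swap[of b] by blast
qed

lemma (in graded_triple) Bbar_has_dim_1:
  assumes "r = s + t" "one_dim_germs cM cN cP"
  shows "Bbar_has_dim M N P 1"
proof -
  obtain b where b: "equivariant cM cN cP b" "\<not> germ_zero b"
    "\<And>k. equivariant cM cN cP k \<Longrightarrow> \<exists>a. germ_zero (\<lambda>i j. k i j - a * b i j)"
    using assms(2) unfolding one_dim_germs_def by blast
  show ?thesis
  proof (rule Bbar_has_dim_of_germs[OF assms(1), where b = "\<lambda>_. b"])
    show "\<exists>a. germ_zero (\<lambda>i j. k i j - (\<Sum>l<1::nat. a l * b i j))" if k: "equivariant cM cN cP k" for k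
    proof -
      obtain a where "germ_zero (\<lambda>i j. k i j - a * b i j)"
        using b(3)[OF k] by blast
      then show ?thesis
        by (intro exI[of _ "\<lambda>_. a"]) simp
    qed
    show "\<forall>l<1::nat. a l = 0" if "germ_zero (\<lambda>i j. \<Sum>l<1::nat. a l * b i j)" for a
    proof -
      have "a 0 = 0"
      proof (rule ccontr)
        assume "a 0 \<noteq> 0"
        then have "germ_zero b"
          using that by (simp add: germ_zero_def)
        then show False using b(2) by simp
      qed
      then show ?thesis by simp
    qed
  qed (rule b(1))
qed

lemma germ_zero_linear:
  assumes "germ_zero (\<lambda>i j. p * (s + of_int i) + q * (t + of_int j))"
  shows "p = 0" "q = 0"
proof -
  obtain X where X: "\<And>i j. i \<ge> X \<Longrightarrow> j \<ge> X \<Longrightarrow> p * (s + of_int i) + q * (t + of_int j) = 0"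
    using assms by (auto simp: germ_zero_def)
  show "p = 0" using X[of X X] X[of "X + 1" X] by (simp add: algebra_simps)
  show "q = 0" using X[of X X] X[of X "X + 1"] by (simp add: algebra_simps)
qed

lemma germ_zero_scale: "germ_zero k \<Longrightarrow> germ_zero (\<lambda>i j. a * k i j)"
  by (auto simp: germ_zero_def)

text \<open>The map \<open>b\<close> has germ (p, q), and the weight-0 constraints need only place
  every (\<alpha>, \<beta>) on the line through it. Only the germ of \<open>b\<close> is prescribed,
  since its values at weight 0 may deviate from the linear formula.\<close>

lemma one_dim_germsI:
  assumes forms: "form0 s cM" "form0 t cN" "form1 (s + t) cP"
    and b: "equivariant cM cN cP b"
      "germ_zero (\<lambda>i j. b i j - (p * (s + of_int i) + q * (t + of_int j)))" "(p, q) \<noteq> (0, 0)"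
    and germs: "\<And>k \<alpha> \<beta>. equivariant_germ s t cM cN cP k \<alpha> \<beta> \<Longrightarrow> \<exists>a. \<alpha> = a * p \<and> \<beta> = a * q"
  shows "one_dim_germs cM cN cP"
  unfolding one_dim_germs_def
proof (intro exI[of _ b] conjI allI impI)
  show "\<not> germ_zero b"
  proof
    assume "germ_zero b"
    from germ_zero_add[OF this germ_zero_scale[OF b(2), of "- 1"]]
    have "germ_zero (\<lambda>i j. p * (s + of_int i) + q * (t + of_int j))" by simp
    then show False using germ_zero_linear b(3) by blast
  qed
  fix k assume k: "equivariant cM cN cP k"
  interpret equivariant_forms s t cM cN cP k
    by unfold_locales (fact forms k)+
  obtain \<alpha> \<beta> where "\<And>i j. s + of_int i \<noteq> 0 \<Longrightarrow> t + of_int j \<noteq> 0 \<Longrightarrow> s + t + of_int (i + j) \<noteq> 0 \<Longrightarrow>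
      k i j = \<alpha> * (s + of_int i) + \<beta> * (t + of_int j)"
    by (rule germ_form) (rule that)
  then interpret equivariant_germ s t cM cN cP k \<alpha> \<beta>
    by unfold_locales
  obtain a where a: "\<alpha> = a * p" "\<beta> = a * q"
    using germs[OF equivariant_germ_axioms] by blast
  have "germ_zero (\<lambda>i j. k i j - a * b i j)"
    using germ_zero_add[OF germ_zero_diff germ_zero_scale[OF b(2), of "- a"]]
    by (simp add: a algebra_simps)
  then show "\<exists>a. germ_zero (\<lambda>i j. k i j - a * b i j)" by blast
qed (rule b(1))

abbreviation coeffs_Omega :: "complex \<Rightarrow> complex \<Rightarrow> int \<Rightarrow> int \<Rightarrow> complex" where
  "coeffs_Omega d s \<equiv> \<lambda>m n. of_int m * d + (s + of_int n)"

lemma triple_i_dim: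
  fixes M :: "'m::ab_group_add wmod" and N :: "'n::ab_group_add wmod" and P :: "'p::ab_group_add wmod"
  assumes "triple_i M N P" shows "Bbar_has_dim M N P 2"
proof -
  obtain s t where iso: "M \<cong>\<^sub>W Omega 0 s" "N \<cong>\<^sub>W Omega 0 t" "P \<cong>\<^sub>W Omega 1 (s + t)"
    using assms by (auto simp: triple_i_def)
  interpret graded_triple M N P "coeffs_Omega 0 s" "coeffs_Omega 0 t" "coeffs_Omega 1 (s + t)" s t "s + t"
    by unfold_locales (use iso in \<open>simp_all add: Omega_eq_graded\<close>)
  \<comment> \<open>The coefficients of g df for \<open>l = 0\<close> and of f dg for
    \<open>l = 1\<close>.\<close>
  define b where "b l i j = (if l = 0 then s + of_int i else t + of_int j)" for l :: nat and i j :: int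
  show ?thesis
  proof (rule Bbar_has_dim_of_germs[OF refl, where b = b])
    show "equivariant (coeffs_Omega 0 s) (coeffs_Omega 0 t) (coeffs_Omega 1 (s + t)) (b l)" for l
      by (simp add: equivariant_def b_def algebra_simps)
    show "\<exists>a. germ_zero (\<lambda>i j. k i j - (\<Sum>l<2. a l * b l i j))"
      if "equivariant (coeffs_Omega 0 s) (coeffs_Omega 0 t) (coeffs_Omega 1 (s + t)) k" for k
    proof -
      interpret equivariant_forms s t "coeffs_Omega 0 s" "coeffs_Omega 0 t" "coeffs_Omega 1 (s + t)" k
        by unfold_locales (fact form0_Omega form1_Omega that)+
      obtain \<alpha> \<beta> where "\<And>i j. s + of_int i \<noteq> 0 \<Longrightarrow> t + of_int j \<noteq> 0 \<Longrightarrow> s + t + of_int (i + j) \<noteq> 0 \<Longrightarrow>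
          k i j = \<alpha> * (s + of_int i) + \<beta> * (t + of_int j)"
        by (rule germ_form) (rule that)
      then interpret equivariant_germ s t "coeffs_Omega 0 s" "coeffs_Omega 0 t" "coeffs_Omega 1 (s + t)" k \<alpha> \<beta>
        by unfold_locales
      show ?thesis
        using germ_zero_diff
        by (intro exI[of _ "\<lambda>l. if l = 0 then \<alpha> else \<beta>"]) (simp add: b_def numeral_2_eq_2)
    qed
    show "\<forall>l<2. a l = 0" if "germ_zero (\<lambda>i j. \<Sum>l<2. a l * b l i j)" for a
    proof -
      have "germ_zero (\<lambda>i j. a 0 * (s + of_int i) + a 1 * (t + of_int j))"
        using that by (simp add: b_def numeral_2_eq_2)
      from germ_zero_linear[OF this] show ?thesis
        by (auto simp: less_2_cases_iff)
    qed
  qed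
qed

lemma not_infinity_pointD:
  assumes "(a, b) \<noteq> (0, 0)" "\<not> same_point (a, b) infinity_point" shows "a \<noteq> 0"
proof
  assume "a = 0"
  then have "b \<noteq> 0" using assms(1) by simp
  then have "same_point (a, b) infinity_point"
    using \<open>a = 0\<close> by (auto simp: same_point_def infinity_point_def intro: exI[of _ "1 / b"])
  then show False using assms(2) by simp
qed

lemma not_infinity_pointI: "a \<noteq> 0 \<Longrightarrow> \<not> same_point (a, b) infinity_point"
  by (simp add: same_point_def infinity_point_def)

lemma triple_ii_germs:
  fixes M :: "'m::ab_group_add wmod" and N :: "'n::ab_group_add wmod" and P :: "'p::ab_group_add wmod"
  assumes "triple_ii M N P"
  obtains cM cN cP s t where "graded_triple M N P cM cN cP s t (s + t)" "one_dim_germs cM cN cP"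
proof -
  consider (1) s where "M \<cong>\<^sub>W Omega 0 s" "N \<cong>\<^sub>W Omega 0 (- s)" "P \<cong>\<^sub>W Omega 0 0"
    | (2) s where "M \<cong>\<^sub>W Omega 0 s" "N \<cong>\<^sub>W Omega 1 0" "P \<cong>\<^sub>W Omega 1 s"
    | (3) s a b where "a \<noteq> 0" "M \<cong>\<^sub>W Omega 0 s" "N \<cong>\<^sub>W Omega 0 (- s)" "P \<cong>\<^sub>W A_mod (a, b)"
    | (4) s a b where "a \<noteq> 0" "M \<cong>\<^sub>W B_mod (a, b)" "N \<cong>\<^sub>W Omega 0 s" "P \<cong>\<^sub>W Omega 1 s"
  proof -
    from assms show thesis
      unfolding triple_ii_def
    proof (elim disjE exE conjE)
      fix s and \<xi> :: "complex \<times> complex"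
      assume \<xi>: "\<xi> \<noteq> (0, 0)" "\<not> same_point \<xi> infinity_point"
      obtain a b where ab: "\<xi> = (a, b)" by (cases \<xi>)
      have a: "a \<noteq> 0" using not_infinity_pointD \<xi> unfolding ab by blast
      show thesis if "M \<cong>\<^sub>W Omega 0 s" "N \<cong>\<^sub>W Omega 0 (- s)" "P \<cong>\<^sub>W A_mod \<xi>"
        using 3[OF a] that unfolding ab by blast
      show thesis if "M \<cong>\<^sub>W B_mod \<xi>" "N \<cong>\<^sub>W Omega 0 s" "P \<cong>\<^sub>W Omega 1 s"
        using 4[OF a] that unfolding ab by blast
    qed (fact 1 2)+
  qed
  then show thesis
  proof cases
    case 1
    have "P \<cong>\<^sub>W graded_module (coeffs_B1 0 1)"
      using witt_iso_trans[OF witt_iso_trans[OF 1(3) witt_iso_sym[OF B_mod_0_iso_Omega]] B_mod_iso_B1]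
      by simp
    then have "graded_triple M N P (coeffs_Omega 0 s) (coeffs_Omega 0 (- s)) (coeffs_B1 0 1) s (- s) (s + - s)"
      by unfold_locales (use 1 in \<open>simp_all add: Omega_eq_graded coeffs_weight\<close>)
    moreover have "one_dim_germs (coeffs_Omega 0 s) (coeffs_Omega 0 (- s)) (coeffs_B1 0 1)"
    proof (rule one_dim_germsI[where s = s and t = "- s" and p = 1 and q = 1])
      \<comment> \<open>The product fg. The target Omega^0_0 is presented in the basis of
        \<open>coeffs_B1 0 1\<close>, where the coefficient becomes the weight \<open>i + j\<close>,
        and -1 at weight 0 because of the rescaling there.\<close>
      let ?b = "\<lambda>i j :: int. if i + j = 0 then - 1 else of_int (i + j) :: complex"
      show "equivariant (coeffs_Omega 0 s) (coeffs_Omega 0 (- s)) (coeffs_B1 0 1) ?b"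
        unfolding equivariant_def
      proof (intro allI)
        fix m i j :: int
        define z where "z = i + j"
        have "coeffs_Omega 0 s m i * ?b (i + m) j + coeffs_Omega 0 (- s) m j * ?b i (j + m) =
            of_int z * (if z + m = 0 then - 1 else of_int (z + m))"
          by (simp add: z_def algebra_simps)
        also have "\<dots> = coeffs_B1 0 1 m z * (if z = 0 then - 1 else of_int z)"
          by (auto simp: coeffs_B1_def)
        finally show "coeffs_B1 0 1 m (i + j) * ?b i j =
          coeffs_Omega 0 s m i * ?b (i + m) j + coeffs_Omega 0 (- s) m j * ?b i (j + m)"
          by (simp add: z_def)
      qed
      show "germ_zero (\<lambda>i j. ?b i j - (1 * (s + of_int i) + 1 * (- s + of_int j)))"
        unfolding germ_zero_def by (intro exI[of _ 1]) auto
      fix k \<alpha> \<beta>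
      assume "equivariant_germ s (- s) (coeffs_Omega 0 s) (coeffs_Omega 0 (- s)) (coeffs_B1 0 1) k \<alpha> \<beta>"
      then interpret equivariant_germ s "- s" "coeffs_Omega 0 s" "coeffs_Omega 0 (- s)" "coeffs_B1 0 1" k \<alpha> \<beta> .
      show "\<exists>a. \<alpha> = a * 1 \<and> \<beta> = a * 1"
        using constraint_PB[OF _ refl] by simp
    qed (use form0_Omega[of s] form0_Omega[of "- s"] form1_B1 in simp_all)
    ultimately show ?thesis by (rule that)
  next
    case 2
    have "N \<cong>\<^sub>W graded_module (coeffs_A0 0 1)"
      using witt_iso_trans[OF witt_iso_trans[OF 2(2) witt_iso_sym[OF A_mod_0_iso_Omega]] A_mod_iso_A0]
      by simp
    then have "graded_triple M N P (coeffs_Omega 0 s) (coeffs_A0 0 1) (coeffs_Omega 1 s) s 0 (s + 0)"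
      by unfold_locales (use 2 in \<open>simp_all add: Omega_eq_graded coeffs_weight\<close>)
    moreover have "one_dim_germs (coeffs_Omega 0 s) (coeffs_A0 0 1) (coeffs_Omega 1 s)"
    proof (rule one_dim_germsI[where s = s and t = 0 and p = 0 and q = 1])
      \<comment> \<open>The product of a function and a one-form. In the Omega^0-like basis of
        \<open>coeffs_A0 0 1\<close> it becomes multiplication by \<open>j\<close>, with 1 at the
        unscaled vector of weight 0.\<close>
      let ?b = "\<lambda>i j :: int. if j = 0 then 1 else of_int j :: complex"
      show "equivariant (coeffs_Omega 0 s) (coeffs_A0 0 1) (coeffs_Omega 1 s) ?b"
        unfolding equivariant_def
      proof (intro allI)
        fix m i j :: int
        have "coeffs_A0 0 1 m j * ?b i (j + m) = (of_int j + of_int m) * ?b i j"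
          by (auto simp: coeffs_A0_def add_eq_0_iff)
        then show "coeffs_Omega 1 s m (i + j) * ?b i j =
          coeffs_Omega 0 s m i * ?b (i + m) j + coeffs_A0 0 1 m j * ?b i (j + m)"
          by (simp add: algebra_simps)
      qed
      show "germ_zero (\<lambda>i j. ?b i j - (0 * (s + of_int i) + 1 * (0 + of_int j)))"
        unfolding germ_zero_def by (intro exI[of _ 1]) auto
      fix k \<alpha> \<beta>
      assume "equivariant_germ s 0 (coeffs_Omega 0 s) (coeffs_A0 0 1) (coeffs_Omega 1 s) k \<alpha> \<beta>"
      from equivariant_germ.constraint_A(1)[OF equivariant_germ.swapped_germ[OF this] refl refl]
      show "\<exists>a. \<alpha> = a * 0 \<and> \<beta> = a * 1"
        by simp
    qed (use form0_Omega form1_Omega form0_A0 in simp_all)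
    ultimately show ?thesis by (rule that)
  next
    case 3
    have "graded_triple M N P (coeffs_Omega 0 s) (coeffs_Omega 0 (- s)) (coeffs_A1 a b) s (- s) (s + - s)"
      by unfold_locales (use 3 in \<open>simp_all add: Omega_eq_graded A_mod_eq_A1 coeffs_weight\<close>)
    moreover have "one_dim_germs (coeffs_Omega 0 s) (coeffs_Omega 0 (- s)) (coeffs_A1 a b)"
    proof (rule one_dim_germsI[where s = s and t = "- s" and p = 1 and q = 1])
      let ?b = "\<lambda>i j :: int. of_int (i + j) :: complex"
      show "equivariant (coeffs_Omega 0 s) (coeffs_Omega 0 (- s)) (coeffs_A1 a b) ?b"
        unfolding equivariant_def
      proof (intro allI)
        fix m i j :: int
        define z where "z = i + j"
        have "coeffs_Omega 0 s m i * ?b (i + m) j + coeffs_Omega 0 (- s) m j * ?b i (j + m) =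
            of_int z * of_int (z + m)"
          by (simp add: z_def algebra_simps)
        also have "\<dots> = coeffs_A1 a b m z * of_int z"
          by (auto simp: coeffs_A1_def)
        finally show "coeffs_A1 a b m (i + j) * ?b i j =
          coeffs_Omega 0 s m i * ?b (i + m) j + coeffs_Omega 0 (- s) m j * ?b i (j + m)"
          by (simp add: z_def)
      qed
      show "germ_zero (\<lambda>i j. ?b i j - (1 * (s + of_int i) + 1 * (- s + of_int j)))"
        unfolding germ_zero_def by (intro exI[of _ 1]) auto
      fix k \<alpha> \<beta>
      assume "equivariant_germ s (- s) (coeffs_Omega 0 s) (coeffs_Omega 0 (- s)) (coeffs_A1 a b) k \<alpha> \<beta>"
      then interpret equivariant_germ s "- s" "coeffs_Omega 0 s" "coeffs_Omega 0 (- s)" "coeffs_A1 a b" k \<alpha> \<beta> .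
      show "\<exists>a. \<alpha> = a * 1 \<and> \<beta> = a * 1"
        using constraint_PA[OF _ refl 3(1)] by simp
    qed (use form0_Omega[of s] form0_Omega[of "- s"] form1_A1 in simp_all)
    ultimately show ?thesis by (rule that)
  next
    case 4
    have "graded_triple M N P (coeffs_B0 a b) (coeffs_Omega 0 s) (coeffs_Omega 1 s) 0 s (0 + s)"
      by unfold_locales (use 4 in \<open>simp_all add: Omega_eq_graded B_mod_eq_B0 coeffs_weight\<close>)
    moreover have "one_dim_germs (coeffs_B0 a b) (coeffs_Omega 0 s) (coeffs_Omega 1 s)"
    proof (rule one_dim_germsI[where s = 0 and t = s and p = 1 and q = 0])
      \<comment> \<open>The map g df. It annihilates weight 0 of the first factor, so the arrows of
        B_\<xi> into weight 0, which carry the parameter, have no effect.\<close>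
      let ?b = "\<lambda>i j :: int. of_int i :: complex"
      show "equivariant (coeffs_B0 a b) (coeffs_Omega 0 s) (coeffs_Omega 1 s) ?b"
        unfolding equivariant_def
      proof (intro allI)
        fix m i j :: int
        have "coeffs_B0 a b m i * of_int (i + m) = of_int i * (of_int i + of_int m)"
          by (auto simp: coeffs_B0_def add.commute[of i] add_eq_0_iff)
        then show "coeffs_Omega 1 s m (i + j) * ?b i j =
          coeffs_B0 a b m i * ?b (i + m) j + coeffs_Omega 0 s m j * ?b i (j + m)"
          by (simp add: algebra_simps)
      qed
      show "germ_zero (\<lambda>i j. ?b i j - (1 * (0 + of_int i) + 0 * (s + of_int j)))"
        unfolding germ_zero_def by (intro exI[of _ 1]) auto
      fix k \<alpha> \<beta>
      assume "equivariant_germ 0 s (coeffs_B0 a b) (coeffs_Omega 0 s) (coeffs_Omega 1 s) k \<alpha> \<beta>"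
      from equivariant_germ.constraint_B[OF this refl refl 4(1)]
      show "\<exists>a. \<alpha> = a * 1 \<and> \<beta> = a * 0"
        by simp
    qed (use form0_Omega form1_Omega form0_B0 in simp_all)
    ultimately show ?thesis by (rule that)
  qed
qed

lemma graded_triple_swap:
  "graded_triple M N P cM cN cP s t r \<Longrightarrow> graded_triple N M P cN cM cP t s r"
  by (simp add: graded_triple_def)

lemma triple_ii_dim:
  assumes "triple_ii M N P \<or> triple_ii N M P" shows "Bbar_has_dim M N P 1"
  using assms
proof
  assume "triple_ii M N P"
  then obtain cM cN cP s t where "graded_triple M N P cM cN cP s t (s + t)" "one_dim_germs cM cN cP"
    by (rule triple_ii_germs)
  then show ?thesis
    by (intro graded_triple.Bbar_has_dim_1) simp_all
next
  assume "triple_ii N M P"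
  then obtain cM cN cP s t where g: "graded_triple N M P cN cM cP t s (t + s)" "one_dim_germs cN cM cP"
    by (rule triple_ii_germs)
  show ?thesis
    by (rule graded_triple.Bbar_has_dim_1[OF graded_triple_swap[OF g(1)] add.commute
          one_dim_germs_swap[OF g(2)]])
qed

section \<open>Normal forms and the vanishing case\<close>

definition normal_factor :: "'m::ab_group_add wmod \<Rightarrow> complex \<Rightarrow> (int \<Rightarrow> int \<Rightarrow> complex) \<Rightarrow> bool" where
  "normal_factor M s c \<longleftrightarrow>
     M \<cong>\<^sub>W Omega 0 s \<and> c = coeffs_Omega 0 s \<or>
     s = 0 \<and> (\<exists>a b. (a, b) \<noteq> (0, 0) \<and> M \<cong>\<^sub>W A_mod (a, b) \<and> c = coeffs_A0 a b) \<or>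
     s = 0 \<and> (\<exists>a b. a \<noteq> 0 \<and> M \<cong>\<^sub>W B_mod (a, b) \<and> c = coeffs_B0 a b)"

text \<open>The restrictions on \<open>a\<close> and \<open>b\<close> reflect the different basic
  forms: a factor Omega^1_0 appears as A_{0,b} and a target Omega^0_0 as B_{0,b}, whereas B_{0,b} as
  a factor and A_{0,b} as a target already are the generic Omega^0_0 and Omega^1_0.\<close>

definition normal_target :: "'m::ab_group_add wmod \<Rightarrow> complex \<Rightarrow> (int \<Rightarrow> int \<Rightarrow> complex) \<Rightarrow> bool" where
  "normal_target P r c \<longleftrightarrow>
     P \<cong>\<^sub>W Omega 1 r \<and> c = coeffs_Omega 1 r \<or>
     r = 0 \<and> (\<exists>a b. a \<noteq> 0 \<and> P \<cong>\<^sub>W A_mod (a, b) \<and> c = coeffs_A1 a b) \<or>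
     r = 0 \<and> (\<exists>a b. (a, b) \<noteq> (0, 0) \<and> P \<cong>\<^sub>W B_mod (a, b) \<and> c = coeffs_B1 a b)"

lemma normal_factor_graded:
  assumes "normal_factor M s c"
  shows "M \<cong>\<^sub>W graded_module c" "c 0 n = s + of_int n" "form0 s c"
  using assms witt_iso_trans[OF _ A_mod_iso_A0]
  by (auto simp: normal_factor_def Omega_eq_graded B_mod_eq_B0 coeffs_weight
      form0_Omega[simplified] form0_A0 form0_B0)

lemma normal_target_graded:
  assumes "normal_target P r c"
  shows "P \<cong>\<^sub>W graded_module c" "c 0 n = r + of_int n" "form1 r c"
  using assms witt_iso_trans[OF _ B_mod_iso_B1]
  by (auto simp: normal_target_def Omega_eq_graded A_mod_eq_A1 coeffs_weight
      form1_Omega[simplified] form1_A1 form1_B1)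

lemma Omega_shift: "s' - s \<in> \<int> \<Longrightarrow> M \<cong>\<^sub>W Omega d s \<Longrightarrow> M \<cong>\<^sub>W Omega d s'"
proof -
  assume "s' - s \<in> \<int>" and M: "M \<cong>\<^sub>W Omega d s"
  then obtain k where "s' - s = of_int k" by (auto elim: Ints_cases)
  then have "s' = s + of_int k" by (simp add: algebra_simps)
  then show ?thesis
    using witt_iso_trans[OF M witt_iso_sym[OF Omega_representative]] by simp
qed

text \<open>A nonzero \<open>s\<close> leaves only the density module, and there the representative
  of the coset can be changed; this is needed to turn a congruence of weights into
  \<open>r = s + t\<close>.\<close>

lemma normal_factor_shift:
  assumes "normal_factor M s c" "s \<noteq> 0" "s' - s \<in> \<int>"
  shows "normal_factor M s' (coeffs_Omega 0 s')"
  using assms Omega_shift[OF assms(3)] by (auto simp: normal_factor_def)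

lemma normal_target_shift:
  assumes "normal_target M s c" "s \<noteq> 0" "s' - s \<in> \<int>"
  shows "normal_target M s' (coeffs_Omega 1 s')"
  using assms Omega_shift[OF assms(3)] by (auto simp: normal_target_def)

lemma class_S_normal_factor:
  fixes M :: "'m::ab_group_add wmod"
  assumes M: "class_S M" "indecomposable M" "deg M = {0, 1}"
  obtains s c where "s = 0 \<or> s \<notin> \<int>" "normal_factor M s c"
  using M
proof (cases rule: class_S_degree_01_cases)
  case (Omega s)
  then show ?thesis using that[of s] by (auto simp: normal_factor_def)
next
  case (A a b)
  then show ?thesis using that[of 0 "coeffs_A0 a b"] unfolding normal_factor_def by blast
next
  case (B a b)
  then show ?thesis using that[of 0 "coeffs_B0 a b"] unfolding normal_factor_def by blast
qed

lemma class_S_normal_target: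
  fixes P :: "'m::ab_group_add wmod"
  assumes P: "class_S P" "indecomposable P" "deg P = {0, 1}"
  obtains r c where "r = 0 \<or> r \<notin> \<int>" "normal_target P r c"
  using P
proof (cases rule: class_S_degree_01_cases)
  case (Omega s)
  show ?thesis
  \<comment> \<open>As a target Omega^0_0 is not generic and has to enter as B_{0,1}; for a
    nonintegral coset it may be replaced by Omega^1.\<close>
  proof (cases "s = 0")
    case True
    have "P \<cong>\<^sub>W B_mod (0, 1)"
      using witt_iso_trans[OF Omega(2)[unfolded True] witt_iso_sym[OF B_mod_0_iso_Omega[of 1]]] by simp
    moreover have "(0::complex, 1::complex) \<noteq> (0, 0)" by simp
    ultimately have "normal_target P 0 (coeffs_B1 0 1)"
      unfolding normal_target_def by blast
    then show ?thesis using that by blast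
  next
    case False
    then have "s \<notin> \<int>" using Omega by simp
    then have "P \<cong>\<^sub>W Omega 1 s"
      using Omega witt_iso_trans[OF _ witt_iso_sym[OF Omega_1_iso_Omega_0]] by simp
    then show ?thesis using that[of s] \<open>s \<notin> \<int>\<close> by (auto simp: normal_target_def)
  qed
next
  case (A a b)
  show ?thesis
  proof (cases "a = 0")
    case True
    then have "P \<cong>\<^sub>W Omega 1 0"
      using A witt_iso_trans[OF _ A_mod_0_iso_Omega] by simp
    then show ?thesis using that[of 0] by (auto simp: normal_target_def)
  next
    case False
    then show ?thesis using A that[of 0 "coeffs_A1 a b"] unfolding normal_target_def by blast
  qed
next
  case (B a b)
  then have "(a, b) \<noteq> (0, 0)" by simp
  then show ?thesis using B that[of 0 "coeffs_B1 a b"] unfolding normal_target_def by blast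
qed

text \<open>For \<open>A_mod\<close> a nonzero germ forces \<open>a = 0\<close>, so the module is
  Omega^1_0, and then b \<beta> = 0 gives \<beta> = 0. For \<open>B_mod\<close> the parameter may be
  any finite point, but again \<beta> = 0.\<close>

lemma normal_factor_constraint:
  assumes g: "equivariant_germ s t cM cN cP k \<alpha> \<beta>" and M: "normal_factor M s cM"
    and nz: "\<alpha> \<noteq> 0 \<or> \<beta> \<noteq> 0"
  shows "M \<cong>\<^sub>W Omega 0 s \<or> \<beta> = 0 \<and> s = 0 \<and> (M \<cong>\<^sub>W Omega 1 0 \<or>
    (\<exists>\<xi>. \<xi> \<noteq> (0, 0) \<and> \<not> same_point \<xi> infinity_point \<and> M \<cong>\<^sub>W B_mod \<xi>))"
  using M unfolding normal_factor_def
proof (elim disjE conjE exE)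
  fix a b assume s: "s = 0" and ab: "(a, b) \<noteq> (0, 0)" and M: "M \<cong>\<^sub>W A_mod (a, b)" and c: "cM = coeffs_A0 a b"
  have "\<beta> = 0" "a = 0" "b \<noteq> 0"
    using equivariant_germ.constraint_A[OF g s c] ab nz by auto
  then show ?thesis
    using M s witt_iso_trans[OF M[unfolded \<open>a = 0\<close>] A_mod_0_iso_Omega] by blast
next
  fix a b assume s: "s = 0" and a: "a \<noteq> 0" and M: "M \<cong>\<^sub>W B_mod (a, b)" and c: "cM = coeffs_B0 a b"
  then show ?thesis
    using equivariant_germ.constraint_B[OF g s c a] not_infinity_pointI[OF a]
    by (intro disjI2 conjI exI[of _ "(a, b)"]) auto
qed simp

lemma normal_target_constraint:
  assumes g: "equivariant_germ s t cM cN cP k \<alpha> \<beta>" and P: "normal_target P (s + t) cP"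
    and nz: "\<alpha> \<noteq> 0 \<or> \<beta> \<noteq> 0"
  shows "P \<cong>\<^sub>W Omega 1 (s + t) \<or> \<alpha> = \<beta> \<and> s + t = 0 \<and> (P \<cong>\<^sub>W Omega 0 0 \<or>
    (\<exists>\<xi>. \<xi> \<noteq> (0, 0) \<and> \<not> same_point \<xi> infinity_point \<and> P \<cong>\<^sub>W A_mod \<xi>))"
  using P unfolding normal_target_def
proof (elim disjE conjE exE)
  fix a b assume s: "s + t = 0" and a: "a \<noteq> 0" and P: "P \<cong>\<^sub>W A_mod (a, b)" and c: "cP = coeffs_A1 a b"
  then show ?thesis
    using equivariant_germ.constraint_PA[OF g s c a] not_infinity_pointI[OF a]
    by (intro disjI2 conjI exI[of _ "(a, b)"]) auto
next
  fix a b assume s: "s + t = 0" and ab: "(a, b) \<noteq> (0, 0)" and P: "P \<cong>\<^sub>W B_mod (a, b)" and c: "cP = coeffs_B1 a b"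
  have "\<alpha> = \<beta>" "a = 0" "b \<noteq> 0"
    using equivariant_germ.constraint_PB[OF g s c] ab nz by auto
  then show ?thesis
    using s witt_iso_trans[OF P[unfolded \<open>a = 0\<close>] B_mod_0_iso_Omega] by blast
qed simp

text \<open>Any two of the lines \<beta> = 0, \<alpha> = 0 and \<alpha> = \<beta> meet only in the
  origin, so a nonzero germ permits at most one of the three modules to be nongeneric. Which one it
  is decides the family.\<close>

lemma nonzero_germ_triple:
  assumes M: "normal_factor M s cM" and N: "normal_factor N t cN" and P: "normal_target P (s + t) cP"
    and k: "equivariant cM cN cP k" and nz: "\<not> germ_zero k"
  shows "triple_i M N P \<or> triple_ii M N P \<or> triple_ii N M P"
proof -
  interpret equivariant_forms s t cM cN cP k
    by unfold_locales (fact normal_factor_graded[OF M] normal_factor_graded[OF N]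
        normal_target_graded[OF P] k)+
  obtain \<alpha> \<beta> where "\<And>i j. s + of_int i \<noteq> 0 \<Longrightarrow> t + of_int j \<noteq> 0 \<Longrightarrow> s + t + of_int (i + j) \<noteq> 0 \<Longrightarrow>
      k i j = \<alpha> * (s + of_int i) + \<beta> * (t + of_int j)"
    by (rule germ_form) (rule that)
  then interpret equivariant_germ s t cM cN cP k \<alpha> \<beta>
    by unfold_locales
  have ab: "\<alpha> \<noteq> 0 \<or> \<beta> \<noteq> 0"
    using germ_zero_diff nz by auto
  note cM = normal_factor_constraint[OF equivariant_germ_axioms M ab]
  note cN = normal_factor_constraint[OF swapped_germ N ab[THEN disj_commute[THEN iffD1]]]
  note cP = normal_target_constraint[OF equivariant_germ_axioms P ab]
  show ?thesis
  proof (cases "M \<cong>\<^sub>W Omega 0 s")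
    case genM: True
    show ?thesis
    proof (cases "N \<cong>\<^sub>W Omega 0 t")
      case genN: True
      show ?thesis
      proof (cases "P \<cong>\<^sub>W Omega 1 (s + t)")
        case True
        then show ?thesis using genM genN unfolding triple_i_def by blast
      next
        case False
        then have "t = - s"
          using cP by (simp add: eq_neg_iff_add_eq_0 add.commute)
        then show ?thesis
          using False cP genM genN unfolding triple_ii_def by blast
      qed
    next
      case False
      then have "\<alpha> = 0" "t = 0" using cN by auto
      then have "P \<cong>\<^sub>W Omega 1 s"
        using cP ab by auto
      then show ?thesis
        using False cN genM unfolding triple_ii_def by blast
    qed
  next
    case False
    then have "\<beta> = 0" "s = 0" using cM by auto
    then have "P \<cong>\<^sub>W Omega 1 t" "N \<cong>\<^sub>W Omega 0 t"
      using cP cN ab by auto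
    then show ?thesis
      using False cM unfolding triple_ii_def by blast
  qed
qed

lemma Bbar_zero:
  fixes M :: "'m::ab_group_add wmod" and N :: "'n::ab_group_add wmod" and P :: "'p::ab_group_add wmod"
  assumes M: "class_S M" "indecomposable M" "deg M = {0, 1}"
    and N: "class_S N" "indecomposable N" "deg N = {0, 1}"
    and P: "class_S P" "indecomposable P" "deg P = {0, 1}"
    and no: "\<not> triple_i M N P" "\<not> triple_ii M N P" "\<not> triple_ii N M P"
  shows "Bbar M N P = {bilin_W0 M N P}"
proof -
  obtain s cM where s: "s = 0 \<or> s \<notin> \<int>" and nM: "normal_factor M s cM"
    using M by (rule class_S_normal_factor)
  obtain t cN where t: "t = 0 \<or> t \<notin> \<int>" and nN: "normal_factor N t cN"
    using N by (rule class_S_normal_factor)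
  obtain r cP where r: "r = 0 \<or> r \<notin> \<int>" and nP: "normal_target P r cP"
    using P by (rule class_S_normal_target)
  have triple: "graded_triple M N P cM cN cP s t r"
    if "normal_factor M s cM" "normal_factor N t cN" "normal_target P r cP" for s t r cM cN cP
    by unfold_locales (fact normal_factor_graded[OF that(1)] normal_factor_graded[OF that(2)]
        normal_target_graded[OF that(3)])+
  have match: "Bbar M N P = {bilin_W0 M N P}"
    if n: "normal_factor M s cM" "normal_factor N t cN" "normal_target P (s + t) cP" for s t cM cN cP
    by (rule graded_triple.Bbar_trivial_of_germs[OF triple[OF n] refl])
      (use nonzero_germ_triple[OF n] no in blast)
  show ?thesis
  proof (cases "s + t - r \<in> \<int>")
    case False
    then show ?thesis
      using graded_triple.Bbar_trivial_of_weights[OF triple[OF nM nN nP]] by blast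
  next
    case int: True
    \<comment> \<open>The chosen representatives satisfy \<open>r = s + t\<close> only modulo
      integers. A nonzero \<open>r\<close> or \<open>t\<close> belongs to a density module and can
      be shifted; if both are 0, then \<open>s\<close> is an integer and hence 0.\<close>
    consider "r \<noteq> 0" | "r = 0" "t = 0" | "r = 0" "t \<noteq> 0" by blast
    then show ?thesis
    proof cases
      case 1
      then show ?thesis
        using match[OF nM nN normal_target_shift[OF nP]] int by blast
    next
      case 2
      then have "s = 0" using s int by auto
      then show ?thesis using match[OF nM nN] nP 2 by simp
    next
      case 3
      then have "- s - t \<in> \<int>"
        using int Ints_minus[of "s + t"] by (simp add: algebra_simps)
      then show ?thesis
        using match[OF nM normal_factor_shift[OF nN 3(2)]] nP 3(1) by simp
    qed
  qed
qed

theorem theorem3p2: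
  fixes M :: "'m::ab_group_add wmod"
    and N :: "'n::ab_group_add wmod"
    and P :: "'p::ab_group_add wmod"
  assumes "class_S M" and "indecomposable M" and "deg M = {0, 1}"
    and "class_S N" and "indecomposable N" and "deg N = {0, 1}"
    and "class_S P" and "indecomposable P" and "deg P = {0, 1}"
  shows "(triple_i M N P \<or> triple_i N M P \<longrightarrow> Bbar_has_dim M N P 2) \<and>
    (triple_ii M N P \<or> triple_ii N M P \<longrightarrow> Bbar_has_dim M N P 1) \<and>
    (\<not> (triple_i M N P \<or> triple_i N M P) \<and> \<not> (triple_ii M N P \<or> triple_ii N M P)
      \<longrightarrow> Bbar M N P = {bilin_W0 M N P})"
proof (intro conjI impI)
  assume "triple_i M N P \<or> triple_i N M P"
  then have "triple_i M N P"
    by (auto simp: triple_i_def) (metis add.commute)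
  then show "Bbar_has_dim M N P 2"
    by (rule triple_i_dim)
next
  assume "triple_ii M N P \<or> triple_ii N M P"
  then show "Bbar_has_dim M N P 1"
    by (rule triple_ii_dim)
next
  assume "\<not> (triple_i M N P \<or> triple_i N M P) \<and> \<not> (triple_ii M N P \<or> triple_ii N M P)"
  then show "Bbar M N P = {bilin_W0 M N P}"
    using Bbar_zero[OF assms] by blast
qed

end
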